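(* Let $G$ be a finite connected loopless multigraph, let $L$ be a degree-list assignment of $G$ (that is, $|L(u)|\ge d_G(u)$ for every $u\in V(G)$), and let $\mathcal{M}_L$ be a matching assignment over $L$. Then $G$ does not admit an $\mathcal{M}_L$-coloring if and only if each block of $G$ is isomorphic to $K_n^t$ or $C_n^t$ for some integers $n$ and $t$ (depending on the block) such that all of the following hold. (I) For each vertex $u$ of $G$, the list $L(u)$ has a partition $\{L_B(u) : B \text{ is a block of } G \text{ containing } u\}$ such that for any block $B$ containing $u$, $$|L_B(u)| = \begin{cases} t(n-1) & \text{if } B \text{ is isomorphic to } K_n^t,\\ 2t & \text{if } B \text{ is isomorphic to } C_n^t.\end{cases}$$ (II) If $B$ is a block of $G$ isomorphic to $K_n^t$ for some integers $n$ and $t$, then $\bigcup_{u\in V(B)} \widetilde{L}_B(u)$ induces the graph $H(n,t)$ in the $\mathcal{M}_L$-cover of $G$, where each set $\widetilde{L}_B(u)$ corresponds to $\{(i_u,j,k) : j\in[n-1],\ k\in[t]\}$ for some $i_u\in[n]$. (III) If $B$ is a block of $G$ isomorphic to $C_n^t$ for some integers $n$ and $t$ with $n$ odd, then $\bigcup_{u\in V(B)} \widetilde{L}_B(u)$ induces a $t$-fat ladder of length $n$ in the $\mathcal{M}_L$-cover of $G$, where each set $\widetilde{L}_B(u)$ corresponds to $\{(i_u,j,k) : j\in\{1,2\},\ k\in[t]\}$ for some $i_u\in[n]$. (IV) If $B$ is a block of $G$ isomorphic to $C_n^t$ for some integers $n$ and $t$ with $n$ even, then $\bigcup_{u\in V(B)}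 \widetilde{L}_B(u)$ induces a $t$-fat Möbius ladder of length $n$ in the $\mathcal{M}_L$-cover of $G$, where each set $\widetilde{L}_B(u)$ corresponds to $\{(i_u,j,k) : j\in\{1,2\},\ k\in[t]\}$ for some $i_u\in[n]$. Here the sets $L_B(u)$ in (II)--(IV) are those of the partitions in (I) (the same choice of partitions must satisfy (I)--(IV) simultaneously).
   Context: Notation: $[k]=\{1,\dots,k\}$. Multigraphs may have multiple edges but no loops, and are finite. $\mu_G(uv)$ is the multiplicity of $uv$ in $G$ (equal to $0$ if $u,v$ are not adjacent), and $d_G(u)$ is the degree of $u$, counting edges with multiplicity. A block of a connected multigraph is a maximal connected sub-multigraph having no cut vertex of its own. $K_n$ is the complete graph on $n$ vertices, $C_n$ the cycle on $n$ vertices ($n \ge 3$). For a multigraph $F$ and a positive integer $t$, $F^t$ is the multigraph obtained from $F$ by replacing each edge with $t$ parallel edges. List assignments: a list assignment $L$ of $G$ is a mapping $L:V(G)\to 2^{[k]}$ for some integer $k$. It is a degree-list assignment if $|L(u)|\ge d_G(u)$ for all $u\in V(G)$. Write $\widetilde{L}(u)=\{u\}\times L(u)$, and $\widetilde{L'}(u)=\{u\}\times L'(u)$ for $L'(u)\subseteq L(u)$; in particular $\widetilde{L}_B(u)=\{u\}\times L_B(u)$. In the partitions $\{L_B(u)\}$, empty parts are allowed (this occurs only for $K_1$). Matching assignments: for each pair of vertices $u,v$ of $G$, let $M_{L,uv}$ be a union of $\mu_G(uv)$ matchings (not necessarily perfect) between $\{u\}\times L(u)$ and $\{v\}\times L(v)$;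 it is empty if $u,v$ are not adjacent. $M_{L,uv}$ is regarded as a (simple) bipartite graph of maximum degree at most $\mu_G(uv)$ between these sets. The collection $\mathcal{M}_L=\{M_{L,uv}: uv\in E(G)\}$ is called a matching assignment over $L$. The $\mathcal{M}_L$-cover of $G$ is the simple graph $H$ with vertex set $\{(u,c): u\in V(G),\ c\in L(u)\}$ in which each set $\{u\}\times L(u)$ is a clique, and, for any two distinct vertices $u,v$ of $G$, the edges between $\{u\}\times L(u)$ and $\{v\}\times L(v)$ are exactly those of $M_{L,uv}$. An $\mathcal{M}_L$-coloring of $G$ is an independent set $I$ in the $\mathcal{M}_L$-cover of $G$ with $|I|=|V(G)|$. Special graphs (simple graphs; adjacency is between distinct vertices and symmetric), for positive integers $n,t$: - $H(n,t)$ has vertex set $\{(i,j,k): i\in[n],\ j\in[n-1],\ k\in[t]\}$, and $(i,j,k)$, $(i',j',k')$ are adjacent if and only if $i=i'$ or $j=j'$. - The $t$-fat ladder of length $n$ has vertex set $\{(i,j,k): i\in[n],\ j\in\{1,2\},\ k\in[t]\}$, and $(i,j,k)$, $(i',j',k')$ are adjacent if and only if (up to exchanging the two vertices) either $i=i'$, or $i'=i+1$ and $j=j'$, where $n+1$ is read as $1$ for the index $i$. - The $t$-fat Möbius ladder of length $n$ has vertex set $\{(i,j,k): i\in[n],\ j\in\{1,2\},\ k\in[t]\}$, and $(i,j,k)$, $(i',j',k')$ are adjacent if and only if (up to exchanging the two vertices) either $i=i'$; or $i'=i+1$ and $j=j'$ with $1\le i\le n-1$; or $i=n$, $i'=1$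 and $j\ne j'$. "Induces the graph $X$, where each set $\widetilde{L}_B(u)$ corresponds to $S_u$" means: there is a graph isomorphism from the subgraph of the $\mathcal{M}_L$-cover induced by $\bigcup_{u\in V(B)}\widetilde{L}_B(u)$ onto $X$ that maps each $\widetilde{L}_B(u)$ onto the set $S_u$. *)

theory Defs
  imports Main "HOL-Library.Disjoint_Sets"
begin

section \<open>Finite loopless multigraphs\<close>

text \<open>A multigraph is given by its vertex set and its edge multiplicities.  The multiplicity
  function vanishes outside the vertex set, so that equality of records is equality of
  multigraphs.\<close>

record 'v mgraph =
  verts :: "'v set"
  mult :: "'v \<Rightarrow> 'v \<Rightarrow> nat"

definition multigraph :: "'v mgraph \<Rightarrow> bool" where
  "multigraph G \<longleftrightarrow>
     finite (verts G) \<and>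
     (\<forall>u v. mult G u v = mult G v u) \<and>
     (\<forall>u. mult G u u = 0) \<and>
     (\<forall>u v. mult G u v > 0 \<longrightarrow> u \<in> verts G \<and> v \<in> verts G)"

definition mdegree :: "'v mgraph \<Rightarrow> 'v \<Rightarrow> nat" where
  "mdegree G u = (\<Sum>v\<in>verts G. mult G u v)"

definition submultigraph :: "'v mgraph \<Rightarrow> 'v mgraph \<Rightarrow> bool" where
  "submultigraph B G \<longleftrightarrow>
     multigraph B \<and> verts B \<subseteq> verts G \<and> (\<forall>u v. mult B u v \<le> mult G u v)"

definition delete_vertex :: "'v mgraph \<Rightarrow> 'v \<Rightarrow> 'v mgraph" where
  "delete_vertex G w =
     \<lparr>verts = verts G - {w}, mult = (\<lambda>u v. if u = w \<or> v = w then 0 else mult G u v)\<rparr>"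

definition mreachable :: "'v mgraph \<Rightarrow> 'v \<Rightarrow> 'v \<Rightarrow> bool" where
  "mreachable G x y \<longleftrightarrow> (x, y) \<in> {(u, v). mult G u v > 0}\<^sup>*"

definition mconnected :: "'v mgraph \<Rightarrow> bool" where
  "mconnected G \<longleftrightarrow> verts G \<noteq> {} \<and> (\<forall>x\<in>verts G. \<forall>y\<in>verts G. mreachable G x y)"

definition cut_vertex :: "'v mgraph \<Rightarrow> 'v \<Rightarrow> bool" where
  "cut_vertex G w \<longleftrightarrow>
     w \<in> verts G \<and>
     (\<exists>x \<in> verts G - {w}. \<exists>y \<in> verts G - {w}.
        mreachable G x y \<and> \<not> mreachable (delete_vertex G w) x y)"

definition is_block :: "'v mgraph \<Rightarrow> 'v mgraph \<Rightarrow> bool" where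
  "is_block G B \<longleftrightarrow>
     submultigraph B G \<and> mconnected B \<and> (\<forall>w. \<not> cut_vertex B w) \<and>
     (\<forall>B'. submultigraph B' G \<and> mconnected B' \<and> (\<forall>w. \<not> cut_vertex B' w) \<and>
           submultigraph B B' \<longrightarrow> B' = B)"

definition mgraph_iso :: "'v mgraph \<Rightarrow> 'w mgraph \<Rightarrow> bool" where
  "mgraph_iso G G' \<longleftrightarrow>
     (\<exists>f. bij_betw f (verts G) (verts G') \<and>
          (\<forall>u\<in>verts G. \<forall>v\<in>verts G. mult G' (f u) (f v) = mult G u v))"

definition complete_mg :: "nat \<Rightarrow> nat mgraph" where
  "complete_mg n =
     \<lparr>verts = {1..n},
      mult = (\<lambda>u v. if u \<in> {1..n} \<and> v \<in> {1..n} \<and> u \<noteq> v then 1 else 0)\<rparr>"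

definition cyc_succ :: "nat \<Rightarrow> nat \<Rightarrow> nat" where
  "cyc_succ n i = (if i = n then 1 else i + 1)"

text \<open>This is the cycle on \<open>n\<close> vertices only for \<open>n \<ge> 3\<close>.\<close>

definition cycle_mg :: "nat \<Rightarrow> nat mgraph" where
  "cycle_mg n =
     \<lparr>verts = {1..n},
      mult = (\<lambda>u v. if u \<in> {1..n} \<and> v \<in> {1..n} \<and> (v = cyc_succ n u \<or> u = cyc_succ n v)
                    then 1 else 0)\<rparr>"

definition parallel_mg :: "'v mgraph \<Rightarrow> nat \<Rightarrow> 'v mgraph" where
  "parallel_mg F t = \<lparr>verts = verts F, mult = (\<lambda>u v. t * mult F u v)\<rparr>"

definition iso_complete_power :: "'v mgraph \<Rightarrow> nat \<Rightarrow> nat \<Rightarrow> bool" where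
  "iso_complete_power B n t \<longleftrightarrow>
     n \<ge> 1 \<and> t \<ge> 1 \<and> mgraph_iso B (parallel_mg (complete_mg n) t)"

definition iso_cycle_power :: "'v mgraph \<Rightarrow> nat \<Rightarrow> nat \<Rightarrow> bool" where
  "iso_cycle_power B n t \<longleftrightarrow>
     n \<ge> 3 \<and> t \<ge> 1 \<and> mgraph_iso B (parallel_mg (cycle_mg n) t)"

section \<open>Simple graphs\<close>

record 'a sgraph =
  nodes :: "'a set"
  edges :: "'a set set"

definition induced_subgraph :: "'a sgraph \<Rightarrow> 'a set \<Rightarrow> 'a sgraph" where
  "induced_subgraph X S = \<lparr>nodes = nodes X \<inter> S, edges = {e \<in> edges X. e \<subseteq> S}\<rparr>"

definition independent_set :: "'a sgraph \<Rightarrow> 'a set \<Rightarrow> bool" where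
  "independent_set X I \<longleftrightarrow> I \<subseteq> nodes X \<and> (\<forall>x\<in>I. \<forall>y\<in>I. {x, y} \<notin> edges X)"

definition sgraph_iso_by :: "('a \<Rightarrow> 'b) \<Rightarrow> 'a sgraph \<Rightarrow> 'b sgraph \<Rightarrow> bool" where
  "sgraph_iso_by f X Y \<longleftrightarrow>
     bij_betw f (nodes X) (nodes Y) \<and>
     (\<forall>x\<in>nodes X. \<forall>y\<in>nodes X. {x, y} \<in> edges X \<longleftrightarrow> {f x, f y} \<in> edges Y)"

text \<open>The unordered pairs below make the relation \<open>R\<close> symmetric.\<close>

definition sgraph_of :: "'a set \<Rightarrow> ('a \<Rightarrow> 'a \<Rightarrow> bool) \<Rightarrow> 'a sgraph" where
  "sgraph_of S R =
     \<lparr>nodes = S, edges = {{x, y} | x y. x \<in> S \<and> y \<in> S \<and> x \<noteq> y \<and> R x y}\<rparr>"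

definition H_graph :: "nat \<Rightarrow> nat \<Rightarrow> (nat \<times> nat \<times> nat) sgraph" where
  "H_graph n t =
     sgraph_of ({1..n} \<times> {1..n - 1} \<times> {1..t})
       (\<lambda>(i, j, k) (i', j', k'). i = i' \<or> j = j')"

definition fat_ladder :: "nat \<Rightarrow> nat \<Rightarrow> (nat \<times> nat \<times> nat) sgraph" where
  "fat_ladder n t =
     sgraph_of ({1..n} \<times> {1, 2} \<times> {1..t})
       (\<lambda>(i, j, k) (i', j', k'). i = i' \<or> i' = cyc_succ n i \<and> j = j')"

definition fat_Moebius_ladder :: "nat \<Rightarrow> nat \<Rightarrow> (nat \<times> nat \<times> nat) sgraph" where
  "fat_Moebius_ladder n t =
     sgraph_of ({1..n} \<times> {1, 2} \<times> {1..t})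
       (\<lambda>(i, j, k) (i', j', k').
          i = i' \<or>
          1 \<le> i \<and> i \<le> n - 1 \<and> i' = i + 1 \<and> j = j' \<or>
          i = n \<and> i' = 1 \<and> j \<noteq> j')"

section \<open>List assignments, matching assignments and covers\<close>

definition list_assignment :: "'v mgraph \<Rightarrow> ('v \<Rightarrow> nat set) \<Rightarrow> bool" where
  "list_assignment G L \<longleftrightarrow> (\<exists>k. \<forall>u\<in>verts G. L u \<subseteq> {1..k})"

definition degree_list_assignment :: "'v mgraph \<Rightarrow> ('v \<Rightarrow> nat set) \<Rightarrow> bool" where
  "degree_list_assignment G L \<longleftrightarrow>
     list_assignment G L \<and> (\<forall>u\<in>verts G. card (L u) \<ge> mdegree G u)"

definition fiber :: "'v \<Rightarrow> nat set \<Rightarrow> ('v \<times> nat) set" where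
  "fiber u C = {u} \<times> C"

definition matching_between :: "'a set \<Rightarrow> 'a set \<Rightarrow> 'a set set \<Rightarrow> bool" where
  "matching_between A B N \<longleftrightarrow>
     N \<subseteq> {{a, b} | a b. a \<in> A \<and> b \<in> B} \<and> pairwise disjnt N"

text \<open>The set \<open>M u v\<close> consists of undirected edges and is indexed by the unordered pair of
  \<open>u\<close> and \<open>v\<close>, hence the symmetry.  If \<open>u\<close> and \<open>v\<close> are not adjacent, it is an empty union.\<close>

definition matching_assignment ::
  "'v mgraph \<Rightarrow> ('v \<Rightarrow> nat set) \<Rightarrow> ('v \<Rightarrow> 'v \<Rightarrow> ('v \<times> nat) set set) \<Rightarrow> bool" where
  "matching_assignment G L M \<longleftrightarrow>
     (\<forall>u\<in>verts G. \<forall>v\<in>verts G. u \<noteq> v \<longrightarrow>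
        M u v = M v u \<and>
        (\<exists>N :: nat \<Rightarrow> ('v \<times> nat) set set.
           (\<forall>i < mult G u v. matching_between (fiber u (L u)) (fiber v (L v)) (N i)) \<and>
           M u v = (\<Union>i < mult G u v. N i)))"

definition cover ::
  "'v mgraph \<Rightarrow> ('v \<Rightarrow> nat set) \<Rightarrow> ('v \<Rightarrow> 'v \<Rightarrow> ('v \<times> nat) set set) \<Rightarrow> ('v \<times> nat) sgraph"
where
  "cover G L M =
     \<lparr>nodes = (\<Union>u\<in>verts G. fiber u (L u)),
      edges = {{(u, c), (u, c')} | u c c'. u \<in> verts G \<and> c \<in> L u \<and> c' \<in> L u \<and> c \<noteq> c'} \<union>
              \<Union>{M u v | u v. u \<in> verts G \<and> v \<in> verts G \<and> u \<noteq> v}\<rparr>"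

definition matching_coloring ::
  "'v mgraph \<Rightarrow> ('v \<Rightarrow> nat set) \<Rightarrow> ('v \<Rightarrow> 'v \<Rightarrow> ('v \<times> nat) set set) \<Rightarrow> ('v \<times> nat) set \<Rightarrow> bool"
where
  "matching_coloring G L M I \<longleftrightarrow>
     independent_set (cover G L M) I \<and> card I = card (verts G)"

text \<open>The union of the fibers of \<open>P u\<close>, for \<open>u\<close> in \<open>W\<close>, induces a copy of \<open>Y\<close> in \<open>X\<close> in
  which each fiber corresponds to the layer of \<open>Y\<close> with some first coordinate in \<open>{1..n}\<close>.\<close>

definition induces_layered ::
  "('v \<times> nat) sgraph \<Rightarrow> 'v set \<Rightarrow> ('v \<Rightarrow> nat set) \<Rightarrow> (nat \<times> nat \<times> nat) sgraph \<Rightarrow>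
   nat \<Rightarrow> nat set \<Rightarrow> nat \<Rightarrow> bool"
where
  "induces_layered X W P Y n J t \<longleftrightarrow>
     (\<exists>f. sgraph_iso_by f (induced_subgraph X (\<Union>u\<in>W. fiber u (P u))) Y \<and>
          (\<forall>u\<in>W. \<exists>i\<in>{1..n}. f ` fiber u (P u) = {i} \<times> J \<times> {1..t}))"

end

(*
  Both directions go by induction on the number of vertices, splitting at a cut vertex w: the colours
  of w that do not extend to the one or the other side form the two parts of a partition of L(w), and
  the blocks of G are those of the two sides.

  In a graph without cut vertex, greedy colouring towards a vertex r shows that every partial
  colouring extends to all vertices but one, and uncolourability makes every counting bound at the
  last vertex tight. Hence a colour c of u has exactly mu(uv) neighbours in L(v); moreover, if
  removing u1 and u2 does not disconnect the graph, then colours of u1 and u2 with a common neighbour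
  in a third list are adjacent. So any two vertices at distance two separate the graph, which forces
  the underlying simple graph to be complete or a cycle. In the complete case adjacency of colours is
  transitive and its classes give H(n,t). In the cycle case every list splits into two halves which
  are matched along the edges, and a parity argument decides between the ladder and the Moebius ladder.
*)
theory Submission
  imports Defs
begin

section \<open>Cut-based connectivity\<close>

text \<open>The partition at a cut vertex \<open>w\<close> is forced by counting. On either side,
  greedy colouring towards \<open>w\<close> reaches all other vertices, so the colours of
  \<open>w\<close> that do not extend to that side number at most the degree of \<open>w\<close>
  there. The two degrees add up to the degree of \<open>w\<close>, while the two sets cover a list
  at least that long; hence they are disjoint and attain their bounds, and each side inherits the
  degree condition with the list of \<open>w\<close> shrunk. For this reason the cover graph stays
  fixed and only the multigraph and the lists vary. Connectivity is likewise a property of a vertex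
  set and the multiplicity function, stated through cuts, since what is needed is usually an edge
  leaving a set. Without cut vertices, separation by pairs at distance two is derived from colours,
  but from then on it is a statement about the underlying simple graph alone. A triangle is both
  complete and a cycle; it is treated as complete, and its fat ladder turns out to be the same graph
  as H(3,t).\<close>

definition conn :: "('v \<Rightarrow> 'v \<Rightarrow> nat) \<Rightarrow> 'v set \<Rightarrow> bool" where
  "conn m U \<longleftrightarrow> (\<forall>A\<subseteq>U. A \<noteq> {} \<and> A \<noteq> U \<longrightarrow> (\<exists>a\<in>A. \<exists>b\<in>U - A. m a b > 0))"

lemma connD:
  assumes "conn m U" "A \<subseteq> U" "x \<in> A" "y \<in> U" "y \<notin> A"
  obtains a b where "a \<in> A" "b \<in> U" "b \<notin> A" "m a b > 0"
  using assms unfolding conn_def by (metis DiffE empty_iff)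

lemma rtrancl_leaves:
  assumes "(x, y) \<in> r\<^sup>*" "x \<in> A" "y \<notin> A"
  shows "\<exists>a\<in>A. \<exists>b. b \<notin> A \<and> (a, b) \<in> r"
  using assms by (induction rule: rtrancl_induct) blast+

lemma multigraphD:
  assumes "multigraph G"
  shows "finite (verts G)" "mult G u v = mult G v u" "mult G u u = 0"
    "mult G u v > 0 \<Longrightarrow> u \<in> verts G" "mult G u v > 0 \<Longrightarrow> v \<in> verts G"
  using assms unfolding multigraph_def by blast+

lemma mconnected_iff_conn:
  assumes "multigraph G"
  shows "mconnected G \<longleftrightarrow> verts G \<noteq> {} \<and> conn (mult G) (verts G)"
proof
  assume c: "mconnected G"
  show "verts G \<noteq> {} \<and> conn (mult G) (verts G)"
    unfolding conn_def
  proof (intro conjI allI impI)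
    show "verts G \<noteq> {}" using c by (simp add: mconnected_def)
  next
    fix A assume "A \<subseteq> verts G" "A \<noteq> {} \<and> A \<noteq> verts G"
    then obtain x y where xy: "x \<in> A" "y \<in> verts G" "y \<notin> A" "x \<in> verts G" by blast
    then have "(x, y) \<in> {(u, v). mult G u v > 0}\<^sup>*"
      using c by (auto simp: mconnected_def mreachable_def)
    from rtrancl_leaves[OF this xy(1,3)]
    show "\<exists>a\<in>A. \<exists>b\<in>verts G - A. mult G a b > 0"
      using multigraphD[OF assms] by fastforce
  qed
next
  assume r: "verts G \<noteq> {} \<and> conn (mult G) (verts G)"
  have "mreachable G x y" if xy: "x \<in> verts G" "y \<in> verts G" for x y
  proof (rule ccontr)
    assume n: "\<not> mreachable G x y"
    define A where "A = {z \<in> verts G. mreachable G x z}"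
    have "x \<in> A" "y \<notin> A" "A \<subseteq> verts G" using xy n by (auto simp: A_def mreachable_def)
    then obtain a b where "a \<in> A" "b \<in> verts G" "b \<notin> A" "mult G a b > 0"
      using connD[of "mult G" "verts G" A x y] r xy by metis
    then show False unfolding A_def mreachable_def
      by (auto intro: rtrancl_into_rtrancl)
  qed
  then show "mconnected G" using r by (auto simp: mconnected_def)
qed

text \<open>Vertices outside the graph are included, so that the locales below can demand
  connectivity of \<open>V - {w}\<close> for every \<open>w\<close>.\<close>

lemma conn_delete_vertex:
  assumes "multigraph G" "mconnected G" "\<not> cut_vertex G w"
  shows "conn (mult G) (verts G - {w})"
proof (cases "w \<in> verts G")
  case True
  show ?thesis unfolding conn_def
  proof (intro allI impI)
    fix A assume "A \<subseteq> verts G - {w}" "A \<noteq> {} \<and> A \<noteq> verts G - {w}"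
    then obtain x y where xy: "x \<in> A" "y \<in> verts G - {w}" "y \<notin> A" "x \<in> verts G - {w}" by blast
    have "mreachable G x y" using assms(2) xy by (auto simp: mconnected_def)
    then have "mreachable (delete_vertex G w) x y"
      using assms(3) xy True by (auto simp: cut_vertex_def)
    then have "(x, y) \<in> {(u, v). mult (delete_vertex G w) u v > 0}\<^sup>*"
      by (simp add: mreachable_def)
    from rtrancl_leaves[OF this xy(1,3)]
    obtain a b where "a \<in> A" "b \<notin> A" "mult (delete_vertex G w) a b > 0" by blast
    then show "\<exists>a\<in>A. \<exists>b\<in>verts G - {w} - A. mult G a b > 0"
      using multigraphD[OF assms(1)]
      by (intro bexI[of _ a] bexI[of _ b]) (auto simp: delete_vertex_def split: if_splits)
  qed
next
  case False
  then show ?thesis using mconnected_iff_conn[OF assms(1)] assms(2) by simp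
qed

section \<open>Partial colourings\<close>

text \<open>The lists are a parameter of their own because the induction shrinks the list of a cut
  vertex while the cover graph \<open>X\<close> stays the same.\<close>

definition nbrs :: "('v \<times> nat) sgraph \<Rightarrow> ('v \<Rightarrow> nat set) \<Rightarrow> 'v \<Rightarrow> nat \<Rightarrow> 'v \<Rightarrow> nat set" where
  "nbrs X L u c v = {d \<in> L v. {(u, c), (v, d)} \<in> edges X}"

definition proper_on ::
  "('v \<times> nat) sgraph \<Rightarrow> ('v \<Rightarrow> nat set) \<Rightarrow> 'v set \<Rightarrow> ('v \<Rightarrow> nat) \<Rightarrow> bool" where
  "proper_on X L S \<phi> \<longleftrightarrow> (\<forall>u\<in>S. \<phi> u \<in> L u) \<and>
     (\<forall>u\<in>S. \<forall>v\<in>S. u \<noteq> v \<longrightarrow> {(u, \<phi> u), (v, \<phi> v)} \<notin> edges X)"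

lemma proper_on_insert:
  assumes "proper_on X L S \<phi>" "x \<notin> S" "c \<in> L x" "\<forall>v\<in>S. c \<notin> nbrs X L v (\<phi> v) x"
  shows "proper_on X L (insert x S) (\<phi>(x := c))"
  using assms unfolding proper_on_def nbrs_def by (auto simp: insert_commute)

text \<open>This is the equality case of the union bound: a \<open>B i\<close> below its bound, or
  two overlapping ones, would make the union too small to cover \<open>A\<close>.\<close>

lemma tight_union:
  assumes "finite I" "A \<subseteq> (\<Union>i\<in>I. B i)" "\<And>i. i \<in> I \<Longrightarrow> finite (B i)"
    "\<And>i. i \<in> I \<Longrightarrow> card (B i) \<le> m i" "(\<Sum>i\<in>I. m i) \<le> card A"
  shows "\<forall>i\<in>I. card (B i) = m i" "disjoint_family_on B I"
proof -
  \<comment> \<open>The sets with index in \<open>J\<close> are merged, the others counted one by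
    one: \<open>J = {}\<close> yields the total, and \<open>J = {i, j}\<close> detects an
    overlap.\<close>
  have le: "card A \<le> card (\<Union>i\<in>J. B i) + (\<Sum>i\<in>I - J. card (B i))" if "J \<subseteq> I" for J
  proof -
    have "A \<subseteq> (\<Union>i\<in>J. B i) \<union> (\<Union>i\<in>I - J. B i)" using assms(2) that by blast
    then have "card A \<le> card ((\<Union>i\<in>J. B i) \<union> (\<Union>i\<in>I - J. B i))"
      using assms(1,3) that by (intro card_mono) (auto dest: finite_subset)
    also have "\<dots> \<le> card (\<Union>i\<in>J. B i) + card (\<Union>i\<in>I - J. B i)" by (rule card_Un_le)
    also have "card (\<Union>i\<in>I - J. B i) \<le> (\<Sum>i\<in>I - J. card (B i))"
      using assms(1) by (intro card_UN_le) auto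
    finally show ?thesis by simp
  qed
  have sum_le: "(\<Sum>i\<in>I. card (B i)) \<le> (\<Sum>i\<in>I. m i)" using assms(4) by (intro sum_mono)
  have eq: "(\<Sum>i\<in>I. card (B i)) = (\<Sum>i\<in>I. m i)" using le[of "{}"] sum_le assms(5) by simp
  show "\<forall>i\<in>I. card (B i) = m i"
  proof (rule ccontr)
    assume "\<not> ?thesis"
    then obtain i where "i \<in> I" "card (B i) < m i" using assms(4) by (meson order_le_neq_trans)
    then have "(\<Sum>i\<in>I. card (B i)) < (\<Sum>i\<in>I. m i)" using assms(1,4) by (intro sum_strict_mono_ex1) auto
    then show False using eq by simp
  qed
  show "disjoint_family_on B I" unfolding disjoint_family_on_def
  proof (intro ballI impI)
    fix i j assume ij: "i \<in> I" "j \<in> I" "i \<noteq> j"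
    have "(\<Sum>i\<in>I. card (B i)) = (\<Sum>i\<in>I - {i, j}. card (B i)) + (\<Sum>i\<in>{i, j}. card (B i))"
      using assms(1) ij by (intro sum.subset_diff) auto
    then have "card (B i) + card (B j) \<le> card (B i \<union> B j)"
      using le[of "{i, j}"] eq assms(5) ij by simp
    then have "card (B i \<inter> B j) = 0"
      using card_Un_Int[of "B i" "B j"] assms(3) ij by simp
    then show "B i \<inter> B j = {}" using assms(3) ij by simp
  qed
qed

text \<open>The matchings enter through \<open>bound\<close>. These conditions survive passing to a
  sub-multigraph and shrinking lists with \<open>X\<close> unchanged, which the induction over cut
  vertices relies on.\<close>

locale list_cover =
  fixes X :: "('v \<times> nat) sgraph" and G :: "'v mgraph" and L :: "'v \<Rightarrow> nat set"
  assumes mgr: "multigraph G"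
    and fin_list: "u \<in> verts G \<Longrightarrow> finite (L u)"
    and node: "u \<in> verts G \<Longrightarrow> c \<in> L u \<Longrightarrow> (u, c) \<in> nodes X"
    and clique: "u \<in> verts G \<Longrightarrow> c \<in> L u \<Longrightarrow> c' \<in> L u \<Longrightarrow> c \<noteq> c' \<Longrightarrow> {(u, c), (u, c')} \<in> edges X"
    and loopless: "{p} \<notin> edges X"
    and bound: "u \<in> verts G \<Longrightarrow> v \<in> verts G \<Longrightarrow> u \<noteq> v \<Longrightarrow> c \<in> L u \<Longrightarrow>
                  card (nbrs X L u c v) \<le> mult G u v"
begin

abbreviation "V \<equiv> verts G"
abbreviation "m \<equiv> mult G"
abbreviation "N \<equiv> nbrs X L"

lemmas m_sym = multigraphD(2)[OF mgr]
lemmas m_refl = multigraphD(3)[OF mgr]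
lemmas m_verts = multigraphD(4,5)[OF mgr]
lemmas fin_V = multigraphD(1)[OF mgr]

lemma N_sub: "N u c v \<subseteq> L v" by (auto simp: nbrs_def)

lemma N_sym: "c \<in> L u \<Longrightarrow> d \<in> L v \<Longrightarrow> d \<in> N u c v \<longleftrightarrow> c \<in> N v d u"
  by (auto simp: nbrs_def insert_commute)

lemma N_finite: "v \<in> V \<Longrightarrow> finite (N u c v)"
  using fin_list N_sub by (meson finite_subset)

lemma mdegree_remove: "u \<in> V \<Longrightarrow> mdegree G u = (\<Sum>v\<in>V - {u}. m v u)"
  unfolding mdegree_def using fin_V m_refl by (simp add: sum.remove[of V u] m_sym[of u])

text \<open>The uncoloured neighbour \<open>y\<close> contributes to the degree of \<open>x\<close>
  but blocks no colour, so strictly fewer than \<open>card (L x)\<close> colours are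
  blocked.\<close>

lemma extend_step:
  assumes "S \<subseteq> V" "x \<in> V" "x \<notin> S" "y \<in> V" "y \<notin> S" "m x y > 0" "proper_on X L S \<phi>"
    "mdegree G x \<le> card (L x)"
  shows "\<exists>c. proper_on X L (insert x S) (\<phi>(x := c))"
proof -
  have ny: "y \<noteq> x" using assms(6) m_refl by auto
  have fS: "finite S" using assms(1) fin_V finite_subset by blast
  have "card (\<Union>v\<in>S. N v (\<phi> v) x) \<le> (\<Sum>v\<in>S. card (N v (\<phi> v) x))" using fS by (rule card_UN_le)
  also have "\<dots> \<le> (\<Sum>v\<in>S. m v x)"
    using assms(1,2,3,7) by (intro sum_mono bound) (auto simp: proper_on_def)
  also have "\<dots> < (\<Sum>v\<in>insert y S. m v x)"
    using fS assms(5,6) by (simp add: m_sym[of y])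
  also have "\<dots> \<le> (\<Sum>v\<in>V - {x}. m v x)"
    using assms(1-4) fin_V ny by (intro sum_mono2) auto
  also have "\<dots> \<le> card (L x)" using assms(2,8) mdegree_remove by simp
  finally have "\<not> L x \<subseteq> (\<Union>v\<in>S. N v (\<phi> v) x)"
    using fS N_finite assms(2) by (metis card_mono finite_UN_I not_less)
  then obtain c where "c \<in> L x" "\<forall>v\<in>S. c \<notin> N v (\<phi> v) x" by blast
  then show ?thesis using proper_on_insert[OF assms(7,3)] by blast
qed

text \<open>Colour greedily towards \<open>r\<close>: every vertex of \<open>U - {r}\<close> is coloured while it still has an
  uncoloured neighbour.\<close>

lemma extend:
  assumes c: "conn m U" and U: "U \<subseteq> V" "r \<in> U" and \<phi>: "proper_on X L (V - U) \<phi>"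
    and d: "\<And>u. u \<in> U - {r} \<Longrightarrow> mdegree G u \<le> card (L u)"
  shows "\<exists>\<psi>. proper_on X L (V - {r}) \<psi> \<and> (\<forall>x\<in>V - U. \<psi> x = \<phi> x)"
proof -
  define Q where "Q T \<longleftrightarrow> (\<forall>\<phi>. proper_on X L (V - T) \<phi> \<longrightarrow>
    (\<exists>\<psi>. proper_on X L (V - {r}) \<psi> \<and> (\<forall>x\<in>V - T. \<psi> x = \<phi> x)))" for T
  \<comment> \<open>\<open>F\<close> holds the sets of still uncoloured vertices from which
    colouring down to \<open>r\<close> is possible. A maximal one is \<open>U\<close>: an edge
    leaving it leads to some \<open>x\<close> that can be coloured first, while its neighbour inside
    is still uncoloured.\<close>
  define F where "F = {T. T \<subseteq> U \<and> r \<in> T \<and> Q T}"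
  have "F \<subseteq> Pow V" using U by (auto simp: F_def)
  then have fF: "finite F" using fin_V by (meson finite_Pow_iff finite_subset)
  have "{r} \<in> F" using U by (auto simp: F_def Q_def)
  then obtain T where T: "T \<in> F" "\<And>T'. T' \<in> F \<Longrightarrow> T \<subseteq> T' \<Longrightarrow> T = T'"
    using finite_has_maximal[OF fF] by (metis empty_iff)
  have "T = U"
  proof (rule ccontr)
    assume "T \<noteq> U"
    then obtain y where y: "y \<in> U" "y \<notin> T" using T(1) by (auto simp: F_def)
    then obtain a x where ax: "a \<in> T" "x \<in> U" "x \<notin> T" "m a x > 0"
      using T(1) connD[OF c, of T r y] by (auto simp: F_def)
    have "Q (insert x T)" unfolding Q_def
    proof (intro allI impI)
      fix \<phi> assume p: "proper_on X L (V - insert x T) \<phi>"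
      obtain e where e: "proper_on X L (insert x (V - insert x T)) (\<phi>(x := e))"
        using extend_step[of "V - insert x T" x a \<phi>] p ax T(1) U d[of x]
        by (auto simp: F_def m_sym)
      have "insert x (V - insert x T) = V - T" using ax U by auto
      then obtain \<psi> where "proper_on X L (V - {r}) \<psi>" "\<forall>z\<in>V - T. \<psi> z = (\<phi>(x := e)) z"
        using e T(1) by (auto simp: F_def Q_def)
      then show "\<exists>\<psi>. proper_on X L (V - {r}) \<psi> \<and> (\<forall>z\<in>V - insert x T. \<psi> z = \<phi> z)"
        by (intro exI[of _ \<psi>]) auto
    qed
    then have "insert x T \<in> F" using T(1) ax by (auto simp: F_def)
    then show False using T(2)[of "insert x T"] ax by blast
  qed
  then show ?thesis using T(1) \<phi> by (auto simp: F_def Q_def)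
qed

lemma list_covered:
  assumes "u \<in> V" "proper_on X L (V - {u}) \<phi>" "\<nexists>\<phi>. proper_on X L V \<phi>"
  shows "L u \<subseteq> (\<Union>v\<in>V - {u}. N v (\<phi> v) u)"
proof (rule ccontr)
  assume "\<not> ?thesis"
  then obtain c where "c \<in> L u" "\<forall>v\<in>V - {u}. c \<notin> N v (\<phi> v) u" by blast
  then have "proper_on X L (insert u (V - {u})) (\<phi>(u := c))"
    using proper_on_insert[OF assms(2)] by blast
  then show False using assms(1,3) by (simp add: insert_absorb)
qed

lemma list_small:
  assumes "u \<in> V" "proper_on X L (V - {u}) \<phi>" "\<nexists>\<phi>. proper_on X L V \<phi>"
  shows "card (L u) \<le> mdegree G u"
proof -
  have "card (L u) \<le> card (\<Union>v\<in>V - {u}. N v (\<phi> v) u)"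
    using list_covered[OF assms] fin_V N_finite[OF assms(1)] by (intro card_mono) auto
  also have "\<dots> \<le> (\<Sum>v\<in>V - {u}. card (N v (\<phi> v) u))" using fin_V by (intro card_UN_le) auto
  also have "\<dots> \<le> (\<Sum>v\<in>V - {u}. m v u)"
    using assms(1,2) by (intro sum_mono bound) (auto simp: proper_on_def)
  finally show ?thesis using assms(1) mdegree_remove by simp
qed

text \<open>A colouring that cannot be completed at \<open>u\<close> leaves no slack: the blocked
  sets cover a list at least as long as the sum of their bounds, so every bound is attained and no
  colour is blocked twice.\<close>

lemma list_tight:
  assumes "u \<in> V" "proper_on X L (V - {u}) \<phi>" "\<nexists>\<phi>. proper_on X L V \<phi>"
    "mdegree G u \<le> card (L u)"
  shows "v \<in> V - {u} \<Longrightarrow> card (N v (\<phi> v) u) = m v u"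
    and "disjoint_family_on (\<lambda>v. N v (\<phi> v) u) (V - {u})"
proof -
  have "\<forall>v\<in>V - {u}. card (N v (\<phi> v) u) = m v u"
    and "disjoint_family_on (\<lambda>v. N v (\<phi> v) u) (V - {u})"
    using tight_union[where I = "V - {u}" and A = "L u" and B = "\<lambda>v. N v (\<phi> v) u" and m = "\<lambda>v. m v u"]
      list_covered[OF assms(1-3)] fin_V N_finite[OF assms(1)] assms(1,2,4) bound mdegree_remove[of u]
    by (auto simp: proper_on_def)
  then show "v \<in> V - {u} \<Longrightarrow> card (N v (\<phi> v) u) = m v u"
    "disjoint_family_on (\<lambda>v. N v (\<phi> v) u) (V - {u})" by auto
qed

end

section \<open>Graphs in which every pair of vertices at distance two separates\<close>

lemma connE:
  assumes "\<not> conn m U"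
  obtains A where "A \<subseteq> U" "A \<noteq> {}" "U - A \<noteq> {}" "\<And>a b. a \<in> A \<Longrightarrow> b \<in> U - A \<Longrightarrow> m a b = 0"
proof -
  obtain A where A: "A \<subseteq> U" "A \<noteq> {}" "A \<noteq> U" "\<not> (\<exists>a\<in>A. \<exists>b\<in>U - A. m a b > 0)"
    using assms unfolding conn_def by blast
  show thesis by (rule that[OF A(1,2)]) (use A in auto)
qed

locale two_connected =
  fixes V :: "'v set" and m :: "'v \<Rightarrow> 'v \<Rightarrow> nat"
  assumes sym: "m u v = m v u"
    and irr: "m u u = 0"
    and in_V: "m u v > 0 \<Longrightarrow> u \<in> V"
    and conn_V: "conn m V"
    and conn_del: "conn m (V - {w})"
    and sep: "x \<noteq> y \<Longrightarrow> m x y = 0 \<Longrightarrow> m w x > 0 \<Longrightarrow> m w y > 0 \<Longrightarrow> \<not> conn m (V - {x, y})"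
begin

lemma in_V': "m u v > 0 \<Longrightarrow> v \<in> V" using in_V[of v u] by (simp add: sym[of v u])

text \<open>Both \<open>{c, d}\<close> and \<open>{c', d}\<close> separate \<open>x\<close> from
  \<open>y\<close>. The intersection of the two sides containing \<open>y\<close> can be left only
  through \<open>d\<close>, which would make \<open>d\<close> a cut vertex.\<close>

lemma no_second_neighbour:
  assumes xy: "x \<in> V" "y \<in> V" "x \<noteq> y"
    and CD: "C \<union> D = V - {x, y}" "C \<inter> D = {}" "\<And>a b. a \<in> C \<Longrightarrow> b \<in> D \<Longrightarrow> m a b = 0"
    and c: "c \<in> C" "m x c > 0" and c': "c' \<in> C" "m x c' > 0" and d: "d \<in> D" "m x d > 0"
  shows "c = c'"
proof (rule ccontr)
  assume ne: "c \<noteq> c'"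
  \<comment> \<open>The pair \<open>e\<close>, \<open>d\<close> separates because \<open>x\<close>
    is a common neighbour and no edge joins \<open>C\<close> to \<open>D\<close>. \<open>B\<close>
    is a side of this separation that avoids \<open>x\<close>; the point is that it contains
    \<open>y\<close>.\<close>
  have side: "\<exists>B. B \<subseteq> V - {e, d} \<and> x \<notin> B \<and> y \<in> B \<and> (\<forall>a\<in>B. \<forall>b. m a b > 0 \<longrightarrow> b \<in> B \<union> {e, d})"
    if e: "e \<in> C" "m x e > 0" for e
  proof -
    have "\<not> conn m (V - {e, d})" 
    proof (rule sep)
      show "e \<noteq> d" using e d CD(2) by blast
      show "m e d = 0" using e d CD(3) by blast
    qed (use e d in auto)
    then obtain A where A: "A \<subseteq> V - {e, d}" "A \<noteq> {}" "V - {e, d} - A \<noteq> {}"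
      "\<And>a b. a \<in> A \<Longrightarrow> b \<in> V - {e, d} - A \<Longrightarrow> m a b = 0" by (rule connE) blast
    define B where "B = (if x \<in> A then V - {e, d} - A else A)"
    have ed: "x \<noteq> e" "x \<noteq> d" using e d CD by auto
    have B: "B \<subseteq> V - {e, d}" "B \<noteq> {}" "x \<notin> B" using A unfolding B_def by auto
    have cl: "b \<in> B \<union> {e, d}" if "a \<in> B" "m a b > 0" for a b
    proof (rule ccontr)
      assume "b \<notin> B \<union> {e, d}"
      then have "b \<in> V - {e, d} - B" using in_V'[OF that(2)] by auto
      then have "m a b = 0 \<or> m b a = 0"
        using A(1,4) that(1) unfolding B_def by (auto split: if_splits)
      then show False using that(2) sym[of a b] by auto
    qed
    \<comment> \<open>A side avoiding both \<open>x\<close> and \<open>y\<close> lies in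
      \<open>C\<close> and \<open>D\<close>. Its part in \<open>C\<close> would be cut off by
      \<open>e\<close> alone and its part in \<open>D\<close> by \<open>d\<close> alone.\<close>
    have "y \<in> B"
    proof (rule ccontr)
      assume y: "y \<notin> B"
      have "B \<inter> C = {}"
      proof (rule ccontr)
        assume "B \<inter> C \<noteq> {}"
        then obtain z where "z \<in> B \<inter> C" by blast
        obtain a b where ab: "a \<in> B \<inter> C" "b \<in> V - {e}" "b \<notin> B \<inter> C" "m a b > 0"
        proof (rule connD[OF conn_del[of e], of "B \<inter> C" z x])
          show "B \<inter> C \<subseteq> V - {e}" "x \<in> V - {e}" "x \<notin> B \<inter> C" using B ed xy by auto
        qed (use \<open>z \<in> B \<inter> C\<close> in auto)
        then have "b \<in> B \<or> b = d" using cl by blast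
        moreover have "b \<notin> D" using ab(1,4) CD(3) by fastforce
        ultimately show False using ab(2,3) B(1,3) y d(1) CD(1) by auto
      qed
      moreover have "B \<inter> D = {}"
      proof (rule ccontr)
        assume "B \<inter> D \<noteq> {}"
        then obtain z where "z \<in> B \<inter> D" by blast
        obtain a b where ab: "a \<in> B \<inter> D" "b \<in> V - {d}" "b \<notin> B \<inter> D" "m a b > 0"
        proof (rule connD[OF conn_del[of d], of "B \<inter> D" z x])
          show "B \<inter> D \<subseteq> V - {d}" "x \<in> V - {d}" "x \<notin> B \<inter> D" using B ed xy by auto
        qed (use \<open>z \<in> B \<inter> D\<close> in auto)
        then have "b \<in> B \<or> b = e" using cl by blast
        moreover have "b \<notin> C" using ab(1,4) CD(3)[of b a] sym[of a b] by fastforce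
        ultimately show False using ab(2,3) B(1,3) y e(1) CD(1) by auto
      qed
      ultimately show False using B(1-3) y CD(1) by auto
    qed
    then show ?thesis using B cl by blast
  qed
  obtain B where B: "B \<subseteq> V - {c, d}" "x \<notin> B" "y \<in> B" "\<And>a b. a \<in> B \<Longrightarrow> m a b > 0 \<Longrightarrow> b \<in> B \<union> {c, d}"
    using side[OF c] by blast
  obtain B' where B': "B' \<subseteq> V - {c', d}" "x \<notin> B'" "y \<in> B'"
    "\<And>a b. a \<in> B' \<Longrightarrow> m a b > 0 \<Longrightarrow> b \<in> B' \<union> {c', d}"
    using side[OF c'] by blast
  have xne: "x \<noteq> c" "x \<noteq> d" "x \<noteq> c'" using c c' d CD by auto
  have "c' \<notin> B" using B(2) B(4)[of c' x] c'(2) sym[of x c'] xne by auto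
  have "c \<notin> B'" using B'(2) B'(4)[of c x] c(2) sym[of x c] xne by auto
  obtain a b where ab: "a \<in> B \<inter> B'" "b \<in> V - {d}" "b \<notin> B \<inter> B'" "m a b > 0"
  proof (rule connD[OF conn_del[of d], of "B \<inter> B'" y x])
    show "B \<inter> B' \<subseteq> V - {d}" "x \<in> V - {d}" "x \<notin> B \<inter> B'" "y \<in> B \<inter> B'" using B(1-3) B'(1-3) xne xy by auto
  qed
  show False using B(4)[of a b] B'(4)[of a b] ab \<open>c' \<notin> B\<close> \<open>c \<notin> B'\<close> ne by auto
qed

text \<open>Asking the two neighbours to be non-adjacent puts them at distance two, so that the
  property passes on to them. It also keeps the triangle out of the cycle case.\<close>

definition path_vertex :: "'v \<Rightarrow> bool" where
  "path_vertex x \<longleftrightarrow> (\<exists>a b. a \<noteq> b \<and> m a b = 0 \<and> {z. m x z > 0} = {a, b})"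

lemma path_vertex_if_dist_two:
  assumes "x \<noteq> y" "m x y = 0" "m w x > 0" "m w y > 0"
  shows "path_vertex x"
proof -
  have V: "x \<in> V" "y \<in> V" using in_V'[OF assms(3)] in_V'[OF assms(4)] by blast+
  obtain C where C: "C \<subseteq> V - {x, y}" "C \<noteq> {}" "V - {x, y} - C \<noteq> {}"
    "\<And>a b. a \<in> C \<Longrightarrow> b \<in> V - {x, y} - C \<Longrightarrow> m a b = 0"
    by (rule connE[OF sep[OF assms]]) blast
  define D where "D = V - {x, y} - C"
  have CD: "C \<union> D = V - {x, y}" "C \<inter> D = {}" "\<And>a b. a \<in> C \<Longrightarrow> b \<in> D \<Longrightarrow> m a b = 0"
    using C by (auto simp: D_def)
  have DC: "D \<union> C = V - {x, y}" "D \<inter> C = {}" using CD(1,2) by blast+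
  have DC3: "m a b = 0" if "a \<in> D" "b \<in> C" for a b using CD(3)[OF that(2,1)] sym[of a b] by simp
  \<comment> \<open>Each side contains a neighbour of \<open>x\<close>; otherwise \<open>y\<close>
    alone would separate that side from \<open>x\<close>.\<close>
  have ex: "\<exists>c\<in>E. m x c > 0" if E: "E \<union> F = V - {x, y}" "E \<noteq> {}" "\<And>a b. a \<in> E \<Longrightarrow> b \<in> F \<Longrightarrow> m a b = 0" for E F
  proof -
    obtain z where z: "z \<in> E" using E by blast
    obtain a b where ab: "a \<in> E" "b \<in> V - {y}" "b \<notin> E" "m a b > 0"
    proof (rule connD[OF conn_del[of y], of E z x])
      show "E \<subseteq> V - {y}" "x \<in> V - {y}" "x \<notin> E" using E(1) V assms(1) by auto
    qed (use z in auto)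
    have "b \<notin> F" using E(3)[OF ab(1), of b] ab(4) by (intro notI) simp
    then have "b = x" using ab(2,3) E(1) by blast
    then show ?thesis using ab(1,4) sym[of a x] by (intro bexI[of _ a]) simp_all
  qed
  obtain c where c: "c \<in> C" "m x c > 0" using ex[OF CD(1) C(2) CD(3)] by blast
  obtain d where d: "d \<in> D" "m x d > 0" using ex[OF DC(1) _ DC3] C(3) D_def by blast
  have "z = c \<or> z = d" if z: "m x z > 0" for z
  proof -
    have "z \<noteq> x" "z \<noteq> y" using z assms(2) irr[of x] by (metis less_irrefl)+
    then have "z \<in> C \<or> z \<in> D" using in_V'[OF z] CD(1) by blast
    then show ?thesis
    proof
      assume "z \<in> C"
      from no_second_neighbour[OF V assms(1) CD c this z d] show ?thesis by simp
    next
      assume "z \<in> D"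
      from no_second_neighbour[OF V assms(1) DC DC3 d this z c] show ?thesis by simp
    qed
  qed
  then have "{z. m x z > 0} = {c, d}" using c d by auto
  moreover have "c \<noteq> d" "m c d = 0" using c d CD(2) CD(3)[OF c(1) d(1)] by blast+
  ultimately show ?thesis unfolding path_vertex_def by (intro exI[of _ c] exI[of _ d] conjI)
qed

text \<open>A missing edge produces two vertices at distance two, hence a path vertex. The
  neighbours of a path vertex are again at distance two from each other, so the property spreads
  through the connected graph.\<close>

lemma complete_or_cycle:
  "(\<forall>x\<in>V. \<forall>y\<in>V. x \<noteq> y \<longrightarrow> m x y > 0) \<or> (\<forall>x\<in>V. path_vertex x)"
proof (rule disjCI)
  assume "\<not> (\<forall>x\<in>V. path_vertex x)"
  then obtain p where p: "p \<in> V" "\<not> path_vertex p" by blast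
  show "\<forall>x\<in>V. \<forall>y\<in>V. x \<noteq> y \<longrightarrow> m x y > 0"
  proof (intro ballI impI, rule ccontr)
    fix x y assume xy: "x \<in> V" "y \<in> V" "x \<noteq> y" "\<not> m x y > 0"
    define A where "A = insert x {z. m x z > 0}"
    obtain a b where ab: "a \<in> A" "b \<in> V" "b \<notin> A" "m a b > 0"
    proof (rule connD[OF conn_V, of A x y])
      show "A \<subseteq> V" using xy(1) by (auto simp: A_def intro: in_V')
      show "x \<in> A" "y \<notin> A" using xy by (auto simp: A_def)
    qed (use xy(2) in auto)
    have "x \<noteq> b" "m x b = 0" using ab(3) by (auto simp: A_def)
    moreover have "a \<noteq> x" using ab(4) \<open>m x b = 0\<close> by (metis less_irrefl)
    then have "m a x > 0" using ab(1) sym[of a x] by (simp add: A_def)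
    ultimately have pv: "path_vertex x" using path_vertex_if_dist_two[of x b a] ab(4) by blast
    obtain q r where qr: "q \<in> {z \<in> V. path_vertex z}" "r \<in> V" "r \<notin> {z \<in> V. path_vertex z}" "m q r > 0"
    proof (rule connD[OF conn_V, of "{z \<in> V. path_vertex z}" x p])
    qed (use xy pv p in auto)
    then obtain c d where cd: "c \<noteq> d" "m c d = 0" "{z. m q z > 0} = {c, d}"
      unfolding path_vertex_def by auto
    have "m q c > 0" "m q d > 0" using cd(3) by blast+
    moreover have "m d c = 0" using cd(2) by (subst sym)
    ultimately have "path_vertex c" "path_vertex d"
      using path_vertex_if_dist_two[of c d q] path_vertex_if_dist_two[of d c q] cd(1,2) by simp_all
    moreover have "r = c \<or> r = d" using qr(4) cd(3) by blast
    ultimately show False using qr(2,3) by auto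
  qed
qed

end

section \<open>Uncolourable covers of graphs without cut vertices\<close>

locale block_cover = list_cover +
  assumes conn_V: "conn m V"
    and conn_del: "conn m (V - {w})"
    and deg: "u \<in> V \<Longrightarrow> mdegree G u \<le> card (L u)"
    and bad: "\<nexists>\<phi>. proper_on X L V \<phi>"
begin

lemma card_L: "u \<in> V \<Longrightarrow> card (L u) = mdegree G u"
  using extend[OF conn_V _ _ _ deg, of u undefined] list_small[OF _ _ bad, of u] deg[of u]
  by (auto simp: proper_on_def)

text \<open>With \<open>u\<close> precoloured by \<open>c\<close>, the remaining vertices are still
  connected because \<open>u\<close> is not a cut vertex, so greedy colouring reaches everything but
  \<open>v\<close>, where the bounds are tight.\<close>

lemma card_N:
  assumes "u \<in> V" "v \<in> V" "u \<noteq> v" "c \<in> L u"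
  shows "card (N u c v) = m u v"
proof -
  have p: "proper_on X L (V - (V - {u})) (\<lambda>_. c)"
    using assms by (auto simp: proper_on_def)
  have "\<exists>\<psi>. proper_on X L (V - {v}) \<psi> \<and> (\<forall>x\<in>V - (V - {u}). \<psi> x = c)"
    by (rule extend[OF conn_del[of u] _ _ p]) (use assms deg in auto)
  then obtain \<psi> where \<psi>: "proper_on X L (V - {v}) \<psi>" "\<psi> u = c" using assms by auto
  show ?thesis using list_tight(1)[OF assms(2) \<psi>(1) bad deg[OF assms(2)], of u] assms \<psi>(2) by simp
qed

text \<open>If \<open>c1\<close> and \<open>c2\<close> were non-adjacent, both could be precoloured
  and the colouring extended up to \<open>w\<close>; then \<open>x\<close> would be blocked twice,
  against disjointness in the tight case.\<close>

lemma adjacent_via_common_neighbour: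
  assumes V: "u1 \<in> V" "u2 \<in> V" "w \<in> V" and ne: "u1 \<noteq> u2" "u1 \<noteq> w" "u2 \<noteq> w"
    and con: "conn m (V - {u1, u2})"
    and x: "x \<in> L w" and c: "c1 \<in> N w x u1" "c2 \<in> N w x u2"
  shows "c2 \<in> N u1 c1 u2"
proof (rule ccontr)
  assume n: "c2 \<notin> N u1 c1 u2"
  have cL: "c1 \<in> L u1" "c2 \<in> L u2" using c N_sub by blast+
  define \<phi> where "\<phi> = (\<lambda>_. c2)(u1 := c1)"
  have p: "proper_on X L (V - (V - {u1, u2})) \<phi>"
    using V ne n cL by (auto simp: proper_on_def \<phi>_def nbrs_def insert_commute)
  have "\<exists>\<psi>. proper_on X L (V - {w}) \<psi> \<and> (\<forall>x\<in>V - (V - {u1, u2}). \<psi> x = \<phi> x)"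
    by (rule extend[OF con _ _ p]) (use V ne deg in auto)
  then obtain \<psi> where \<psi>: "proper_on X L (V - {w}) \<psi>" "\<psi> u1 = c1" "\<psi> u2 = c2"
    using V ne by (auto simp: \<phi>_def)
  have "N u1 c1 w \<inter> N u2 c2 w = {}"
    using list_tight(2)[OF V(3) \<psi>(1) bad deg[OF V(3)]] \<psi>(2,3) V ne
    unfolding disjoint_family_on_def by (metis Diff_iff singletonD)
  moreover have "x \<in> N u1 c1 w" "x \<in> N u2 c2 w" using c cL x N_sym by blast+
  ultimately show False by blast
qed

lemma L_nonempty: "u \<in> V \<Longrightarrow> m u v > 0 \<Longrightarrow> L u \<noteq> {}"
proof -
  assume a: "u \<in> V" "m u v > 0"
  then have "m u v \<le> mdegree G u" unfolding mdegree_def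
    by (intro member_le_sum[of v V "m u"] fin_V m_verts(2)[of u v]) auto
  then show ?thesis using card_L[OF a(1)] a(2) by (intro notI) simp
qed

text \<open>For \<open>sep\<close>: a colour of \<open>w\<close> has neighbours in the lists of both
  \<open>x\<close> and \<open>y\<close> by \<open>card_N\<close>. If \<open>x\<close> and
  \<open>y\<close> did not separate, those neighbours would be adjacent, although multiplicity zero
  admits no edge between the two lists.\<close>

sublocale two_connected V m
proof (rule two_connected.intro)
  show "m u v = m v u" "m u u = 0" for u v by (rule m_sym, rule m_refl)
  show "u \<in> V" if "m u v > 0" for u v using that by (rule m_verts)
  show "conn m V" by (rule conn_V)
  show "conn m (V - {w})" for w by (rule conn_del)
next
  fix x y w assume a: "x \<noteq> y" "m x y = 0" "m w x > 0" "m w y > 0"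
  then have V: "x \<in> V" "y \<in> V" "w \<in> V" and ne: "x \<noteq> w" "y \<noteq> w"
    using m_verts[OF a(3)] m_verts[OF a(4)] m_refl[of w] by auto
  show "\<not> conn m (V - {x, y})"
  proof
    assume con: "conn m (V - {x, y})"
    obtain e where e: "e \<in> L w" using L_nonempty V a by blast
    have "N w e x \<noteq> {}" "N w e y \<noteq> {}" using card_N[of w x e] card_N[of w y e] V ne a e by auto
    then obtain c1 c2 where c: "c1 \<in> N w e x" "c2 \<in> N w e y" by blast
    have "c2 \<in> N x c1 y" by (rule adjacent_via_common_neighbour[OF V a(1) ne con e c])
    moreover have "c1 \<in> L x" using c(1) N_sub by blast
    then have "card (N x c1 y) = 0" using card_N[OF V(1,2) a(1)] a(2) by simp
    then have "N x c1 y = {}" using N_finite[OF V(2)] by simp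
    ultimately show False by blast
  qed
qed

end

section \<open>Layered graphs\<close>

lemma edge_sgraph_of:
  "{x, y} \<in> edges (sgraph_of S R) \<longleftrightarrow> x \<in> S \<and> y \<in> S \<and> x \<noteq> y \<and> (R x y \<or> R y x)"
  by (auto simp: sgraph_of_def doubleton_eq_iff)

text \<open>Adjacency in the model graphs depends on the first two coordinates only. It therefore
  suffices to give the layer by \<open>\<iota>\<close> and the class by \<open>\<kappa>\<close>; the
  \<open>t\<close> colours of a class may be numbered arbitrarily. The relation is symmetrised in
  \<open>edge\<close> as it is by the unordered pairs of \<open>sgraph_of\<close>.\<close>

lemma induces_layeredI:
  assumes \<iota>: "bij_betw \<iota> W {1..n}"
    and fin: "\<And>u. u \<in> W \<Longrightarrow> finite (P u)"
    and \<kappa>: "\<And>u c. u \<in> W \<Longrightarrow> c \<in> P u \<Longrightarrow> \<kappa> u c \<in> J"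
    and cls: "\<And>u j. u \<in> W \<Longrightarrow> j \<in> J \<Longrightarrow> card {c \<in> P u. \<kappa> u c = j} = t"
    and node: "\<And>u c. u \<in> W \<Longrightarrow> c \<in> P u \<Longrightarrow> (u, c) \<in> nodes X"
    and loopless: "\<And>p. {p} \<notin> edges X"
    and edge: "\<And>u v c d. u \<in> W \<Longrightarrow> v \<in> W \<Longrightarrow> c \<in> P u \<Longrightarrow> d \<in> P v \<Longrightarrow> (u, c) \<noteq> (v, d) \<Longrightarrow>
      {(u, c), (v, d)} \<in> edges X \<longleftrightarrow>
      R (\<iota> u) (\<kappa> u c) (\<iota> v) (\<kappa> v d) \<or> R (\<iota> v) (\<kappa> v d) (\<iota> u) (\<kappa> u c)"
  shows "induces_layered X W P
    (sgraph_of ({1..n} \<times> J \<times> {1..t}) (\<lambda>(i, j, k) (i', j', k'). R i j i' j')) n J t"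
    (is "induces_layered _ _ _ ?Y _ _ _")
proof -
  define K where "K u j = {c \<in> P u. \<kappa> u c = j}" for u j
  have "\<exists>g. bij_betw g (K u j) {1..t}" if "u \<in> W" "j \<in> J" for u j
    using that fin cls by (intro finite_same_card_bij) (auto simp: K_def)
  then obtain g where g: "\<And>u j. u \<in> W \<Longrightarrow> j \<in> J \<Longrightarrow> bij_betw (g u j) (K u j) {1..t}" by metis
  define f where "f = (\<lambda>(u, c). (\<iota> u, \<kappa> u c, g u (\<kappa> u c) c))"
  have K_sub: "K u j \<subseteq> P u" for u j by (auto simp: K_def)
  have in_K: "c \<in> K u (\<kappa> u c)" if "c \<in> P u" for u c using that by (auto simp: K_def)
  have layer: "f ` fiber u (P u) = {\<iota> u} \<times> J \<times> {1..t}" if u: "u \<in> W" for u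
  proof
    show "f ` fiber u (P u) \<subseteq> {\<iota> u} \<times> J \<times> {1..t}"
    proof
      fix y assume "y \<in> f ` fiber u (P u)"
      then obtain c where c: "c \<in> P u" "y = f (u, c)" by (auto simp: fiber_def)
      then show "y \<in> {\<iota> u} \<times> J \<times> {1..t}"
        using bij_betwE[OF g[OF u \<kappa>[OF u c(1)]]] in_K[OF c(1)] \<kappa>[OF u c(1)] by (simp add: f_def)
    qed
  next
    show "{\<iota> u} \<times> J \<times> {1..t} \<subseteq> f ` fiber u (P u)"
    proof
      fix y assume "y \<in> {\<iota> u} \<times> J \<times> {1..t}"
      then obtain j k where jk: "y = (\<iota> u, j, k)" "j \<in> J" "k \<in> {1..t}" by blast
      then have "k \<in> g u j ` K u j" using g[OF u jk(2)] by (simp add: bij_betw_def)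
      then obtain c where "c \<in> K u j" "k = g u j c" by blast
      then have "f (u, c) = y" "c \<in> P u" using jk by (auto simp: f_def K_def)
      then show "y \<in> f ` fiber u (P u)" by (force simp: fiber_def)
    qed
  qed
  have inj: "inj_on f (Sigma W P)"
  proof (rule inj_onI)
    fix p q assume "p \<in> Sigma W P" "q \<in> Sigma W P" and eq: "f p = f q"
    then obtain u c v d where p: "p = (u, c)" "q = (v, d)" "u \<in> W" "v \<in> W" "c \<in> P u" "d \<in> P v" by blast
    have "u = v" using eq p bij_betw_imp_inj_on[OF \<iota>] by (auto simp: f_def dest: inj_onD)
    moreover from this have "\<kappa> u c = \<kappa> u d" "g u (\<kappa> u c) c = g u (\<kappa> u c) d" using eq p by (auto simp: f_def)
    then have "c = d"
      using bij_betw_imp_inj_on[OF g[OF p(3) \<kappa>[OF p(3,5)]]] in_K[OF p(5)] in_K[of d u] p(6) \<open>u = v\<close>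
      by (auto dest: inj_onD)
    ultimately show "p = q" using p by simp
  qed
  have S: "(\<Union>u\<in>W. fiber u (P u)) = Sigma W P" by (auto simp: fiber_def)
  have nds: "nodes (induced_subgraph X (\<Union>u\<in>W. fiber u (P u))) = Sigma W P"
    unfolding S using node by (auto simp: induced_subgraph_def)
  have img: "f ` Sigma W P = {1..n} \<times> J \<times> {1..t}"
    unfolding S[symmetric] image_UN using layer \<iota> by (auto simp: bij_betw_def)
  have "sgraph_iso_by f (induced_subgraph X (\<Union>u\<in>W. fiber u (P u))) ?Y"
    unfolding sgraph_iso_by_def nds
  proof (intro conjI ballI)
    show "bij_betw f (Sigma W P) (nodes ?Y)" using inj img by (simp add: bij_betw_def sgraph_of_def)
  next
    fix p q assume pq: "p \<in> Sigma W P" "q \<in> Sigma W P"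
    have fpq: "f p \<in> {1..n} \<times> J \<times> {1..t}" "f q \<in> {1..n} \<times> J \<times> {1..t}" using pq img by blast+
    have e: "{p, q} \<in> edges (induced_subgraph X (\<Union>u\<in>W. fiber u (P u))) \<longleftrightarrow> {p, q} \<in> edges X"
      unfolding S using pq by (simp add: induced_subgraph_def)
    show "{p, q} \<in> edges (induced_subgraph X (\<Union>u\<in>W. fiber u (P u))) \<longleftrightarrow> {f p, f q} \<in> edges ?Y"
    proof (cases "p = q")
      case True
      then show ?thesis unfolding e edge_sgraph_of using loopless[of p] by simp
    next
      case False
      obtain u c v d where p: "p = (u, c)" "q = (v, d)" "u \<in> W" "v \<in> W" "c \<in> P u" "d \<in> P v"
        using pq by blast
      have "f p \<noteq> f q" using False inj pq by (auto dest: inj_onD)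
      then show ?thesis unfolding e edge_sgraph_of using fpq edge[OF p(3-6)] False p(1,2)
        by (simp add: f_def)
    qed
  qed
  moreover have "\<forall>u\<in>W. \<exists>i\<in>{1..n}. f ` fiber u (P u) = {i} \<times> J \<times> {1..t}"
    using layer bij_betwE[OF \<iota>] by blast
  ultimately show ?thesis unfolding induces_layered_def by blast
qed

section \<open>Complete blocks\<close>

lemma conn_complete:
  assumes "\<And>x y. x \<in> U \<Longrightarrow> y \<in> U \<Longrightarrow> x \<noteq> y \<Longrightarrow> m x y > 0"
  shows "conn m U"
  unfolding conn_def
proof (intro allI impI)
  fix A assume A: "A \<subseteq> U" "A \<noteq> {} \<and> A \<noteq> U"
  then obtain a b where ab: "a \<in> A" "b \<in> U - A" by blast
  then have "m a b > 0" using assms[of a b] A by blast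
  then show "\<exists>a\<in>A. \<exists>b\<in>U - A. m a b > 0" using ab by blast
qed

locale complete_block = block_cover +
  assumes complete: "x \<in> V \<Longrightarrow> y \<in> V \<Longrightarrow> x \<noteq> y \<Longrightarrow> m x y > 0"
begin

lemma adj_trans:
  assumes "u \<in> V" "v \<in> V" "w \<in> V" "u \<noteq> v" "u \<noteq> w" "v \<noteq> w" "x \<in> L w" "c \<in> N w x u" "d \<in> N w x v"
  shows "d \<in> N u c v"
  using adjacent_via_common_neighbour[OF assms(1-6) conn_complete assms(7-9)] complete by auto

lemma N_nonempty: "u \<in> V \<Longrightarrow> v \<in> V \<Longrightarrow> u \<noteq> v \<Longrightarrow> c \<in> L u \<Longrightarrow> N u c v \<noteq> {}"
  using card_N[of u v c] complete[of u v] by auto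

text \<open>By \<open>adj_trans\<close>, the neighbours in \<open>L u\<close> of a colour
  \<open>x\<close> of \<open>w\<close> are also neighbours of any colour \<open>c\<close> of
  \<open>v\<close> adjacent to \<open>x\<close>. Comparing sizes in both roles equates the
  multiplicities.\<close>

lemma mult_triple:
  assumes "u \<in> V" "v \<in> V" "w \<in> V" "u \<noteq> v" "u \<noteq> w" "v \<noteq> w"
  shows "m u v = m u w"
proof -
  have le: "m u w \<le> m u v" if vw: "v \<in> V" "w \<in> V" "u \<noteq> v" "u \<noteq> w" "v \<noteq> w" for v w
  proof -
    have "m w u > 0" using complete[of w u] that assms(1) by blast
    then obtain x where x: "x \<in> L w" using L_nonempty[of w u] \<open>w \<in> V\<close> by blast
    obtain c where c: "c \<in> N w x v" using N_nonempty[of w v x] vw x by auto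
    have cL: "c \<in> L v" using c N_sub by blast
    have "N w x u \<subseteq> N v c u" using adj_trans[of v u w x c] assms(1) that x c by blast
    then have "card (N w x u) \<le> card (N v c u)" using N_finite assms(1) by (intro card_mono)
    then show ?thesis using card_N[of w u x] card_N[of v u c] assms(1) that x cL m_sym[of u] by simp
  qed
  show ?thesis using le[of v w] le[of w v] assms by simp
qed

lemma uniform: "\<exists>t\<ge>1. \<forall>u\<in>V. \<forall>v\<in>V. u \<noteq> v \<longrightarrow> m u v = t"
proof (cases "\<exists>a b. a \<in> V \<and> b \<in> V \<and> a \<noteq> b")
  case True
  then obtain a b where ab: "a \<in> V" "b \<in> V" "a \<noteq> b" by blast
  have a: "m a y = m a b" if "y \<in> V" "y \<noteq> a" for y
    using mult_triple[of a y b] that ab by (cases "y = b") auto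
  have "m x y = m a b" if "x \<in> V" "y \<in> V" "x \<noteq> y" for x y
  proof (cases "x = a \<or> y = a")
    case True
    then show ?thesis using a[of x] a[of y] that m_sym[of x y] by auto
  next
    case False
    then have "m x y = m x a" using mult_triple[of x y a] that ab by auto
    then show ?thesis using a[of x] that False m_sym[of x a] by simp
  qed
  then show ?thesis using complete[OF ab] by (intro exI[of _ "m a b"]) auto
qed auto

context
  fixes n t :: nat and \<iota> :: "'a \<Rightarrow> nat"
  assumes \<iota>: "bij_betw \<iota> V {1..n}" and t: "t \<ge> 1"
    and mt: "\<And>u v. u \<in> V \<Longrightarrow> v \<in> V \<Longrightarrow> u \<noteq> v \<Longrightarrow> m u v = t"
begin

lemma card_V: "card V = n"
  using bij_betw_same_card[OF \<iota>] by simp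

lemma card_L_complete: "u \<in> V \<Longrightarrow> card (L u) = t * (n - 1)"
  using mdegree_remove[of u] mt[of _ u] card_L[of u] card_V fin_V by (simp add: card_Diff_singleton)

text \<open>\<open>S u c\<close> labels the adjacency class of a colour. Any set of
  \<open>n - 1\<close> labels will do, because the columns of H(n,t) are interchangeable.\<close>

lemma complete_layeredI:
  assumes F: "\<And>u c. u \<in> V \<Longrightarrow> c \<in> L u \<Longrightarrow> S u c \<in> F" "card F = n - 1" "finite F"
    and cls: "\<And>u p. u \<in> V \<Longrightarrow> p \<in> F \<Longrightarrow> card {c \<in> L u. S u c = p} = t"
    and adj: "\<And>u v c d. u \<in> V \<Longrightarrow> v \<in> V \<Longrightarrow> u \<noteq> v \<Longrightarrow> c \<in> L u \<Longrightarrow> d \<in> L v \<Longrightarrow>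
      d \<in> N u c v \<longleftrightarrow> S u c = S v d"
  shows "induces_layered X V L (H_graph n t) n {1..n - 1} t"
proof -
  obtain h where h: "bij_betw h F {1..n - 1}"
    using F(2,3) by (metis bij_betw_iff_card card_atLeastAtMost diff_Suc_1 finite_atLeastAtMost)
  note hi = bij_betw_imp_inj_on[OF h]
  show ?thesis unfolding H_graph_def
  proof (rule induces_layeredI[where \<kappa> = "\<lambda>u c. h (S u c)" and \<iota> = \<iota> and R = "\<lambda>i j i' j'. i = i' \<or> j = j'"])
    fix u v c d assume a: "u \<in> V" "v \<in> V" "c \<in> L u" "d \<in> L v" "(u, c) \<noteq> (v, d)"
    show "{(u, c), (v, d)} \<in> edges X \<longleftrightarrow>
      (\<iota> u = \<iota> v \<or> h (S u c) = h (S v d)) \<or> (\<iota> v = \<iota> u \<or> h (S v d) = h (S u c))"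
    proof (cases "u = v")
      case True
      then show ?thesis using clique[of u c d] a by auto
    next
      case False
      then have "\<iota> u \<noteq> \<iota> v" using bij_betw_imp_inj_on[OF \<iota>] a(1,2) by (auto dest: inj_onD)
      moreover have "h (S u c) = h (S v d) \<longleftrightarrow> S u c = S v d"
        using F(1) a hi by (auto dest: inj_onD)
      moreover have "{(u, c), (v, d)} \<in> edges X \<longleftrightarrow> d \<in> N u c v" using a by (simp add: nbrs_def)
      ultimately show ?thesis using adj[of u v c d] False a by auto
    qed
  next
    fix u j assume u: "u \<in> V" and j: "j \<in> {1..n - 1}"
      then have "j \<in> h ` F" using bij_betw_imp_surj_on[OF h] by simp
    then obtain p where p: "p \<in> F" "j = h p" by blast
    have "{c \<in> L u. h (S u c) = j} = {c \<in> L u. S u c = p}"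
      using p F(1) u hi by (auto dest: inj_onD)
    then show "card {c \<in> L u. h (S u c) = j} = t" using cls u p by simp
  qed (use \<iota> fin_list node loopless bij_betwE[OF h] F(1) in auto)
qed

lemma complete_induces_H: "induces_layered X V L (H_graph n t) n {1..n - 1} t"
\<comment> \<open>The general argument compares classes through a third vertex, so small
  \<open>n\<close> is separate: there is at most one class.\<close>
proof (cases "n \<le> 2")
  case True
  \<comment> \<open>A dummy label for the single class when \<open>n = 2\<close>; for smaller
    \<open>n\<close> all lists are empty and there is no class.\<close>
  define F where "F = (if n = 2 then {undefined :: nat set} else {})"
  have L0: "L u = {}" if "u \<in> V" "n \<noteq> 2" for u
    using card_L_complete[OF that(1)] that True fin_list[of u] by auto
  have n2: "card (L u) = t" if "u \<in> V" "n = 2" for u using card_L_complete that by simp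
  have ad: "N u c v = L v" if "u \<in> V" "v \<in> V" "u \<noteq> v" "c \<in> L u" for u v c
  proof -
    have "n = 2" using L0 that by auto
    then show ?thesis
      using card_N[OF that] mt[of u v] that n2[of v] fin_list[of v] N_sub[of u c v]
      by (intro card_subset_eq) auto
  qed
  show ?thesis
  proof (rule complete_layeredI[where F = F and S = "\<lambda>u c. undefined"])
    show "card F = n - 1" using True by (auto simp: F_def)
    show "card {c \<in> L u. undefined = p} = t" if "u \<in> V" "p \<in> F" for u p
      using that n2 by (auto simp: F_def split: if_splits)
  qed (use L0 ad in \<open>auto simp: F_def\<close>)
next
  case False
  then obtain u0 where u0: "u0 \<in> V" using card_V by fastforce
  have third: "\<exists>w\<in>V. w \<noteq> a \<and> w \<noteq> b" for a b
  proof (rule ccontr)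
    assume "\<not> ?thesis"
    then have "V \<subseteq> {a, b}" by blast
    then have "card V \<le> card {a, b}" by (intro card_mono) auto
    then show False using False card_V by (simp add: card_insert_if split: if_splits)
  qed
  \<comment> \<open>A class is represented by its trace on the list of a reference vertex
    \<open>u0\<close>. For a colour of \<open>u0\<close> itself, the union in \<open>S\<close> picks
    out the one trace containing it.\<close>
  define F where "F = {N u c u0 | u c. u \<in> V \<and> u \<noteq> u0 \<and> c \<in> L u}"
  define S where "S u c = (if u = u0 then \<Union>{p \<in> F. c \<in> p} else N u c u0)" for u c
  have eq1: "N u c u0 = N v d u0"
    if "u \<in> V" "v \<in> V" "u \<noteq> u0" "v \<noteq> u0" "c \<in> L u" "d \<in> L v" "u \<noteq> v" "d \<in> N u c v" for u v c d
  proof -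
    have sub: "N u c u0 \<subseteq> N v d u0"
      if "u \<in> V" "v \<in> V" "u \<noteq> u0" "v \<noteq> u0" "c \<in> L u" "u \<noteq> v" "d \<in> N u c v" for u v c d
      using adj_trans[of v u0 u c d] u0 that by blast
    show ?thesis using sub[of u v c d] sub[of v u d c] that N_sym[of c u d v] by blast
  qed
  have eq: "N u c u0 = N v d u0"
    if "u \<in> V" "v \<in> V" "u \<noteq> u0" "v \<noteq> u0" "c \<in> L u" "d \<in> L v" "x \<in> N u c u0" "x \<in> N v d u0" for u v c d x
  proof -
    have xL: "x \<in> L u0" using that N_sub by blast
    have ne: "N u c u0 = N v d u0"
      if "u \<in> V" "v \<in> V" "u \<noteq> u0" "v \<noteq> u0" "c \<in> L u" "d \<in> L v" "x \<in> N u c u0" "x \<in> N v d u0" "u \<noteq> v" for u v c d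
    proof (rule eq1[OF that(1-6,9)])
      show "d \<in> N u c v"
        using adj_trans[of u v u0 x c d] that u0 xL N_sym[of x u0 c u] N_sym[of x u0 d v] by simp
    qed
    show ?thesis
    proof (cases "u = v")
      \<comment> \<open>Two colours of the same vertex are compared through a colour
        \<open>e\<close> of a third vertex \<open>w\<close> that is adjacent to
        \<open>x\<close>.\<close>
      case True
      obtain w where w: "w \<in> V" "w \<noteq> u" "w \<noteq> u0" using third by blast
      obtain e where e: "e \<in> N u0 x w" using N_nonempty[of u0 w x] u0 w xL by auto
      then have e': "e \<in> L w" "x \<in> N w e u0" using N_sub N_sym[of x u0 e w] xL by blast+
      show ?thesis using ne[of u w c e] ne[of v w d e] w e' that True by simp
    qed (use ne that in blast)
  qed
  have F_eq: "p = q" if "p \<in> F" "q \<in> F" "x \<in> p" "x \<in> q" for p q x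
    using that eq unfolding F_def by blast
  have F_card: "card p = t" if "p \<in> F" for p
    using that card_N u0 mt unfolding F_def by auto
  have F_sub: "p \<subseteq> L u0" if "p \<in> F" for p using that N_sub unfolding F_def by blast
  have F_cov: "\<exists>p\<in>F. x \<in> p" if x: "x \<in> L u0" for x
  proof -
    obtain w where w: "w \<in> V" "w \<noteq> u0" using third by blast
    obtain e where e: "e \<in> N u0 x w" using N_nonempty[of u0 w x] u0 w x by auto
    then have "e \<in> L w" "x \<in> N w e u0" using N_sub N_sym[of x u0 e w] x by blast+
    then show ?thesis using w unfolding F_def by blast
  qed
  have S0: "S u0 x = p" if "p \<in> F" "x \<in> p" for x p
    using F_eq that unfolding S_def by auto
  have S0F: "S u0 x \<in> F \<and> x \<in> S u0 x" if "x \<in> L u0" for x using F_cov[OF that] S0 by auto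
  have Sn: "S u c \<in> F" "S u c = N u c u0" if "u \<in> V" "u \<noteq> u0" "c \<in> L u" for u c
    using that unfolding S_def F_def by auto
  have iff0: "x \<in> N u c u0 \<longleftrightarrow> S u0 x = S u c" if "u \<in> V" "u \<noteq> u0" "c \<in> L u" "x \<in> L u0" for u c x
    using S0[of "S u c" x] S0F[of x] Sn[of u c] that by auto
  have finF: "finite F" using fin_list[OF u0] F_sub by (meson Pow_iff finite_Pow_iff finite_subset subsetI)
  have "\<Union>F = L u0" using F_sub F_cov by blast
  moreover have "p \<inter> q = {}" if "p \<in> F" "q \<in> F" "p \<noteq> q" for p q using F_eq that by blast
  ultimately have "t * card F = card (L u0)"
    using card_partition[OF finF, of t] F_card fin_list[OF u0] by simp
  then have cF: "card F = n - 1" using card_L_complete[OF u0] t by simp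
  show ?thesis
  proof (rule complete_layeredI[where F = F and S = S])
    show "S u c \<in> F" if "u \<in> V" "c \<in> L u" for u c using that S0F Sn by (cases "u = u0") auto
    show "card F = n - 1" "finite F" by (fact cF, fact finF)
  next
    fix u p assume u: "u \<in> V" and p: "p \<in> F"
    show "card {c \<in> L u. S u c = p} = t"
    proof (cases "u = u0")
      case True
      have "{c \<in> L u. S u c = p} = p" using S0[OF p] S0F F_sub[OF p] True by auto
      then show ?thesis using F_card[OF p] by simp
    next
      case False
      have "p \<noteq> {}" using F_card[OF p] t by auto
      then obtain x where x: "x \<in> p" by blast
      have xL: "x \<in> L u0" using x F_sub p by blast
      \<comment> \<open>One colour \<open>x\<close> of the trace sees exactly the colours of
        \<open>u\<close> in that class, and \<open>card_N\<close> counts them.\<close>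
      have "{c \<in> L u. S u c = p} = N u0 x u"
        using iff0[OF u False _ xL] S0[OF p x] N_sym[OF xL] N_sub[of u0 x u] by auto
      then show ?thesis using card_N[of u0 u x] u0 u False xL mt by simp
    qed
  next
    fix u v c d assume a: "u \<in> V" "v \<in> V" "u \<noteq> v" "c \<in> L u" "d \<in> L v"
    consider "u = u0" | "v = u0" | "u \<noteq> u0" "v \<noteq> u0" by blast
    then show "d \<in> N u c v \<longleftrightarrow> S u c = S v d"
    proof cases
      case 1
      then show ?thesis using iff0[of v d c] a N_sym[of c u d v] by auto
    next
      case 2
      then show ?thesis using iff0[of u c d] a by auto
    next
      case 3
      obtain x where x: "x \<in> N u c u0" using N_nonempty[of u u0 c] a u0 3 by auto
      have xL: "x \<in> L u0" using x N_sub by blast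
      show ?thesis
      proof
        assume "d \<in> N u c v"
        then show "S u c = S v d" using eq1[OF a(1,2) 3 a(4,5,3)] Sn a 3 by simp
      next
        assume "S u c = S v d"
        then have "x \<in> N v d u0" using x Sn a 3 by simp
        then show "d \<in> N u c v"
          using adj_trans[of u v u0 x c d] a 3 u0 x xL N_sym[of x u0 c u] N_sym[of x u0 d v] by simp
      qed
    qed
  qed
qed

end

end

section \<open>Cycle blocks\<close>

lemma cyc_succ_in: "i \<in> {1..n} \<Longrightarrow> cyc_succ n i \<in> {1..n}"
  by (auto simp: cyc_succ_def)

lemma cyc_pred:
  assumes "i \<in> {1..n}"
  obtains j where "j \<in> {1..n}" "cyc_succ n j = i"
  using assms by (intro that[of "if i = 1 then n else i - 1"]) (auto simp: cyc_succ_def)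

section \<open>Closing up a longest path of path vertices to a cycle\<close>

context two_connected
begin

text \<open>A longest path closes up to a cycle: both neighbours of its last vertex lie on it, and the
  inner vertices have no free neighbour.\<close>

lemma cyclic_enumeration:
  assumes fin: "finite V" and ne: "V \<noteq> {}" and pv: "\<And>x. x \<in> V \<Longrightarrow> path_vertex x"
  shows "\<exists>n\<ge>3. \<exists>q. bij_betw q {1..n} V \<and>
    (\<forall>i\<in>{1..n}. \<forall>j\<in>{1..n}. m (q i) (q j) > 0 \<longleftrightarrow> j = cyc_succ n i \<or> i = cyc_succ n j)"
proof -
  have two: "z = a \<or> z = b" if xa: "m x a > 0" "m x b > 0" "a \<noteq> b" "m x z > 0" for x a b z
  proof -
    obtain c d where "{z. m x z > 0} = {c, d}"
      using pv[OF in_V[OF xa(1)]] unfolding path_vertex_def by blast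
    then have "a \<in> {c, d}" "b \<in> {c, d}" "z \<in> {c, d}" using xa by blast+
    then show ?thesis using xa(3) by blast
  qed
  define path where "path p \<longleftrightarrow> distinct p \<and> set p \<subseteq> V \<and>
    (\<forall>i. Suc i < length p \<longrightarrow> m (p ! i) (p ! Suc i) > 0)" for p
  have bnd: "length p \<le> card V" if "path p" for p
    using that card_mono[OF fin, of "set p"] distinct_card[of p] by (simp add: path_def)
  obtain x where x: "x \<in> V" using ne by blast
  then obtain a b where ab: "a \<noteq> b" "{z. m x z > 0} = {a, b}"
    using pv unfolding path_vertex_def by blast
  then have xab: "m x a > 0" "m x b > 0" by blast+
  then have ax: "m a x > 0" by (subst sym)
  \<comment> \<open>This makes a longest path at least three vertices long, the minimal length of a
    cycle.\<close>
  have "path [a, x, b]"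
    unfolding path_def using ab(1) xab ax x in_V'[OF xab(1)] in_V'[OF xab(2)] irr
    by (auto simp: less_Suc_eq nth_Cons' numeral_2_eq_2)
  moreover have "\<forall>p. path p \<longrightarrow> length p < Suc (card V)" using bnd by (simp add: less_Suc_eq_le)
  ultimately have "\<exists>p. path p \<and> (\<forall>p'. path p' \<longrightarrow> length p' \<le> length p)"
    by (intro ex_has_greatest_nat)
  then obtain p where p: "path p" and max: "\<And>p'. path p' \<Longrightarrow> length p' \<le> length p" by blast
  define n where "n = length p"
  have n3: "n \<ge> 3" using max[OF \<open>path [a, x, b]\<close>] by (simp add: n_def)
  have step: "m (p ! i) (p ! Suc i) > 0" if "Suc i < n" for i
    using p that by (simp add: path_def n_def)
  have step': "m (p ! Suc i) (p ! i) > 0" if "Suc i < n" for i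
    using step[OF that] by (subst sym)
  have dist: "p ! i = p ! j \<longleftrightarrow> i = j" if "i < n" "j < n" for i j
    using p that by (simp add: path_def n_def nth_eq_iff_index_eq)
  have pV: "p ! i \<in> V" if "i < n" for i using p that by (auto simp: path_def n_def)
  have on_path: "z \<in> set p" if z: "m (p ! (n - 1)) z > 0" for z
  proof (rule ccontr)
    assume nz: "z \<notin> set p"
    have "path (p @ [z])" unfolding path_def
    proof (intro conjI allI impI)
      show "distinct (p @ [z])" "set (p @ [z]) \<subseteq> V"
        using p nz in_V'[OF z] by (auto simp: path_def)
    next
      fix i assume i: "Suc i < length (p @ [z])"
      show "m ((p @ [z]) ! i) ((p @ [z]) ! Suc i) > 0"
      proof (cases "Suc i < n")
        case True
        then show ?thesis using step by (simp add: nth_append n_def)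
      next
        case False
        then have "i = n - 1" "Suc i = n" using i by (auto simp: n_def)
        then show ?thesis using z n3 by (simp add: nth_append n_def)
      qed
    qed
    then show False using max by fastforce
  qed
  obtain c d where cd: "c \<noteq> d" "{z. m (p ! (n - 1)) z > 0} = {c, d}"
    using pv[OF pV, of "n - 1"] n3 unfolding path_vertex_def by auto
  \<comment> \<open>Besides its predecessor, the last vertex has a second neighbour, which lies on
    the path by maximality.\<close>
  then have "\<exists>z. m (p ! (n - 1)) z > 0 \<and> z \<noteq> p ! (n - 2)" by blast
  then obtain z where z: "m (p ! (n - 1)) z > 0" "z \<noteq> p ! (n - 2)" by blast
  then obtain j where j: "j < n" "z = p ! j" using on_path[of z] by (metis in_set_conv_nth n_def)
  have "j \<noteq> n - 1" using z j irr[of z] by (metis less_irrefl)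
  then have j2: "j < n - 2" using z j n3 by (cases "j = n - 2") auto
  \<comment> \<open>An inner vertex already has two neighbours on the path, so the edge from the
    last vertex can only return to the first.\<close>
  have "j = 0"
  proof (rule ccontr)
    assume "j \<noteq> 0"
    then obtain k where k: "j = Suc k" using not0_implies_Suc by blast
    have zj: "m (p ! j) (p ! (n - 1)) > 0" using z(1) unfolding j(2) by (subst sym)
    have "p ! (n - 1) = p ! k \<or> p ! (n - 1) = p ! Suc j"
    proof (rule two[OF _ _ _ zj])
      show "m (p ! j) (p ! k) > 0" using step'[of k] j2 k by simp
      show "m (p ! j) (p ! Suc j) > 0" using step[of j] j2 by simp
      show "p ! k \<noteq> p ! Suc j" using dist[of k "Suc j"] j2 k by simp
    qed
    then show False using dist[of "n - 1" k] dist[of "n - 1" "Suc j"] j2 k by auto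
  qed
  then have close: "m (p ! (n - 1)) (p ! 0) > 0" using z j by simp
  define q where "q i = p ! (i - 1)" for i
  have edge: "m (q i) (q (cyc_succ n i)) > 0" if "i \<in> {1..n}" for i
    using step[of "i - 1"] close that by (auto simp: q_def cyc_succ_def)
  have inj: "q i = q j \<longleftrightarrow> i = j" if "i \<in> {1..n}" "j \<in> {1..n}" for i j
  proof -
    have "i - 1 < n" "j - 1 < n" "i - 1 = j - 1 \<longleftrightarrow> i = j" using that by auto
    then show ?thesis using dist[of "i - 1" "j - 1"] by (simp add: q_def)
  qed
  have nb: "z = q (cyc_succ n i) \<or> (\<exists>k\<in>{1..n}. z = q k \<and> i = cyc_succ n k)"
    if i: "i \<in> {1..n}" and z: "m (q i) z > 0" for i z
  proof -
    obtain k where k: "k \<in> {1..n}" "cyc_succ n k = i" using cyc_pred[OF i] by blast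
    have "m (q i) (q k) > 0" using edge[OF k(1)] k(2) by (subst sym) simp
    moreover have "q k \<noteq> q (cyc_succ n i)"
      using inj[OF k(1) cyc_succ_in[OF i]] k n3 i by (auto simp: cyc_succ_def split: if_splits)
    ultimately have "z = q (cyc_succ n i) \<or> z = q k" by (intro two[OF edge[OF i] _ _ z]) auto
    then show ?thesis using k by blast
  qed
  have qV: "q ` {1..n} \<subseteq> V" using pV by (auto simp: q_def)
  have "q ` {1..n} = V"
  proof (rule ccontr)
    assume "q ` {1..n} \<noteq> V"
    then obtain y where y: "y \<in> V" "y \<notin> q ` {1..n}" using qV by blast
    have "q 1 \<in> q ` {1..n}" using n3 by simp
    then obtain a b where ab: "a \<in> q ` {1..n}" "b \<in> V" "b \<notin> q ` {1..n}" "m a b > 0"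
      by (rule connD[OF conn_V qV _ y])
    then obtain i where i: "i \<in> {1..n}" "a = q i" by blast
    then show False using nb[OF i(1), of b] cyc_succ_in[OF i(1)] ab(3,4) by blast
  qed
  then have bij: "bij_betw q {1..n} V" unfolding bij_betw_def
    by (intro conjI inj_onI) (use inj in blast)+
  have adj: "m (q i) (q j) > 0 \<longleftrightarrow> j = cyc_succ n i \<or> i = cyc_succ n j"
    if ij: "i \<in> {1..n}" "j \<in> {1..n}" for i j
  proof
    assume "m (q i) (q j) > 0"
    then show "j = cyc_succ n i \<or> i = cyc_succ n j"
      using nb[OF ij(1), of "q j"] inj[OF ij(2)] cyc_succ_in[OF ij(1)] by blast
  next
    assume "j = cyc_succ n i \<or> i = cyc_succ n j"
    then show "m (q i) (q j) > 0"
    proof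
      assume "i = cyc_succ n j"
      then show ?thesis using edge[OF ij(2)] by (subst sym) simp
    qed (use edge[OF ij(1)] in simp)
  qed
  show ?thesis by (intro exI[of _ n] exI[of _ q] conjI ballI n3 bij adj)
qed

end

section \<open>Lists over a cycle: splitting each list into two halves\<close>

locale cycle_block = block_cover +
  assumes path: "x \<in> V \<Longrightarrow> path_vertex x"
begin

lemma two_neighbours:
  assumes "w \<in> V"
  obtains u1 u2 where "u1 \<noteq> u2" "{z. m w z > 0} = {u1, u2}"
  using path[OF assms] unfolding path_vertex_def by blast

text \<open>Once \<open>u1\<close> is deleted, \<open>w\<close> has no neighbour but
  \<open>u2\<close>, and removing such a pendant vertex keeps the rest connected.\<close>

lemma conn_remove_edge:
  assumes "{z. m w z > 0} = {u1, u2}"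
  shows "conn m (V - {u1, w})"
  unfolding conn_def
proof (intro allI impI)
  fix A assume A: "A \<subseteq> V - {u1, w}" "A \<noteq> {} \<and> A \<noteq> V - {u1, w}"
  then obtain x y where xy: "x \<in> A" "y \<in> V - {u1, w}" "y \<notin> A" by blast
  have nb: "z = u1 \<or> z = u2" if "m w z > 0" for z using assms that by blast
  have nb': "z = u1 \<or> z = u2" if "m z w > 0" for z using nb[of z] m_sym[of w z] that by simp
  \<comment> \<open>\<open>w\<close> joins the side of \<open>u2\<close>, so that the crossing edge
    found in \<open>V - {u1}\<close> does not use \<open>w\<close>.\<close>
  define A' where "A' = (if u2 \<in> A \<and> w \<noteq> u1 then insert w A else A)"
  have wV: "w \<in> V" using assms by (intro m_verts(1)[of w u1]) blast
  obtain a b where ab: "a \<in> A'" "b \<in> V - {u1}" "b \<notin> A'" "m a b > 0"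
  proof (rule connD[OF conn_del[of u1], of A' x y])
    show "A' \<subseteq> V - {u1}" using A(1) wV by (auto simp: A'_def)
  qed (use xy in \<open>auto simp: A'_def\<close>)
  have "a \<in> A \<and> b \<in> V - {u1, w} - A"
    using ab nb[of b] nb'[of a] A(1) by (auto simp: A'_def split: if_splits)
  then show "\<exists>a\<in>A. \<exists>b\<in>V - {u1, w} - A. m a b > 0" using ab(4) by blast
qed

lemma degree_two:
  assumes "u1 \<noteq> u2" "{z. m w z > 0} = {u1, u2}"
  shows "mdegree G w = m w u1 + m w u2"
proof -
  have sub: "{u1, u2} \<subseteq> V" using assms(2) m_verts(2)[of w] by blast
  have "mdegree G w = (\<Sum>z\<in>{u1, u2}. m w z)"
    unfolding mdegree_def using assms(2) sub fin_V by (intro sum.mono_neutral_right) auto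
  then show ?thesis using assms(1) by simp
qed

text \<open>Precolour \<open>u1\<close> with \<open>c\<close> and extend to everything except \<open>u2\<close>: the colours of \<open>u2\<close> that
  are left over by the other vertices do not depend on the colour of \<open>w\<close>.\<close>

lemma constant_neighbourhood:
  assumes nbw: "u1 \<noteq> u2" "{z. m w z > 0} = {u1, u2}" and c: "c \<in> L u1"
    and y: "y \<in> L w - N u1 c w" and y': "y' \<in> L w - N u1 c w"
  shows "N w y u2 = N w y' u2"
proof -
  have mw: "m w u1 > 0" "m w u2 > 0" using nbw by blast+
  have V: "w \<in> V" "u1 \<in> V" "u2 \<in> V" using m_verts[OF mw(1)] m_verts[OF mw(2)] by auto
  have ne: "w \<noteq> u1" "w \<noteq> u2" using mw m_refl[of w] by auto
  define \<phi> where "\<phi> = (\<lambda>_. y)(u1 := c)"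
  have p: "proper_on X L (V - (V - {u1, w})) \<phi>"
    using c y V ne by (auto simp: proper_on_def \<phi>_def nbrs_def insert_commute)
  have "\<exists>\<psi>. proper_on X L (V - {u2}) \<psi> \<and> (\<forall>x\<in>V - (V - {u1, w}). \<psi> x = \<phi> x)"
    by (rule extend[OF conn_remove_edge[OF nbw(2)] _ _ p]) (use V ne nbw deg in auto)
  then obtain \<psi> where \<psi>: "proper_on X L (V - {u2}) \<psi>" "\<psi> u1 = c" "\<psi> w = y"
    using V ne by (auto simp: \<phi>_def)
  \<comment> \<open>\<open>w\<close> may be recoloured freely outside the neighbourhood of
    \<open>c\<close>: among its neighbours only \<open>u1\<close> is coloured, since
    \<open>u2\<close> is left out.\<close>
  have pr: "proper_on X L (V - {u2}) (\<psi>(w := e))" if e: "e \<in> L w - N u1 c w" for e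
  proof -
    have "proper_on X L (V - {u2} - {w}) \<psi>" using \<psi>(1) by (auto simp: proper_on_def)
    moreover have "\<forall>v\<in>V - {u2} - {w}. e \<notin> N v (\<psi> v) w"
    proof
      fix v assume v: "v \<in> V - {u2} - {w}"
      show "e \<notin> N v (\<psi> v) w"
      proof (cases "v = u1")
        case False
        then have "v \<notin> {z. m w z > 0}" unfolding nbw(2) using v by blast
        then have "m v w = 0" by (simp add: m_sym[of v w])
        moreover have "\<psi> v \<in> L v" using \<psi>(1) v by (simp add: proper_on_def)
        then have "card (N v (\<psi> v) w) = m v w" using v V(1) by (intro card_N) auto
        ultimately have "card (N v (\<psi> v) w) = 0" by (rule trans[rotated])
        then show ?thesis using N_finite[OF V(1)] by simp
      qed (use \<psi>(2) e in auto)
    qed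
    ultimately have "proper_on X L (insert w (V - {u2} - {w})) (\<psi>(w := e))"
      using e by (intro proper_on_insert) auto
    moreover have "insert w (V - {u2} - {w}) = V - {u2}" using V ne by auto
    ultimately show ?thesis by simp
  qed
  \<comment> \<open>The colours of \<open>u2\<close> blocked by vertices other than
    \<open>w\<close>. Recolouring \<open>w\<close> does not change this set, and tightness makes the
    neighbourhood of the colour of \<open>w\<close> its complement.\<close>
  define Q where "Q = (\<Union>v\<in>V - {u2} - {w}. N v (\<psi> v) u2)"
  have eq: "N w e u2 = L u2 - Q" if e: "e \<in> L w - N u1 c w" for e
  proof -
    let ?B = "\<lambda>v. N v ((\<psi>(w := e)) v) u2"
    have Q: "(\<Union>v\<in>V - {u2} - {w}. ?B v) = Q" unfolding Q_def by (intro SUP_cong) auto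
    have B: "?B w = N w e u2" by simp
    have ins: "V - {u2} = insert w (V - {u2} - {w})" using V ne by blast
    have "L u2 \<subseteq> (\<Union>v\<in>V - {u2}. ?B v)" by (rule list_covered[OF V(3) pr[OF e] bad])
    also have "\<dots> = ?B w \<union> (\<Union>v\<in>V - {u2} - {w}. ?B v)" by (subst ins) (rule UN_insert)
    finally have cov: "L u2 \<subseteq> N w e u2 \<union> Q" unfolding Q B .
    have dj: "disjoint_family_on ?B (V - {u2})"
      by (rule list_tight(2)[OF V(3) pr[OF e] bad deg[OF V(3)]])
    have "?B w \<inter> ?B v = {}" if v: "v \<in> V - {u2} - {w}" for v
      by (rule disjoint_family_onD[OF dj]) (use v V(1) ne in auto)
    then have "?B w \<inter> (\<Union>v\<in>V - {u2} - {w}. ?B v) = {}" by blast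
    then have "N w e u2 \<inter> Q = {}" unfolding Q B .
    then show ?thesis using cov N_sub[of w e u2] by blast
  qed
  show ?thesis using eq[OF y] eq[OF y'] by simp
qed

text \<open>All colours of \<open>w\<close> left free by \<open>c\<close> have the same
  neighbourhood in \<open>L u2\<close>, so each of them is adjacent to \<open>z\<close>. Their
  number is the degree minus \<open>m w u1\<close>, that is \<open>m w u2\<close>, which is the size
  of the neighbourhood of \<open>z\<close>.\<close>

lemma complement_neighbourhood:
  assumes nbw: "u1 \<noteq> u2" "{z. m w z > 0} = {u1, u2}" and c: "c \<in> L u1"
    and y: "y \<in> L w - N u1 c w" and z: "z \<in> N w y u2"
  shows "N u2 z w = L w - N u1 c w"
proof -
  have mw: "m w u1 > 0" "m w u2 > 0" using nbw by blast+
  have V: "w \<in> V" "u1 \<in> V" "u2 \<in> V" using m_verts[OF mw(1)] m_verts[OF mw(2)] by auto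
  have ne: "w \<noteq> u1" "w \<noteq> u2" using mw m_refl[of w] by auto
  have zL: "z \<in> L u2" using z N_sub by blast
  have "y' \<in> N u2 z w" if y': "y' \<in> L w - N u1 c w" for y'
    using constant_neighbourhood[OF nbw c y y'] z N_sym[of y' w z u2] y' zL by simp
  moreover have "card (N u2 z w) = card (L w - N u1 c w)"
    using card_N[OF V(3,1) _ zL] card_N[OF V(2,1) _ c] ne card_L[OF V(1)] degree_two[OF nbw]
      m_sym[of w u1] m_sym[of w u2] card_Diff_subset[OF N_finite[OF V(1)] N_sub, of u1 c] by simp
  ultimately show ?thesis using N_finite[OF V(1)] by (intro card_subset_eq[symmetric]) auto
qed

text \<open>Let \<open>H\<close> be the neighbourhood in \<open>L w\<close> of one colour of
  \<open>u1\<close> and \<open>K\<close> its complement. A colour of \<open>u2\<close> that meets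
  \<open>K\<close> sees exactly \<open>K\<close>, and then a colour of \<open>u1\<close> that meets
  \<open>H\<close> sees exactly \<open>H\<close>. Since every colour of \<open>w\<close> is seen
  from both neighbours, some neighbourhood from \<open>u1\<close> fits into \<open>K\<close> and
  some neighbourhood from \<open>u2\<close> fits into \<open>H\<close>; so the two multiplicities
  agree, and these inclusions become equalities.\<close>

lemma halves:
  assumes nbw: "u1 \<noteq> u2" "{z. m w z > 0} = {u1, u2}"
  shows "m w u1 = m w u2"
    and "\<exists>H\<subseteq>L w. card H = m w u1 \<and>
      (\<forall>u\<in>{u1, u2}. \<forall>c\<in>L u. N u c w = H \<or> N u c w = L w - H)"
proof -
  have nbw': "u2 \<noteq> u1" "{z. m w z > 0} = {u2, u1}" using nbw by auto
  have mw: "m w u1 > 0" "m w u2 > 0" using nbw by blast+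
  have V: "w \<in> V" "u1 \<in> V" "u2 \<in> V" using m_verts[OF mw(1)] m_verts[OF mw(2)] by auto
  have ne: "w \<noteq> u1" "w \<noteq> u2" using mw m_refl[of w] by auto
  have c1: "card (N u1 c w) = m w u1" if "c \<in> L u1" for c
    using card_N[OF V(2,1) _ that] ne m_sym[of w u1] by simp
  have c2: "card (N u2 c w) = m w u2" if "c \<in> L u2" for c
    using card_N[OF V(3,1) _ that] ne m_sym[of w u2] by simp
  have ex1: "\<exists>c\<in>L u1. y \<in> N u1 c w" if y: "y \<in> L w" for y
  proof -
    have "N w y u1 \<noteq> {}" using card_N[of w u1 y] V ne y mw by auto
    then obtain c where "c \<in> N w y u1" by blast
    then show ?thesis using N_sub N_sym[of y w c u1] y by blast
  qed
  have ex2: "\<exists>c\<in>L u2. y \<in> N u2 c w" if y: "y \<in> L w" for y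
  proof -
    have "N w y u2 \<noteq> {}" using card_N[of w u2 y] V ne y mw by auto
    then obtain c where "c \<in> N w y u2" by blast
    then show ?thesis using N_sub N_sym[of y w c u2] y by blast
  qed
  have "L u1 \<noteq> {}" using L_nonempty[OF V(2), of w] mw m_sym[of w u1] by simp
  then obtain c0 where c0: "c0 \<in> L u1" by blast
  define H where "H = N u1 c0 w"
  define K where "K = L w - H"
  have HL: "H \<subseteq> L w" using N_sub by (simp add: H_def)
  have finL: "finite (L w)" using fin_list V by blast
  have cH: "card H = m w u1" using c1 c0 by (simp add: H_def)
  have cK: "card K = m w u2"
    using cH HL finL card_L[OF V(1)] degree_two[OF nbw] by (simp add: K_def card_Diff_subset finite_subset)
  have A2: "N u2 z w = K" if "z \<in> L u2" "y \<in> K" "y \<in> N u2 z w" for z y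
    using complement_neighbourhood[OF nbw c0, of y z] that N_sym[of y w z u2] by (auto simp: K_def H_def)
  have "K \<noteq> {}" using cK mw by auto
  then obtain y0 where y0: "y0 \<in> K" by blast
  then obtain z0 where z0: "z0 \<in> L u2" "N u2 z0 w = K" using A2 ex2[of y0] K_def by blast
  have HK: "H = L w - K" using HL by (auto simp: K_def)
  have A1: "N u1 c w = H" if "c \<in> L u1" "x \<in> H" "x \<in> N u1 c w" for c x
    using complement_neighbourhood[OF nbw' z0(1), of x c] that N_sym[of x w c u1] z0(2) HL HK by auto
  have B2: "N u2 z w = K \<or> N u2 z w \<subseteq> H" if "z \<in> L u2" for z
    using A2[OF that] N_sub[of u2 z w] by (auto simp: K_def)
  have B1: "N u1 c w = H \<or> N u1 c w \<subseteq> K" if "c \<in> L u1" for c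
    using A1[OF that] N_sub[of u1 c w] by (auto simp: K_def)
  have finH: "finite H" "finite K" using HL finL finite_subset by (auto simp: K_def)
  have "m w u1 \<le> m w u2"
  proof -
    obtain c where "c \<in> L u1" "y0 \<in> N u1 c w" using ex1[of y0] y0 by (auto simp: K_def)
    then show ?thesis using B1[of c] c1[of c] cK card_mono[OF finH(2), of "N u1 c w"] y0 by (auto simp: K_def)
  qed
  moreover have "m w u2 \<le> m w u1"
  proof -
    have "H \<noteq> {}" using cH mw by auto
    then obtain x where x: "x \<in> H" by blast
    then obtain z where "z \<in> L u2" "x \<in> N u2 z w" using ex2[of x] HL by blast
    then show ?thesis using B2[of z] c2[of z] cH card_mono[OF finH(1), of "N u2 z w"] x by (auto simp: K_def)
  qed
  ultimately show eq: "m w u1 = m w u2" by simp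
  have "N u1 c w = H \<or> N u1 c w = K" if "c \<in> L u1" for c
    using B1[OF that] card_subset_eq[OF finH(2), of "N u1 c w"] c1[OF that] cK eq by auto
  moreover have "N u2 c w = H \<or> N u2 c w = K" if "c \<in> L u2" for c
    using B2[OF that] card_subset_eq[OF finH(1), of "N u2 c w"] c2[OF that] cH eq by auto
  ultimately show "\<exists>H\<subseteq>L w. card H = m w u1 \<and>
      (\<forall>u\<in>{u1, u2}. \<forall>c\<in>L u. N u c w = H \<or> N u c w = L w - H)"
    using HL cH by (intro exI[of _ H]) (auto simp: K_def)
qed

lemma uniform:
  assumes "V \<noteq> {}"
  shows "\<exists>t\<ge>1. \<forall>u v. m u v > 0 \<longrightarrow> m u v = t"
proof -
  obtain a where a: "a \<in> V" using assms by blast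
  obtain b1 b2 where b: "b1 \<noteq> b2" "{z. m a z > 0} = {b1, b2}" using two_neighbours[OF a] by blast
  define t where "t = m a b1"
  define A where "A = {x \<in> V. \<forall>z. m x z > 0 \<longrightarrow> m x z = t}"
  have clos: "x \<in> A" if x: "x \<in> V" "m x y = t" "m x y > 0" for x y
  proof -
    obtain c d where c: "c \<noteq> d" "{z. m x z > 0} = {c, d}" using two_neighbours[OF x(1)] by blast
    then have "y = c \<or> y = d" using x(3) by blast
    then have "m x c = t" "m x d = t" using halves(1)[OF c] x(2) by auto
    then show ?thesis using x(1) c(2) by (auto simp: A_def)
  qed
  have tpos: "t > 0" using b by (auto simp: t_def)
  then have "a \<in> A" using clos[OF a, of b1] by (simp add: t_def)
  have "A = V"
  proof (rule ccontr)
    assume "A \<noteq> V"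
    then obtain y where y: "y \<in> V" "y \<notin> A" by (auto simp: A_def)
    have "A \<subseteq> V" by (auto simp: A_def)
    then obtain c d where cd: "c \<in> A" "d \<in> V" "d \<notin> A" "m c d > 0"
      by (rule connD[OF conn_V _ \<open>a \<in> A\<close> y])
    then have "m c d = t" by (simp add: A_def)
    then show False using clos[of d c] cd m_sym[of d c] by simp
  qed
  then have "\<forall>u v. m u v > 0 \<longrightarrow> m u v = t" using m_verts(1) by (auto simp: A_def)
  moreover have "t \<ge> 1" using tpos by simp
  ultimately show ?thesis by blast
qed

end

section \<open>From halves to ladders: parity around the cycle\<close>

lemma cyc_succ_asym: "n \<ge> 3 \<Longrightarrow> cyc_succ n (cyc_succ n i) \<noteq> i"
  by (simp add: cyc_succ_def)

context cycle_block
begin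

context
  fixes n t :: nat and \<iota> :: "'a \<Rightarrow> nat"
  assumes \<iota>: "bij_betw \<iota> V {1..n}" and n3: "n \<ge> 3" and t1: "t \<ge> 1"
    and mt: "\<And>u v. u \<in> V \<Longrightarrow> v \<in> V \<Longrightarrow>
      m u v = (if \<iota> v = cyc_succ n (\<iota> u) \<or> \<iota> u = cyc_succ n (\<iota> v) then t else 0)"
begin

lemma list_halves:
  assumes w: "w \<in> V"
  shows "card (L w) = 2 * t"
    and "\<exists>H\<subseteq>L w. card H = t \<and> (\<forall>u. m u w > 0 \<longrightarrow> (\<forall>c\<in>L u. N u c w = H \<or> N u c w = L w - H))"
proof -
  obtain u1 u2 where nb: "u1 \<noteq> u2" "{z. m w z > 0} = {u1, u2}" using two_neighbours[OF w] by blast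
  have mw: "m w u1 > 0" "m w u2 > 0" using nb(2) by blast+
  have eqt: "m w u = t" if "m w u > 0" for u
    using mt[OF w m_verts(2)[OF that]] that by (auto split: if_splits)
  show "card (L w) = 2 * t"
    using card_L[OF w] degree_two[OF nb] eqt[OF mw(1)] eqt[OF mw(2)] by simp
  obtain H where H: "H \<subseteq> L w" "card H = m w u1"
    "\<And>u c. u \<in> {u1, u2} \<Longrightarrow> c \<in> L u \<Longrightarrow> N u c w = H \<or> N u c w = L w - H"
    using halves(2)[OF nb] by blast
  have "u \<in> {u1, u2}" if "m u w > 0" for u
    using that unfolding nb(2)[symmetric] by (simp add: m_sym[of u w])
  then show "\<exists>H\<subseteq>L w. card H = t \<and> (\<forall>u. m u w > 0 \<longrightarrow> (\<forall>c\<in>L u. N u c w = H \<or> N u c w = L w - H))"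
    using H eqt[OF mw(1)] by (intro exI[of _ H] conjI allI impI ballI) simp_all
qed

text \<open>\<open>\<tau>\<close> records whether the identifications of the halves along the cycle compose to a flip;
  colouring alternately with the two classes shows that this must happen exactly for even \<open>n\<close>.\<close>

lemma letters:
  "\<exists>K :: 'a \<Rightarrow> nat \<Rightarrow> bool. (\<forall>u\<in>V. \<forall>x. card {c \<in> L u. K u c = x} = t) \<and>
    (\<forall>u\<in>V. \<forall>v\<in>V. \<forall>c\<in>L u. \<forall>d\<in>L v. \<iota> v = cyc_succ n (\<iota> u) \<longrightarrow>
      ({(u, c), (v, d)} \<in> edges X \<longleftrightarrow> ((K u c = K v d) \<noteq> (\<iota> u = n \<and> even n))))"
proof -
  obtain H where H: "\<And>w. w \<in> V \<Longrightarrow> H w \<subseteq> L w" "\<And>w. w \<in> V \<Longrightarrow> card (H w) = t"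
    "\<And>w u c. w \<in> V \<Longrightarrow> m u w > 0 \<Longrightarrow> c \<in> L u \<Longrightarrow> N u c w = H w \<or> N u c w = L w - H w"
    using list_halves(2) by metis
  have "\<exists>f. \<forall>c\<in>L u. \<forall>d\<in>L v. {(u, c), (v, d)} \<in> edges X \<longleftrightarrow> ((c \<in> H u) = (d \<in> H v)) \<noteq> f"
    if uv: "u \<in> V" "v \<in> V" "m u v > 0" for u v
  proof -
    have m': "m v u > 0" using uv(3) by (subst m_sym)
    have "H u \<noteq> {}" using H(2)[OF uv(1)] t1 by auto
    then obtain c0 where c0: "c0 \<in> H u" "c0 \<in> L u" using H(1)[OF uv(1)] by blast
    \<comment> \<open>One representative \<open>c0\<close> decides for the whole edge whether the
      halves are joined straight or flipped, because neighbourhoods in both directions are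
      halves.\<close>
    define f where "f \<longleftrightarrow> N u c0 v \<noteq> H v"
    have "{(u, c), (v, d)} \<in> edges X \<longleftrightarrow> ((c \<in> H u) = (d \<in> H v)) \<noteq> f" if cd: "c \<in> L u" "d \<in> L v" for c d
    proof -
      have 0: "c0 \<in> N v d u \<longleftrightarrow> (d \<in> H v) \<noteq> f"
        using H(3)[OF uv(2,3) c0(2)] cd N_sym[OF c0(2) cd(2)] H(1)[OF uv(2)] by (auto simp: f_def)
      have "c \<in> N v d u \<longleftrightarrow> (c \<in> H u) = (c0 \<in> N v d u)"
        using H(3)[OF uv(1) m' cd(2)] cd(1) c0 by auto
      moreover have "{(u, c), (v, d)} \<in> edges X \<longleftrightarrow> c \<in> N v d u"
        using cd by (simp add: nbrs_def insert_commute)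
      ultimately show ?thesis using 0 by blast
    qed
    then show ?thesis by blast
  qed
  then obtain f where f: "\<And>u v c d. u \<in> V \<Longrightarrow> v \<in> V \<Longrightarrow> m u v > 0 \<Longrightarrow> c \<in> L u \<Longrightarrow> d \<in> L v \<Longrightarrow>
      {(u, c), (v, d)} \<in> edges X \<longleftrightarrow> ((c \<in> H u) = (d \<in> H v)) \<noteq> f u v" by metis
  define q where "q = inv_into V \<iota>"
  have q: "q i \<in> V" "\<iota> (q i) = i" if "i \<in> {1..n}" for i
    using that \<iota> by (auto simp: q_def bij_betw_def intro: inv_into_into f_inv_into_f)
  have q\<iota>: "q (\<iota> u) = u" if "u \<in> V" for u
    using that \<iota> by (simp add: q_def bij_betw_def)
  have \<iota>in: "\<iota> u \<in> {1..n}" if "u \<in> V" for u using bij_betwE[OF \<iota>] that by blast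
  \<comment> \<open>The parity of the flips met between positions \<open>1\<close> and
    \<open>i\<close>. Relabelling the halves by it straightens every edge except the closing
    one.\<close>
  define s where "s i = odd (card {j \<in> {1..<i}. f (q j) (q (Suc j))})" for i
  have s1: "\<not> s 1" by (simp add: s_def)
  have sS: "s (Suc i) = (s i \<noteq> f (q i) (q (Suc i)))" if "i \<ge> 1" for i
  proof -
    have "{j \<in> {1..<Suc i}. f (q j) (q (Suc j))} =
      (if f (q i) (q (Suc i)) then insert i {j \<in> {1..<i}. f (q j) (q (Suc j))}
       else {j \<in> {1..<i}. f (q j) (q (Suc j))})"
      using that by (auto simp: less_Suc_eq)
    then show ?thesis by (simp add: s_def)
  qed
  define K where "K u c \<longleftrightarrow> (c \<in> H u) \<noteq> s (\<iota> u)" for u c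
  define \<tau> where "\<tau> \<longleftrightarrow> f (q n) (q 1) \<noteq> s n"
  have half: "card {c \<in> L u. (c \<in> H u) = x} = t" if u: "u \<in> V" for u x
  proof (cases x)
    case True
    then have "{c \<in> L u. (c \<in> H u) = x} = H u" using H(1)[OF u] by auto
    then show ?thesis using H(2)[OF u] by simp
  next
    case False
    then have "{c \<in> L u. (c \<in> H u) = x} = L u - H u" by auto
    then show ?thesis
      using H(1,2)[OF u] list_halves(1)[OF u] fin_list[OF u] by (simp add: card_Diff_subset finite_subset)
  qed
  have cls: "card {c \<in> L u. K u c = x} = t" if u: "u \<in> V" for u x
  proof -
    have "{c \<in> L u. K u c = x} = {c \<in> L u. (c \<in> H u) = (x \<noteq> s (\<iota> u))}" by (auto simp: K_def)
    then show ?thesis using half[OF u] by simp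
  qed
  have edge: "{(u, c), (v, d)} \<in> edges X \<longleftrightarrow> (K u c = K v d) \<noteq> (\<iota> u = n \<and> \<tau>)"
    if a: "u \<in> V" "v \<in> V" "\<iota> v = cyc_succ n (\<iota> u)" "c \<in> L u" "d \<in> L v" for u v c d
  proof -
    have "m u v > 0" using mt[OF a(1,2)] a(3) t1 by simp
    note e = f[OF a(1,2) this a(4,5)]
    show ?thesis
    proof (cases "\<iota> u = n")
      case True
      then have "\<iota> v = 1" using a(3) by (simp add: cyc_succ_def)
      then have "v = q 1" "u = q n" using q\<iota>[OF a(1)] q\<iota>[OF a(2)] True by simp_all
      then show ?thesis unfolding e K_def \<tau>_def True \<open>\<iota> v = 1\<close> using s1 by blast
    next
      case False
      then have iv: "\<iota> v = Suc (\<iota> u)" using a(3) by (simp add: cyc_succ_def)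
      then have "v = q (Suc (\<iota> u))" "u = q (\<iota> u)" using q\<iota>[OF a(1)] q\<iota>[OF a(2)] by simp_all
      then have "s (\<iota> v) = (s (\<iota> u) \<noteq> f u v)" using sS[of "\<iota> u"] \<iota>in[OF a(1)] iv by simp
      then show ?thesis unfolding e K_def using False by blast
    qed
  qed
  have "\<tau> \<longleftrightarrow> even n"
  proof (rule ccontr)
    assume \<tau>: "\<not> (\<tau> \<longleftrightarrow> even n)"
    have "\<exists>c\<in>L u. K u c = even (\<iota> u)" if "u \<in> V" for u
    proof -
      have "{c \<in> L u. K u c = even (\<iota> u)} \<noteq> {}"
        using cls[OF that, of "even (\<iota> u)"] t1 by (intro notI) simp
      then show ?thesis by blast
    qed
    then obtain \<phi> where \<phi>: "\<And>u. u \<in> V \<Longrightarrow> \<phi> u \<in> L u" "\<And>u. u \<in> V \<Longrightarrow> K u (\<phi> u) = even (\<iota> u)"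
      by metis
    have no: "{(u, \<phi> u), (v, \<phi> v)} \<notin> edges X"
      if a: "u \<in> V" "v \<in> V" "\<iota> v = cyc_succ n (\<iota> u)" for u v
      unfolding edge[OF a \<phi>(1)[OF a(1)] \<phi>(1)[OF a(2)]] \<phi>(2)[OF a(1)] \<phi>(2)[OF a(2)]
      using a(3) \<tau> by (auto simp: cyc_succ_def split: if_splits)
    have "proper_on X L V \<phi>" unfolding proper_on_def
    proof (intro conjI ballI impI)
      fix u v assume uv: "u \<in> V" "v \<in> V" "u \<noteq> v"
      consider "\<iota> v = cyc_succ n (\<iota> u)" | "\<iota> u = cyc_succ n (\<iota> v)" | "m u v = 0"
        using mt[OF uv(1,2)] by (auto split: if_splits)
      then show "{(u, \<phi> u), (v, \<phi> v)} \<notin> edges X"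
      proof cases
        case 3
        then have "card (N u (\<phi> u) v) = 0" using card_N[OF uv \<phi>(1)] uv(1) by simp
        then have "\<phi> v \<notin> N u (\<phi> u) v" using N_finite[OF uv(2)] by simp
        then show ?thesis using \<phi>(1)[OF uv(2)] by (simp add: nbrs_def)
      qed (use no[OF uv(1,2)] no[OF uv(2,1)] in \<open>simp_all add: insert_commute\<close>)
    qed (use \<phi> in auto)
    then show False using bad by blast
  qed
  note edge' = edge[unfolded this]
  show ?thesis
  proof (intro exI[of _ K] conjI ballI allI impI)
    show "card {c \<in> L u. K u c = x} = t" if "u \<in> V" for u x using that by (rule cls)
  qed (rule edge')
qed

text \<open>Both ladders are instances: they differ only at the closing edge from \<open>n\<close>
  to \<open>1\<close>, which is crossed exactly for even \<open>n\<close>.\<close>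

lemma cycle_layeredI:
  assumes "\<And>i j i' j'. i \<in> {1..n} \<Longrightarrow> i' \<in> {1..n} \<Longrightarrow> j \<in> {1, 2} \<Longrightarrow> j' \<in> {1, 2} \<Longrightarrow> R i j i' j' \<longleftrightarrow>
    i = i' \<or> i' = cyc_succ n i \<and> ((j = j') \<noteq> (i = n \<and> even n))"
  shows "induces_layered X V L
    (sgraph_of ({1..n} \<times> {1, 2} \<times> {1..t}) (\<lambda>(i, j, k) (i', j', k'). R i j i' j')) n {1, 2} t"
proof -
  obtain K :: "'a \<Rightarrow> nat \<Rightarrow> bool" where K0: "(\<forall>u\<in>V. \<forall>x. card {c \<in> L u. K u c = x} = t) \<and>
    (\<forall>u\<in>V. \<forall>v\<in>V. \<forall>c\<in>L u. \<forall>d\<in>L v. \<iota> v = cyc_succ n (\<iota> u) \<longrightarrow>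
      ({(u, c), (v, d)} \<in> edges X \<longleftrightarrow> ((K u c = K v d) \<noteq> (\<iota> u = n \<and> even n))))"
    by (rule exE[OF letters])
  note K = conjunct1[OF K0, rule_format] conjunct2[OF K0, rule_format]
  define \<kappa> :: "'a \<Rightarrow> nat \<Rightarrow> nat" where "\<kappa> u c = (if K u c then 1 else 2)" for u c
  have \<kappa>_eq: "\<kappa> u c = \<kappa> v d \<longleftrightarrow> K u c = K v d" for u c v d by (simp add: \<kappa>_def)
  have \<iota>in: "\<iota> u \<in> {1..n}" if "u \<in> V" for u by (rule bij_betw_apply[OF \<iota> that])
  show ?thesis
  proof (rule induces_layeredI[where \<iota> = \<iota> and \<kappa> = \<kappa> and R = R])
    fix u j assume u: "u \<in> V" and j: "j \<in> {1, 2 :: nat}"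
    then have "{c \<in> L u. \<kappa> u c = j} = {c \<in> L u. K u c = (j = 1)}" unfolding \<kappa>_def by (cases "j = 1") auto
    then show "card {c \<in> L u. \<kappa> u c = j} = t" using K(1)[OF u] by simp
  next
    fix u v c d assume a: "u \<in> V" "v \<in> V" "c \<in> L u" "d \<in> L v" "(u, c) \<noteq> (v, d)"
    have k12: "\<kappa> u c \<in> {1, 2}" "\<kappa> v d \<in> {1, 2}" by (auto simp: \<kappa>_def)
    note R = assms[OF \<iota>in[OF a(1)] \<iota>in[OF a(2)] k12] assms[OF \<iota>in[OF a(2)] \<iota>in[OF a(1)] k12(2,1)]
    show "{(u, c), (v, d)} \<in> edges X \<longleftrightarrow>
      R (\<iota> u) (\<kappa> u c) (\<iota> v) (\<kappa> v d) \<or> R (\<iota> v) (\<kappa> v d) (\<iota> u) (\<kappa> u c)"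
    proof (cases "u = v")
      case True
      then show ?thesis unfolding R using clique[of u c d] a by auto
    next
      case False
      then have ne: "\<iota> u \<noteq> \<iota> v" using bij_betw_imp_inj_on[OF \<iota>] a(1,2) by (auto dest: inj_onD)
      consider "\<iota> v = cyc_succ n (\<iota> u)" "\<iota> u \<noteq> cyc_succ n (\<iota> v)"
        | "\<iota> u = cyc_succ n (\<iota> v)" "\<iota> v \<noteq> cyc_succ n (\<iota> u)"
        | "\<iota> v \<noteq> cyc_succ n (\<iota> u)" "\<iota> u \<noteq> cyc_succ n (\<iota> v)"
        using cyc_succ_asym[OF n3, of "\<iota> u"] by metis
      then show ?thesis
      proof cases
        case 1
        then show ?thesis unfolding R \<kappa>_eq using K(2)[OF a(1-4) 1(1)] ne by auto
      next
        case 2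
        have "{(u, c), (v, d)} \<in> edges X \<longleftrightarrow> ((K v d = K u c) \<noteq> (\<iota> v = n \<and> even n))"
          using K(2)[OF a(2,1,4,3) 2(1)] by (simp add: insert_commute)
        then show ?thesis unfolding R \<kappa>_eq using ne 2 by auto
      next
        case 3
        then have "m u v = 0" using mt[OF a(1,2)] by simp
        then have "card (N u c v) = 0" using card_N[OF a(1,2) False a(3)] by simp
        then have "d \<notin> N u c v" using N_finite[OF a(2)] by simp
        then have "{(u, c), (v, d)} \<notin> edges X" using a(4) by (simp add: nbrs_def)
        then show ?thesis unfolding R using 3 ne by auto
      qed
    qed
  next
    show "\<kappa> u c \<in> {1, 2}" for u c by (simp add: \<kappa>_def)
  qed (rule \<iota> fin_list node loopless; assumption)+
qed

lemma cycle_induces_ladder: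
  assumes "odd n"
  shows "induces_layered X V L (fat_ladder n t) n {1, 2} t"
  unfolding fat_ladder_def
  by (rule cycle_layeredI[where R = "\<lambda>i j i' j'. i = i' \<or> i' = cyc_succ n i \<and> j = j'"]) (use assms in auto)

lemma cycle_induces_Moebius:
  assumes "even n"
  shows "induces_layered X V L (fat_Moebius_ladder n t) n {1, 2} t"
  unfolding fat_Moebius_ladder_def
  by (rule cycle_layeredI[where R = "\<lambda>i j i' j'. i = i' \<or> 1 \<le> i \<and> i \<le> n - 1 \<and> i' = i + 1 \<and> j = j' \<or>
      i = n \<and> i' = 1 \<and> j \<noteq> j'"]) (use assms n3 in \<open>auto simp: cyc_succ_def\<close>)

end

end

section \<open>Obstructed blocks\<close>

text \<open>The conditions range over all fitting \<open>n\<close> and \<open>t\<close>, as the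
  description of a block is not unique: \<open>K_3^t\<close> is also \<open>C_3^t\<close>, and a
  single vertex is \<open>K_1^t\<close> for every \<open>t\<close>.\<close>

definition obstructed_block :: "('v \<times> nat) sgraph \<Rightarrow> 'v mgraph \<Rightarrow> ('v \<Rightarrow> nat set) \<Rightarrow> bool" where
  "obstructed_block X B P \<longleftrightarrow>
     ((\<exists>n t. iso_complete_power B n t) \<or> (\<exists>n t. iso_cycle_power B n t)) \<and>
     (\<forall>u\<in>verts B.
        (\<forall>n t. iso_complete_power B n t \<longrightarrow> card (P u) = t * (n - 1)) \<and>
        (\<forall>n t. iso_cycle_power B n t \<longrightarrow> card (P u) = 2 * t)) \<and>
     (\<forall>n t. iso_complete_power B n t \<longrightarrow>
        induces_layered X (verts B) P (H_graph n t) n {1..n - 1} t) \<and>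
     (\<forall>n t. iso_cycle_power B n t \<and> odd n \<longrightarrow>
        induces_layered X (verts B) P (fat_ladder n t) n {1, 2} t) \<and>
     (\<forall>n t. iso_cycle_power B n t \<and> even n \<longrightarrow>
        induces_layered X (verts B) P (fat_Moebius_ladder n t) n {1, 2} t)"

lemma iso_complete_powerD:
  assumes "iso_complete_power B n t"
  shows "\<exists>\<iota>. n \<ge> 1 \<and> t \<ge> 1 \<and> bij_betw \<iota> (verts B) {1..n} \<and>
    (\<forall>u v. u \<in> verts B \<longrightarrow> v \<in> verts B \<longrightarrow> u \<noteq> v \<longrightarrow> mult B u v = t)"
proof -
  obtain f where f: "n \<ge> 1" "t \<ge> 1" "bij_betw f (verts B) {1..n}"
    "\<And>u v. u \<in> verts B \<Longrightarrow> v \<in> verts B \<Longrightarrow>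
      t * (if f u \<in> {1..n} \<and> f v \<in> {1..n} \<and> f u \<noteq> f v then 1 else 0) = mult B u v"
    using assms by (auto simp: iso_complete_power_def mgraph_iso_def parallel_mg_def complete_mg_def)
  show ?thesis
  proof (intro exI[of _ f] conjI allI impI f(1-3))
    fix u v assume uv: "u \<in> verts B" "v \<in> verts B" "u \<noteq> v"
    then have "f u \<noteq> f v" using bij_betw_imp_inj_on[OF f(3)] by (auto dest: inj_onD)
    then show "mult B u v = t"
      using f(4)[OF uv(1,2)] bij_betw_apply[OF f(3) uv(1)] bij_betw_apply[OF f(3) uv(2)] by simp
  qed
qed

lemma iso_cycle_powerD:
  assumes "iso_cycle_power B n t"
  shows "\<exists>\<iota>. n \<ge> 3 \<and> t \<ge> 1 \<and> bij_betw \<iota> (verts B) {1..n} \<and>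
    (\<forall>u v. u \<in> verts B \<longrightarrow> v \<in> verts B \<longrightarrow>
      mult B u v = (if \<iota> v = cyc_succ n (\<iota> u) \<or> \<iota> u = cyc_succ n (\<iota> v) then t else 0))"
proof -
  obtain f where f: "n \<ge> 3" "t \<ge> 1" "bij_betw f (verts B) {1..n}"
    "\<And>u v. u \<in> verts B \<Longrightarrow> v \<in> verts B \<Longrightarrow>
      t * (if f u \<in> {1..n} \<and> f v \<in> {1..n} \<and> (f v = cyc_succ n (f u) \<or> f u = cyc_succ n (f v)) then 1 else 0)
      = mult B u v"
    using assms by (auto simp: iso_cycle_power_def mgraph_iso_def parallel_mg_def cycle_mg_def)
  show ?thesis
  proof (intro exI[of _ f] conjI allI impI f(1-3))
    fix u v assume uv: "u \<in> verts B" "v \<in> verts B"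
    show "mult B u v = (if f v = cyc_succ n (f u) \<or> f u = cyc_succ n (f v) then t else 0)"
      unfolding f(4)[OF uv, symmetric]
      using bij_betw_apply[OF f(3) uv(1)] bij_betw_apply[OF f(3) uv(2)] by simp
  qed
qed

text \<open>Any two of three cyclic positions are consecutive. This reconciles the two conditions
  imposed on a triangle, which is both a complete graph and an odd cycle.\<close>

lemma fat_ladder_3: "fat_ladder 3 t = H_graph 3 t"
proof -
  let ?S = "{1..3} \<times> {1, 2} \<times> {1..t}"
  let ?R = "\<lambda>(i, j, k) (i', j', k'). i = i' \<or> i' = cyc_succ 3 i \<and> j = j'"
  let ?R' = "\<lambda>(i, j, k) (i', j', k'). i = i' \<or> j = (j' :: nat)"
  have "a = b \<or> b = cyc_succ 3 a \<or> a = cyc_succ 3 b" if "a \<in> {1..3}" "b \<in> {1..3}" for a b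
    using that by (simp add: cyc_succ_def) arith
  then have "?R x y \<or> ?R y x \<longleftrightarrow> ?R' x y \<or> ?R' y x" if "x \<in> ?S" "y \<in> ?S" for x y
    using that by fastforce
  then have e: "{x, y} \<in> edges (sgraph_of ?S ?R) \<longleftrightarrow> {x, y} \<in> edges (sgraph_of ?S ?R')" for x y
    unfolding edge_sgraph_of by blast
  have pair: "\<exists>x y. z = {x, y}" if "z \<in> edges (sgraph_of ?S R)"
    for z :: "(nat \<times> nat \<times> nat) set" and R
    using that by (simp add: sgraph_of_def) blast
  have "edges (sgraph_of ?S ?R) = edges (sgraph_of ?S ?R')"
  proof (rule set_eqI)
    fix z
    show "z \<in> edges (sgraph_of ?S ?R) \<longleftrightarrow> z \<in> edges (sgraph_of ?S ?R')"
    proof (cases "\<exists>x y. z = {x, y}")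
      case True
      then show ?thesis using e by (elim exE) (simp only:)
    qed (use pair in blast)
  qed
  moreover have "{1..3 - 1} = {1, 2 :: nat}" by auto
  ultimately show ?thesis unfolding fat_ladder_def H_graph_def by (simp add: sgraph_of_def)
qed

text \<open>Positions \<open>1\<close> and \<open>3\<close> are not consecutive once
  \<open>n > 3\<close>.\<close>

lemma complete_not_long_cycle:
  assumes "iso_cycle_power B n t" "\<And>u v. u \<in> verts B \<Longrightarrow> v \<in> verts B \<Longrightarrow> u \<noteq> v \<Longrightarrow> mult B u v > 0"
  shows "n = 3"
proof (rule ccontr)
  obtain \<iota> where i: "n \<ge> 3" "t \<ge> 1" "bij_betw \<iota> (verts B) {1..n}"
    "\<And>u v. u \<in> verts B \<Longrightarrow> v \<in> verts B \<Longrightarrow>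
      mult B u v = (if \<iota> v = cyc_succ n (\<iota> u) \<or> \<iota> u = cyc_succ n (\<iota> v) then t else 0)"
    using iso_cycle_powerD[OF assms(1)] by blast
  assume "n \<noteq> 3"
  then have n: "n > 3" using i(1) by simp
  then have "1 \<in> \<iota> ` verts B" "3 \<in> \<iota> ` verts B" using bij_betw_imp_surj_on[OF i(3)] by auto
  then obtain u v where uv: "u \<in> verts B" "\<iota> u = 1" "v \<in> verts B" "\<iota> v = 3" by auto
  then have "u \<noteq> v" by auto
  then show False using assms(2)[OF uv(1,3)] i(4)[OF uv(1,3)] uv n by (simp add: cyc_succ_def)
qed

section \<open>Uncolourable covers without cut vertices are obstructed\<close>

context block_cover
begin

lemma obstructed_if_complete:
  assumes ne: "V \<noteq> {}" and c: "\<forall>x\<in>V. \<forall>y\<in>V. x \<noteq> y \<longrightarrow> m x y > 0"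
  shows "obstructed_block X G L"
proof -
  interpret complete_block X G L by unfold_locales (use c in blast)
  obtain t where t: "t \<ge> 1" "\<forall>u\<in>V. \<forall>v\<in>V. u \<noteq> v \<longrightarrow> m u v = t" using uniform by blast
  obtain f where f: "bij_betw f V {1..card V}" using finite_same_card_bij[OF fin_V, of "{1..card V}"] by auto
  have "mgraph_iso G (parallel_mg (complete_mg (card V)) t)" unfolding mgraph_iso_def
  proof (intro exI[of _ f] conjI ballI)
    show "bij_betw f V (verts (parallel_mg (complete_mg (card V)) t))"
      using f by (simp add: parallel_mg_def complete_mg_def)
  next
    fix u v assume uv: "u \<in> V" "v \<in> V"
    have "f u = f v \<longleftrightarrow> u = v" using bij_betw_imp_inj_on[OF f] uv by (auto dest: inj_onD)
    then show "mult (parallel_mg (complete_mg (card V)) t) (f u) (f v) = m u v"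
      using bij_betw_apply[OF f uv(1)] bij_betw_apply[OF f uv(2)] t(2) uv m_refl[of v]
      by (cases "u = v") (simp_all add: parallel_mg_def complete_mg_def)
  qed
  moreover have "card V \<ge> 1" using ne fin_V by (simp add: card_gt_0_iff Suc_leI)
  ultimately have ex: "iso_complete_power G (card V) t" using t(1) by (simp add: iso_complete_power_def)
  have com: "induces_layered X V L (H_graph n t) n {1..n - 1} t" "\<forall>u\<in>V. card (L u) = t * (n - 1)"
    if "iso_complete_power G n t" for n t
  proof -
    obtain \<iota> where i: "n \<ge> 1" "t \<ge> 1" "bij_betw \<iota> V {1..n}"
      "\<And>u v. u \<in> V \<Longrightarrow> v \<in> V \<Longrightarrow> u \<noteq> v \<Longrightarrow> m u v = t"
      using iso_complete_powerD[OF \<open>iso_complete_power G n t\<close>] by blast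
    show "induces_layered X V L (H_graph n t) n {1..n - 1} t" by (rule complete_induces_H[OF i(3,2,4)])
    show "\<forall>u\<in>V. card (L u) = t * (n - 1)" using card_L_complete[OF i(3,2,4)] by blast
  qed
  \<comment> \<open>A complete block that is also a cycle power must be a triangle, so the cycle
    conditions reduce to the complete case with \<open>n = 3\<close>.\<close>
  have cyc: "n = 3 \<and> iso_complete_power G n t" if cy: "iso_cycle_power G n t" for n t
  proof -
    have n: "n = 3" using complete_not_long_cycle[OF cy] c by blast
    obtain \<iota> where i0: "n \<ge> 3" and i: "t \<ge> 1" "bij_betw \<iota> V {1..n}"
      "\<And>u v. u \<in> V \<Longrightarrow> v \<in> V \<Longrightarrow>
        m u v = (if \<iota> v = cyc_succ n (\<iota> u) \<or> \<iota> u = cyc_succ n (\<iota> v) then t else 0)"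
      using iso_cycle_powerD[OF cy] by blast
    have "mult (parallel_mg (complete_mg n) t) (\<iota> u) (\<iota> v) = m u v" if uv: "u \<in> V" "v \<in> V" for u v
    proof (cases "u = v")
      case False
      then have "\<iota> u \<noteq> \<iota> v" using bij_betw_imp_inj_on[OF i(2)] uv by (auto dest: inj_onD)
      moreover have "m u v = t" using i(3)[OF uv] c uv False by (metis less_irrefl)
      ultimately show ?thesis using bij_betw_apply[OF i(2) uv(1)] bij_betw_apply[OF i(2) uv(2)]
        by (simp add: parallel_mg_def complete_mg_def)
    qed (simp add: parallel_mg_def complete_mg_def m_refl)
    then have "mgraph_iso G (parallel_mg (complete_mg n) t)" unfolding mgraph_iso_def
      using i(2) by (intro exI[of _ \<iota>]) (simp add: parallel_mg_def complete_mg_def)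
    then show ?thesis using n i(1) by (simp add: iso_complete_power_def)
  qed
  have two: "{1..3 - 1} = {1, 2 :: nat}" by auto
  show ?thesis unfolding obstructed_block_def
  proof (intro conjI allI impI ballI)
    show "(\<exists>n t. iso_complete_power G n t) \<or> (\<exists>n t. iso_cycle_power G n t)" using ex by blast
  next
    fix u n t assume "u \<in> V" "iso_complete_power G n t"
    then show "card (L u) = t * (n - 1)" using com(2) by blast
  next
    fix u n t assume u: "u \<in> V" "iso_cycle_power G n t"
    then have "card (L u) = t * (3 - 1)" using com(2) cyc[OF u(2)] by blast
    then show "card (L u) = 2 * t" by simp
  next
    fix n t assume "iso_complete_power G n t"
    then show "induces_layered X V L (H_graph n t) n {1..n - 1} t" by (rule com(1))
  next
    fix n t assume "iso_cycle_power G n t \<and> odd n"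
    then have "n = 3" "iso_complete_power G n t" using cyc by blast+
    then show "induces_layered X V L (fat_ladder n t) n {1, 2} t"
      using com(1)[of n t] by (simp only: fat_ladder_3 two)
  next
    fix n t assume "iso_cycle_power G n t \<and> even n"
    then show "induces_layered X V L (fat_Moebius_ladder n t) n {1, 2} t" using cyc by fastforce
  qed
qed

lemma obstructed_if_cycle:
  assumes ne: "V \<noteq> {}" and c: "\<forall>x\<in>V. path_vertex x"
  shows "obstructed_block X G L"
proof -
  interpret cycle_block X G L by unfold_locales (use c in blast)
  obtain t where t: "t \<ge> 1" "\<And>u v. m u v > 0 \<Longrightarrow> m u v = t" using uniform[OF ne] by blast
  obtain n q where q: "n \<ge> 3" "bij_betw q {1..n} V"
    "\<forall>i\<in>{1..n}. \<forall>j\<in>{1..n}. m (q i) (q j) > 0 \<longleftrightarrow> j = cyc_succ n i \<or> i = cyc_succ n j"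
    using cyclic_enumeration[OF fin_V ne path] by blast
  define f where "f = inv_into {1..n} q"
  have f: "bij_betw f V {1..n}" unfolding f_def by (rule bij_betw_inv_into[OF q(2)])
  have qf: "q (f u) = u" if "u \<in> V" for u
    unfolding f_def using that bij_betw_inv_into_right[OF q(2)] by blast
  have "mgraph_iso G (parallel_mg (cycle_mg n) t)" unfolding mgraph_iso_def
  proof (intro exI[of _ f] conjI ballI)
    show "bij_betw f V (verts (parallel_mg (cycle_mg n) t))"
      using f by (simp add: parallel_mg_def cycle_mg_def)
  next
    fix u v assume uv: "u \<in> V" "v \<in> V"
    have fi: "f u \<in> {1..n}" "f v \<in> {1..n}" using bij_betw_apply[OF f] uv by blast+
    have adj: "m u v > 0 \<longleftrightarrow> f v = cyc_succ n (f u) \<or> f u = cyc_succ n (f v)"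
      using q(3)[rule_format, OF fi] qf uv by simp
    have "m u v = (if f v = cyc_succ n (f u) \<or> f u = cyc_succ n (f v) then t else 0)"
      unfolding adj[symmetric] using t(2)[of u v] by (cases "m u v = 0") simp_all
    then show "mult (parallel_mg (cycle_mg n) t) (f u) (f v) = m u v"
      using fi by (simp add: parallel_mg_def cycle_mg_def)
  qed
  then have ex: "iso_cycle_power G n t" using t(1) q(1) by (simp add: iso_cycle_power_def)
  \<comment> \<open>The two non-adjacent neighbours of a path vertex rule out a complete
    graph.\<close>
  have no_complete: "\<not> iso_complete_power G n t" for n t
  proof
    assume "iso_complete_power G n t"
    then obtain \<iota> where i0: "n \<ge> 1" and i: "t \<ge> 1" and "bij_betw \<iota> V {1..n}" and i2: "\<And>u v. u \<in> V \<Longrightarrow> v \<in> V \<Longrightarrow> u \<noteq> v \<Longrightarrow> m u v = t"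
      using iso_complete_powerD by blast
    obtain x where x: "x \<in> V" using ne by blast
    obtain a b where ab: "a \<noteq> b" "m a b = 0" "{z. m x z > 0} = {a, b}"
      using path[OF x] unfolding path_vertex_def by blast
    have "m x a > 0" "m x b > 0" using ab(3) by blast+
    then show False using i2[OF m_verts(2) m_verts(2) ab(1)] i ab(2) by fastforce
  qed
  show ?thesis unfolding obstructed_block_def
  proof (intro conjI allI impI ballI)
    show "(\<exists>n t. iso_complete_power G n t) \<or> (\<exists>n t. iso_cycle_power G n t)" using ex by blast
  next
    fix u n t assume u: "u \<in> V" and cy: "iso_cycle_power G n t"
    obtain \<iota> where i: "n \<ge> 3" "t \<ge> 1" "bij_betw \<iota> V {1..n}"
      "\<And>u v. u \<in> V \<Longrightarrow> v \<in> V \<Longrightarrow>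
        m u v = (if \<iota> v = cyc_succ n (\<iota> u) \<or> \<iota> u = cyc_succ n (\<iota> v) then t else 0)"
      using iso_cycle_powerD[OF cy] by blast
    show "card (L u) = 2 * t" by (rule list_halves(1)[OF i(3,1,2,4) u])
  next
    fix n t assume cy: "iso_cycle_power G n t \<and> odd n"
    then have "iso_cycle_power G n t" by blast
    then obtain \<iota> where i: "n \<ge> 3" "t \<ge> 1" "bij_betw \<iota> V {1..n}"
      "\<And>u v. u \<in> V \<Longrightarrow> v \<in> V \<Longrightarrow>
        m u v = (if \<iota> v = cyc_succ n (\<iota> u) \<or> \<iota> u = cyc_succ n (\<iota> v) then t else 0)"
      using iso_cycle_powerD by blast
    show "induces_layered X V L (fat_ladder n t) n {1, 2} t"
      by (rule cycle_induces_ladder[OF i(3,1,2,4)]) (use cy in blast)+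
  next
    fix n t assume cy: "iso_cycle_power G n t \<and> even n"
    then have "iso_cycle_power G n t" by blast
    then obtain \<iota> where i: "n \<ge> 3" "t \<ge> 1" "bij_betw \<iota> V {1..n}"
      "\<And>u v. u \<in> V \<Longrightarrow> v \<in> V \<Longrightarrow>
        m u v = (if \<iota> v = cyc_succ n (\<iota> u) \<or> \<iota> u = cyc_succ n (\<iota> v) then t else 0)"
      using iso_cycle_powerD by blast
    show "induces_layered X V L (fat_Moebius_ladder n t) n {1, 2} t"
      by (rule cycle_induces_Moebius[OF i(3,1,2,4)]) (use cy in blast)+
  qed (use no_complete in blast)+
qed

lemma obstructed: "V \<noteq> {} \<Longrightarrow> obstructed_block X G L"
  using complete_or_cycle obstructed_if_complete obstructed_if_cycle by blast

end

section \<open>Obstructed blocks admit no colouring\<close>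

lemma layered_coordinates:
  assumes ind: "induces_layered X W P Y n J t"
    and node: "\<And>u c. u \<in> W \<Longrightarrow> c \<in> P u \<Longrightarrow> (u, c) \<in> nodes X"
    and \<phi>: "\<And>u. u \<in> W \<Longrightarrow> \<phi> u \<in> P u"
  obtains i j k where "inj_on i W" "\<And>u. u \<in> W \<Longrightarrow> i u \<in> {1..n}" "\<And>u. u \<in> W \<Longrightarrow> j u \<in> J"
    "\<And>u. u \<in> W \<Longrightarrow> k u \<in> {1..t}"
    "\<And>u v. u \<in> W \<Longrightarrow> v \<in> W \<Longrightarrow>
      {(u, \<phi> u), (v, \<phi> v)} \<in> edges X \<longleftrightarrow> {(i u, j u, k u), (i v, j v, k v)} \<in> edges Y"
proof -
  define S where "S = (\<Union>u\<in>W. fiber u (P u))"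
  obtain f where f: "sgraph_iso_by f (induced_subgraph X S) Y"
    and lay: "\<And>u. u \<in> W \<Longrightarrow> \<exists>i\<in>{1..n}. f ` fiber u (P u) = {i} \<times> J \<times> {1..t}"
    using ind unfolding induces_layered_def S_def by blast
  obtain i where i: "\<And>u. u \<in> W \<Longrightarrow> i u \<in> {1..n}" "\<And>u. u \<in> W \<Longrightarrow> f ` fiber u (P u) = {i u} \<times> J \<times> {1..t}"
    using lay by metis
  have nds: "nodes (induced_subgraph X S) = S"
    using node by (auto simp: induced_subgraph_def S_def fiber_def)
  have inj: "inj_on f S" and ed: "\<And>x y. x \<in> S \<Longrightarrow> y \<in> S \<Longrightarrow>
      {x, y} \<in> edges (induced_subgraph X S) \<longleftrightarrow> {f x, f y} \<in> edges Y"
    using f unfolding sgraph_iso_by_def nds by (auto simp: bij_betw_def)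
  have S: "(u, \<phi> u) \<in> S" "(u, \<phi> u) \<in> fiber u (P u)" if "u \<in> W" for u
    using \<phi>[OF that] that by (auto simp: S_def fiber_def)
  define j where "j u = fst (snd (f (u, \<phi> u)))" for u
  define k where "k u = snd (snd (f (u, \<phi> u)))" for u
  have mem: "f (u, \<phi> u) \<in> {i u} \<times> J \<times> {1..t}" if "u \<in> W" for u
    unfolding i(2)[OF that, symmetric] using S(2)[OF that] by (rule imageI)
  have fe: "f (u, \<phi> u) = (i u, j u, k u)" if "u \<in> W" for u
    using mem[OF that] by (auto simp: j_def k_def)
  show thesis
  proof (rule that)
    \<comment> \<open>Two vertices with the same layer would have the same image of their fibers,
      although the fibers are disjoint and \<open>f\<close> is injective.\<close>
    show "inj_on i W"
    proof (rule inj_onI)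
      fix u v assume uv: "u \<in> W" "v \<in> W" "i u = i v"
      then have "f (u, \<phi> u) \<in> f ` fiber v (P v)" using mem[OF uv(1)] i(2)[OF uv(2)] by simp
      then obtain p where p: "p \<in> fiber v (P v)" "f (u, \<phi> u) = f p" by blast
      then have "p \<in> S" using uv(2) by (auto simp: S_def)
      then have "(u, \<phi> u) = p" using inj_onD[OF inj p(2)] S(1)[OF uv(1)] by blast
      then show "u = v" using p(1) by (auto simp: fiber_def)
    qed
  next
    fix u v assume uv: "u \<in> W" "v \<in> W"
    have "{(u, \<phi> u), (v, \<phi> v)} \<in> edges X \<longleftrightarrow> {(u, \<phi> u), (v, \<phi> v)} \<in> edges (induced_subgraph X S)"
      using S uv by (simp add: induced_subgraph_def)
    then show "{(u, \<phi> u), (v, \<phi> v)} \<in> edges X \<longleftrightarrow> {(i u, j u, k u), (i v, j v, k v)} \<in> edges Y"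
      using ed[OF S(1)[OF uv(1)] S(1)[OF uv(2)]] fe uv by simp
  qed (use i(1) mem fe in auto)
qed

text \<open>Pigeonhole: \<open>n\<close> chosen colours occupy only \<open>n - 1\<close> columns,
  and two in the same column are adjacent.\<close>

lemma no_colouring_of_H:
  assumes ind: "induces_layered X W P (H_graph n t) n {1..n - 1} t"
    and node: "\<And>u c. u \<in> W \<Longrightarrow> c \<in> P u \<Longrightarrow> (u, c) \<in> nodes X"
    and W: "card W = n" "n \<ge> 1"
  shows "\<not> proper_on X P W \<phi>"
proof
  assume p: "proper_on X P W \<phi>"
  then have \<phi>: "\<And>u. u \<in> W \<Longrightarrow> \<phi> u \<in> P u" by (simp add: proper_on_def)
  obtain i j k where c: "inj_on i W" "\<And>u. u \<in> W \<Longrightarrow> i u \<in> {1..n}" "\<And>u. u \<in> W \<Longrightarrow> j u \<in> {1..n - 1}"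
    "\<And>u. u \<in> W \<Longrightarrow> k u \<in> {1..t}" "\<And>u v. u \<in> W \<Longrightarrow> v \<in> W \<Longrightarrow>
      {(u, \<phi> u), (v, \<phi> v)} \<in> edges X \<longleftrightarrow> {(i u, j u, k u), (i v, j v, k v)} \<in> edges (H_graph n t)"
    using layered_coordinates[OF ind node \<phi>] by metis
  have "j ` W \<subseteq> {1..n - 1}" using c(3) by blast
  then have "\<not> inj_on j W" using card_inj_on_le[of j W "{1..n - 1}"] W by auto
  then obtain u v where uv: "u \<in> W" "v \<in> W" "u \<noteq> v" "j u = j v" unfolding inj_on_def by blast
  then have "i u \<noteq> i v" using inj_onD[OF c(1)] by blast
  then have "{(i u, j u, k u), (i v, j v, k v)} \<in> edges (H_graph n t)"
    unfolding H_graph_def edge_sgraph_of using c(2-4) uv by simp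
  then show False using c(5)[OF uv(1,2)] p uv by (simp add: proper_on_def)
qed

text \<open>In a proper colouring the second coordinate alternates from position \<open>1\<close> to
  \<open>n\<close>, so its two end values agree exactly for odd \<open>n\<close>, whereas the
  closing edge demands agreement exactly for even \<open>n\<close>. The hypothesis on
  \<open>Y\<close> lists the edges common to the treatment of both ladders.\<close>

lemma no_colouring_of_ladder:
  assumes ind: "induces_layered X W P Y n {1, 2} t"
    and node: "\<And>u c. u \<in> W \<Longrightarrow> c \<in> P u \<Longrightarrow> (u, c) \<in> nodes X"
    and W: "card W = n" "n \<ge> 3"
    and Y: "\<And>i j k j' k'. i \<in> {1..n} \<Longrightarrow> j \<in> {1, 2} \<Longrightarrow> j' \<in> {1, 2} \<Longrightarrow> k \<in> {1..t} \<Longrightarrow> k' \<in> {1..t} \<Longrightarrow>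
      (j = j') \<noteq> (i = n \<and> even n) \<Longrightarrow> {(i, j, k), (cyc_succ n i, j', k')} \<in> edges Y"
  shows "\<not> proper_on X P W \<phi>"
proof
  assume p: "proper_on X P W \<phi>"
  then have \<phi>: "\<And>u. u \<in> W \<Longrightarrow> \<phi> u \<in> P u" by (simp add: proper_on_def)
  obtain i j k where c: "inj_on i W" "\<And>u. u \<in> W \<Longrightarrow> i u \<in> {1..n}" "\<And>u. u \<in> W \<Longrightarrow> j u \<in> {1, 2}"
    "\<And>u. u \<in> W \<Longrightarrow> k u \<in> {1..t}" "\<And>u v. u \<in> W \<Longrightarrow> v \<in> W \<Longrightarrow>
      {(u, \<phi> u), (v, \<phi> v)} \<in> edges X \<longleftrightarrow> {(i u, j u, k u), (i v, j v, k v)} \<in> edges Y"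
    using layered_coordinates[OF ind node \<phi>] by metis
  have "i ` W = {1..n}"
    using c(2) W card_image[OF c(1)] by (intro card_subset_eq) auto
  then have "\<exists>u\<in>W. i u = a" if "a \<in> {1..n}" for a using that by (metis image_iff)
  then obtain q where q: "\<And>a. a \<in> {1..n} \<Longrightarrow> q a \<in> W" "\<And>a. a \<in> {1..n} \<Longrightarrow> i (q a) = a" by metis
  have step: "(j (q a) = j (q (cyc_succ n a))) = (a = n \<and> even n)" if a: "a \<in> {1..n}" for a
  proof (rule ccontr)
    assume ne: "(j (q a) = j (q (cyc_succ n a))) \<noteq> (a = n \<and> even n)"
    let ?b = "cyc_succ n a"
    have b: "?b \<in> {1..n}" by (rule cyc_succ_in[OF a])
    have "{(a, j (q a), k (q a)), (?b, j (q ?b), k (q ?b))} \<in> edges Y"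
      by (rule Y[OF a c(3)[OF q(1)[OF a]] c(3)[OF q(1)[OF b]] c(4)[OF q(1)[OF a]] c(4)[OF q(1)[OF b]] ne])
    then have "{(q a, \<phi> (q a)), (q ?b, \<phi> (q ?b))} \<in> edges X"
      unfolding c(5)[OF q(1)[OF a] q(1)[OF b]] q(2)[OF a] q(2)[OF b] .
    moreover have "q a \<noteq> q ?b"
    proof
      assume "q a = q ?b"
      then have "i (q ?b) = i (q a)" by simp
      then have "?b = a" unfolding q(2)[OF a] q(2)[OF b] .
      moreover have "?b \<noteq> a" using W(2) by (simp add: cyc_succ_def)
      ultimately show False by contradiction
    qed
    ultimately show False using p q(1)[OF a] q(1)[OF b] by (simp add: proper_on_def)
  qed
  have two_valued: "(y = z) = (x \<noteq> z)" if "x \<in> {1, 2}" "y \<in> {1, 2}" "z \<in> {1, 2}" "x \<noteq> y" for x y z :: nat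
    using that by auto
  have alt: "a \<le> n \<Longrightarrow> (j (q a) = j (q 1)) = odd a" if "a \<ge> 1" for a
    using that
  proof (induction a rule: nat_induct_at_least)
    case (Suc a)
    then have a: "a \<in> {1..n}" "Suc a \<in> {1..n}" "1 \<in> {1..n}" "a \<noteq> n" by auto
    have "j (q a) \<noteq> j (q (Suc a))" using step[OF a(1)] a by (simp add: cyc_succ_def)
    then show ?case using two_valued[OF c(3)[OF q(1)[OF a(1)]] c(3)[OF q(1)[OF a(2)]] c(3)[OF q(1)[OF a(3)]]] Suc
      by simp
  qed simp
  have "n \<in> {1..n}" using W(2) by simp
  from step[OF this] alt[of n] W(2) show False by (simp add: cyc_succ_def)
qed

lemma obstructed_block_not_colourable:
  assumes ob: "obstructed_block X B P"
    and node: "\<And>u c. u \<in> verts B \<Longrightarrow> c \<in> P u \<Longrightarrow> (u, c) \<in> nodes X"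
  shows "\<not> proper_on X P (verts B) \<phi>"
proof -
  consider n t where "iso_complete_power B n t" | n t where "iso_cycle_power B n t"
    using ob unfolding obstructed_block_def by blast
  then show ?thesis
  proof cases
    case 1
    then have ind: "induces_layered X (verts B) P (H_graph n t) n {1..n - 1} t"
      using ob unfolding obstructed_block_def by blast
    obtain \<iota> where "n \<ge> 1" "bij_betw \<iota> (verts B) {1..n}" using iso_complete_powerD[OF 1] by blast
    then show ?thesis using no_colouring_of_H[OF ind node] bij_betw_same_card by fastforce
  next
    case 2
    obtain \<iota> where i: "n \<ge> 3" "bij_betw \<iota> (verts B) {1..n}" using iso_cycle_powerD[OF 2] by blast
    have W: "card (verts B) = n" using bij_betw_same_card[OF i(2)] by simp
    show ?thesis
    proof (cases "odd n")
      case True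
      then have ind: "induces_layered X (verts B) P (fat_ladder n t) n {1, 2} t"
        using ob 2 unfolding obstructed_block_def by blast
      show ?thesis
      proof (rule no_colouring_of_ladder[OF ind node W i(1)])
        fix a j k j' k' :: nat assume a: "a \<in> {1..n}" "j \<in> {1, 2}" "j' \<in> {1, 2}" "k \<in> {1..t}" "k' \<in> {1..t}"
          "(j = j') \<noteq> (a = n \<and> even n)"
        have "cyc_succ n a \<in> {1..n}" "a \<noteq> cyc_succ n a"
          using cyc_succ_in[OF a(1)] i(1) by (auto simp: cyc_succ_def)
        then show "{(a, j, k), (cyc_succ n a, j', k')} \<in> edges (fat_ladder n t)"
          unfolding fat_ladder_def edge_sgraph_of using a True by simp
      qed
    next
      case False
      then have ind: "induces_layered X (verts B) P (fat_Moebius_ladder n t) n {1, 2} t"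
        using ob 2 unfolding obstructed_block_def by blast
      show ?thesis
      proof (rule no_colouring_of_ladder[OF ind node W i(1)])
        fix a j k j' k' :: nat assume a: "a \<in> {1..n}" "j \<in> {1, 2}" "j' \<in> {1, 2}" "k \<in> {1..t}" "k' \<in> {1..t}"
          "(j = j') \<noteq> (a = n \<and> even n)"
        have b: "cyc_succ n a \<in> {1..n}" "a \<noteq> cyc_succ n a"
          using cyc_succ_in[OF a(1)] i(1) by (auto simp: cyc_succ_def)
        show "{(a, j, k), (cyc_succ n a, j', k')} \<in> edges (fat_Moebius_ladder n t)"
          unfolding fat_Moebius_ladder_def edge_sgraph_of using a b False
          by (cases "a = n") (auto simp: cyc_succ_def)
      qed
    qed
  qed
qed

section \<open>Splitting at a cut vertex\<close>

lemma submultigraph_antisym: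
  assumes "submultigraph B B'" "submultigraph B' B"
  shows "B = B'"
proof -
  have "mult B = mult B'" using assms by (intro ext antisym) (auto simp: submultigraph_def)
  moreover have "verts B = verts B'" using assms by (auto simp: submultigraph_def)
  ultimately show ?thesis by (intro mgraph.equality) auto
qed

lemma submultigraph_trans:
  assumes "submultigraph A B" "submultigraph B C"
  shows "submultigraph A C"
  using assms unfolding submultigraph_def by (meson order_trans)

lemma is_block_without_cut_vertex:
  assumes "multigraph G" "mconnected G" "\<forall>w. \<not> cut_vertex G w"
  shows "is_block G B \<longleftrightarrow> B = G"
proof -
  have "submultigraph G G" using assms(1) by (simp add: submultigraph_def)
  then show ?thesis
    using assms submultigraph_antisym unfolding is_block_def by metis
qed

definition sub_on :: "'v mgraph \<Rightarrow> 'v set \<Rightarrow> 'v mgraph" where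
  "sub_on G S = \<lparr>verts = S, mult = (\<lambda>u v. if u \<in> S \<and> v \<in> S then mult G u v else 0)\<rparr>"

lemma sub_on_sel [simp]:
  "verts (sub_on G S) = S"
  "mult (sub_on G S) u v = (if u \<in> S \<and> v \<in> S then mult G u v else 0)"
  by (simp_all add: sub_on_def)

lemma multigraph_sub_on:
  assumes "multigraph G" "S \<subseteq> verts G"
  shows "multigraph (sub_on G S)" "submultigraph (sub_on G S) G"
proof -
  show "multigraph (sub_on G S)"
    unfolding multigraph_def sub_on_sel
    using multigraphD[OF assms(1)] assms(2) by (auto intro: finite_subset)
  then show "submultigraph (sub_on G S) G" using assms(2) by (simp add: submultigraph_def)
qed

lemma submultigraph_sub_on_iff:
  assumes "submultigraph B G" "S \<subseteq> verts G"
  shows "submultigraph B (sub_on G S) \<longleftrightarrow> verts B \<subseteq> S"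
proof
  assume S: "verts B \<subseteq> S"
  have "multigraph B" "\<And>u v. mult B u v \<le> mult G u v" using assms(1) by (simp_all add: submultigraph_def)
  moreover have "mult B u v = 0" if "\<not> (u \<in> S \<and> v \<in> S)" for u v
    using multigraphD(4,5)[OF \<open>multigraph B\<close>, of u v] that S by blast
  ultimately show "submultigraph B (sub_on G S)" using S by (simp add: submultigraph_def)
qed (simp add: submultigraph_def)

text \<open>An edge at \<open>w\<close> spans a larger connected sub-multigraph without cut vertex,
  against maximality. This is what keeps the blocks of the two sides of a split distinct.\<close>

lemma block_not_singleton:
  assumes G: "multigraph G" "mconnected G" and B: "is_block G B" and w: "w \<in> verts G" "verts G \<noteq> {w}"
  shows "\<not> verts B \<subseteq> {w}"
proof
  assume Bw: "verts B \<subseteq> {w}"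
  have mB: "multigraph B" using B by (simp add: is_block_def submultigraph_def)
  have cG: "conn (mult G) (verts G)" using mconnected_iff_conn[OF G(1)] G(2) by blast
  obtain y where y: "y \<in> verts G" "y \<notin> {w}" using w by blast
  obtain a z where az: "a \<in> {w}" "z \<in> verts G" "z \<notin> {w}" "mult G a z > 0"
    by (rule connD[OF cG _ singletonI y]) (use w in auto)
  then have z: "z \<in> verts G" "z \<noteq> w" "mult G w z > 0" "mult G z w > 0"
    using multigraphD(2)[OF G(1), of z w] by auto
  define K where "K = sub_on G {w, z}"
  have K: "multigraph K" "submultigraph K G"
    unfolding K_def using multigraph_sub_on[OF G(1), of "{w, z}"] w z by auto
  have vK: "verts K = {w, z}" by (simp add: K_def)
  have "conn (mult K) (verts K)"
    unfolding vK by (rule conn_complete) (use z in \<open>auto simp: K_def\<close>)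
  then have cK: "mconnected K" using mconnected_iff_conn[OF K(1)] vK by blast
  have nK: "\<not> cut_vertex K v" for v
    unfolding cut_vertex_def vK mreachable_def by auto
  have "mult B u v = 0" for u v
  proof (rule ccontr)
    assume "mult B u v \<noteq> 0"
    then have "u = w" "v = w" using multigraphD(4,5)[OF mB, of u v] Bw by auto
    then show False using multigraphD(3)[OF mB, of w] \<open>mult B u v \<noteq> 0\<close> by simp
  qed
  then have "submultigraph B K" using mB Bw vK by (auto simp: submultigraph_def)
  then have "K = B" using B K cK nK unfolding is_block_def by blast
  then show False using Bw vK z(2) by auto
qed

text \<open>Both sides contain \<open>w\<close> and something else, so both are smaller than
  \<open>G\<close>. Facts are proved for \<open>S\<close> and carried over to \<open>T\<close> by
  \<open>vertex_split_swap\<close>.\<close>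

locale vertex_split =
  fixes G :: "'v mgraph" and S T :: "'v set" and w :: 'v
  assumes mG: "multigraph G" and cG: "mconnected G"
    and ST: "S \<union> T = verts G" "S \<inter> T = {w}" "S \<noteq> {w}" "T \<noteq> {w}"
    and no_edge: "a \<in> S - {w} \<Longrightarrow> b \<in> T - {w} \<Longrightarrow> mult G a b = 0"

lemma vertex_split_swap: "vertex_split G S T w \<Longrightarrow> vertex_split G T S w"
proof -
  assume "vertex_split G S T w"
  then interpret vertex_split G S T w .
  show "vertex_split G T S w"
  proof (rule vertex_split.intro[OF mG cG])
    show "T \<union> S = verts G" "T \<inter> S = {w}" using ST(1,2) by auto
    show "mult G a b = 0" if "a \<in> T - {w}" "b \<in> S - {w}" for a b
      using no_edge[OF that(2,1)] by (simp add: multigraphD(2)[OF mG, of a b])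
  qed (rule ST)+
qed

lemma cut_vertex_imp_split:
  assumes G: "multigraph G" "mconnected G" and w: "cut_vertex G w"
  shows "\<exists>S T. vertex_split G S T w"
proof -
  obtain x y where xy: "x \<in> verts G - {w}" "y \<in> verts G - {w}" "\<not> mreachable (delete_vertex G w) x y"
    and wG: "w \<in> verts G"
    using w unfolding cut_vertex_def by blast
  define C where "C = {z \<in> verts G - {w}. mreachable (delete_vertex G w) x z}"
  have "mult G a b = 0" if "a \<in> C" "b \<in> verts G - {w} - C" for a b
  proof (rule ccontr)
    assume "mult G a b \<noteq> 0"
    then have "mult (delete_vertex G w) a b > 0" using that by (auto simp: C_def delete_vertex_def)
    then have "mreachable (delete_vertex G w) x b"
      using that(1) unfolding C_def mreachable_def by (auto intro: rtrancl_into_rtrancl)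
    then show False using that by (auto simp: C_def)
  qed
  moreover have "x \<in> C" using xy by (simp add: C_def mreachable_def)
  moreover have "y \<in> verts G - C" using xy by (simp add: C_def)
  moreover have "C \<subseteq> verts G - {w}" by (auto simp: C_def)
  ultimately have "vertex_split G (insert w C) (verts G - C) w"
    using G wG xy by unfold_locales auto
  then show ?thesis by blast
qed

context vertex_split
begin

lemma w_in: "w \<in> S" "w \<in> T" "w \<in> verts G" using ST by auto

lemma part: "S \<subseteq> verts G" "multigraph (sub_on G S)" "submultigraph (sub_on G S) G"
  using multigraph_sub_on[OF mG, of S] ST(1) by auto

lemma edge_from_S:
  assumes "mult G a b > 0" "a \<in> S - {w}"
  shows "b \<in> S"
proof -
  have "b \<in> verts G" using multigraphD(5)[OF mG assms(1)] .
  moreover have "b \<notin> T - {w}" using no_edge[OF assms(2), of b] assms(1) by auto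
  ultimately show ?thesis using ST(1) w_in(1) by blast
qed

lemma mconnected_part: "mconnected (sub_on G S)"
  unfolding mconnected_iff_conn[OF part(2)] conn_def
proof (intro conjI allI impI)
  show "verts (sub_on G S) \<noteq> {}" using w_in by auto
next
  fix A assume A: "A \<subseteq> verts (sub_on G S)" "A \<noteq> {} \<and> A \<noteq> verts (sub_on G S)"
  then obtain x y where xy: "x \<in> A" "y \<in> S" "y \<notin> A" by auto
  have AS: "A \<subseteq> S" using A by simp
  have cn: "conn (mult G) (verts G)" using mconnected_iff_conn[OF mG] cG by blast
  have "\<exists>a\<in>A. \<exists>b\<in>S - A. mult G a b > 0"
  proof (cases "w \<in> A")
    case False
    obtain a b where ab: "a \<in> A" "b \<in> verts G" "b \<notin> A" "mult G a b > 0"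
      by (rule connD[OF cn _ xy(1) _ xy(3)]) (use AS xy(2) part(1) in auto)
    then have "b \<in> S" using edge_from_S[of a b] AS False by auto
    then show ?thesis using ab by blast
  next
    case True
    have yT: "y \<notin> T" using ST(2) xy True by auto
    \<comment> \<open>Adding all of \<open>T\<close> to \<open>A\<close> forces the crossing edge to
      end in \<open>S - {w}\<close>, hence to lie within \<open>S\<close>.\<close>
    obtain a b where ab: "a \<in> A \<union> T" "b \<in> verts G" "b \<notin> A \<union> T" "mult G a b > 0"
      by (rule connD[OF cn, of "A \<union> T" x y]) (use AS xy yT ST(1) in auto)
    then have b: "b \<in> S - {w}" using ST w_in by blast
    have "mult G b a > 0" using ab(4) by (simp add: multigraphD(2)[OF mG, of b a])
    then have "a \<in> S" using edge_from_S b by blast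
    then have "a \<in> A \<or> a \<in> S \<inter> T" using ab(1) by blast
    then have "a \<in> A" unfolding ST(2) using True by auto
    then show ?thesis using ab b by blast
  qed
  then show "\<exists>a\<in>A. \<exists>b\<in>verts (sub_on G S) - A. mult (sub_on G S) a b > 0"
    using AS by fastforce
qed

lemma card_part: "card S < card (verts G)"
proof (rule psubset_card_mono)
  show "finite (verts G)" using multigraphD(1)[OF mG] .
  show "S \<subset> verts G" using ST by blast
qed

text \<open>A connected sub-multigraph with vertices properly on both sides falls apart when
  \<open>w\<close> is removed.\<close>

lemma unsplit_subgraph:
  assumes B: "submultigraph B G" "mconnected B" "\<forall>v. \<not> cut_vertex B v"
  shows "verts B \<subseteq> S \<or> verts B \<subseteq> T"
proof (rule ccontr)
  assume "\<not> ?thesis"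
  then obtain x y where xy: "x \<in> verts B" "x \<notin> T" "y \<in> verts B" "y \<notin> S" by blast
  have mB: "multigraph B" and le: "\<And>u v. mult B u v \<le> mult G u v" and BG: "verts B \<subseteq> verts G"
    using B(1) by (auto simp: submultigraph_def)
  have c: "conn (mult B) (verts B - {w})" using conn_delete_vertex[OF mB B(2)] B(3) by blast
  have xS: "x \<in> S - {w}" and yw: "y \<noteq> w" using xy BG ST(1) w_in by blast+
  obtain a b where ab: "a \<in> verts B \<inter> (S - {w})" "b \<in> verts B - {w}" "b \<notin> verts B \<inter> (S - {w})" "mult B a b > 0"
    by (rule connD[OF c, of "verts B \<inter> (S - {w})" x y]) (use xy xS yw in auto)
  have "mult G a b > 0" using ab(4) le[of a b] by simp
  then have "b \<in> S" using edge_from_S ab(1) by blast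
  then show False using ab(2,3) by blast
qed

text \<open>A block of the part is more than \<open>w\<close>, so it is not contained in
  \<open>T\<close>. Any competitor containing it in \<open>G\<close> then stays inside
  \<open>S\<close>, where maximality is known.\<close>

lemma block_of_part:
  assumes "is_block (sub_on G S) B"
  shows "is_block G B" "verts B \<subseteq> S" "\<not> verts B \<subseteq> T"
proof -
  have B: "submultigraph B (sub_on G S)" "mconnected B" "\<forall>v. \<not> cut_vertex B v"
    using assms by (auto simp: is_block_def)
  show BS: "verts B \<subseteq> S" using B(1) by (simp add: submultigraph_def)
  have BG: "submultigraph B G" using B(1) part(3) by (rule submultigraph_trans)
  have "\<not> verts B \<subseteq> {w}"
    using block_not_singleton[OF part(2) mconnected_part assms, of w] w_in ST(3) by simp
  then show nT: "\<not> verts B \<subseteq> T" using BS ST(2) by blast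
  show "is_block G B" unfolding is_block_def
  proof (intro conjI allI impI)
    fix B' assume B': "submultigraph B' G \<and> mconnected B' \<and> (\<forall>v. \<not> cut_vertex B' v) \<and> submultigraph B B'"
    then have "verts B \<subseteq> verts B'" by (simp add: submultigraph_def)
    then have "verts B' \<subseteq> S" using unsplit_subgraph[of B'] B' nT by blast
    then have "submultigraph B' (sub_on G S)" using submultigraph_sub_on_iff[OF _ part(1)] B' by blast
    then show "B' = B" using assms B' unfolding is_block_def by blast
  qed (use B BG in auto)
qed

lemma block_in_part:
  assumes "is_block G B" "verts B \<subseteq> S"
  shows "is_block (sub_on G S) B"
proof -
  have B: "submultigraph B G" "mconnected B" "\<forall>v. \<not> cut_vertex B v"
    "\<And>B'. submultigraph B' G \<Longrightarrow> mconnected B' \<Longrightarrow> \<forall>v. \<not> cut_vertex B' v \<Longrightarrow> submultigraph B B' \<Longrightarrow> B' = B"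
    using assms(1) by (auto simp: is_block_def)
  show ?thesis unfolding is_block_def
  proof (intro conjI allI impI)
    show "submultigraph B (sub_on G S)" using submultigraph_sub_on_iff[OF B(1) part(1)] assms(2) by blast
  next
    fix B' assume B': "submultigraph B' (sub_on G S) \<and> mconnected B' \<and> (\<forall>v. \<not> cut_vertex B' v) \<and> submultigraph B B'"
    then have "submultigraph B' G" using submultigraph_trans[OF _ part(3)] by blast
    then show "B' = B" using B(4) B' by blast
  qed (use B in auto)
qed

end

lemma (in vertex_split) is_block_iff:
  "is_block G B \<longleftrightarrow> is_block (sub_on G S) B \<or> is_block (sub_on G T) B"
proof -
  interpret swap: vertex_split G T S w by (rule vertex_split_swap[OF vertex_split_axioms])
  have "verts B \<subseteq> S \<or> verts B \<subseteq> T" if "is_block G B"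
    using that unsplit_subgraph[of B] by (simp add: is_block_def)
  then show ?thesis using block_of_part(1) swap.block_of_part(1) block_in_part swap.block_in_part by blast
qed

lemma (in vertex_split) blocks_disjoint:
  "\<not> (is_block (sub_on G S) B \<and> is_block (sub_on G T) B)"
proof -
  interpret swap: vertex_split G T S w by (rule vertex_split_swap[OF vertex_split_axioms])
  show ?thesis using block_of_part(3) swap.block_of_part(2) by blast
qed

section \<open>Degrees, lists and colourings on the two sides of a cut vertex\<close>

context vertex_split
begin

lemma mdegree_part:
  assumes "u \<in> S - {w}"
  shows "mdegree (sub_on G S) u = mdegree G u"
proof -
  have "mult G u v = 0" if "v \<in> verts G - S" for v
    using edge_from_S[of u v] assms that by auto
  then have "mdegree G u = (\<Sum>v\<in>S. mult G u v)"
    unfolding mdegree_def using multigraphD(1)[OF mG] part(1) by (intro sum.mono_neutral_right) auto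
  also have "\<dots> = mdegree (sub_on G S) u"
    unfolding mdegree_def using assms by (intro sum.cong) auto
  finally show ?thesis by simp
qed

lemma mdegree_cut: "mdegree G w = mdegree (sub_on G S) w + mdegree (sub_on G T) w"
proof -
  have fin: "finite S" "finite T" using multigraphD(1)[OF mG] ST(1) by (metis finite_Un)+
  have "mdegree G w + mult G w w = (\<Sum>v\<in>S. mult G w v) + (\<Sum>v\<in>T. mult G w v)"
    unfolding mdegree_def ST(1)[symmetric] using sum.union_inter[OF fin, of "mult G w"] ST(2) by simp
  then show ?thesis
    unfolding mdegree_def using w_in multigraphD(3)[OF mG] by simp
qed

lemma list_cover_part:
  assumes "list_cover X G L" "A \<subseteq> L w"
  shows "list_cover X (sub_on G S) (L(w := A))"
proof -
  interpret list_cover X G L by (fact assms(1))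
  have sub: "(L(w := A)) u \<subseteq> L u" for u using assms(2) by simp
  show ?thesis
  proof
    fix u v c assume a: "u \<in> verts (sub_on G S)" "v \<in> verts (sub_on G S)" "u \<noteq> v" "c \<in> (L(w := A)) u"
    then have V: "u \<in> verts G" "v \<in> verts G" "c \<in> L u" "u \<in> S" "v \<in> S" using part(1) sub by auto
    have "nbrs X (L(w := A)) u c v \<subseteq> nbrs X L u c v" using sub[of v] by (auto simp: nbrs_def)
    then have "card (nbrs X (L(w := A)) u c v) \<le> card (nbrs X L u c v)"
      using N_finite[OF V(2)] by (intro card_mono)
    also have "\<dots> \<le> mult G u v" by (rule bound[OF V(1,2) a(3) V(3)])
    finally show "card (nbrs X (L(w := A)) u c v) \<le> mult (sub_on G S) u v" using V by simp
  next
    fix u assume "u \<in> verts (sub_on G S)"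
    then have "u \<in> verts G" using part(1) by auto
    then show "finite ((L(w := A)) u)" using finite_subset[OF sub fin_list] by blast
  next
    fix u c assume "u \<in> verts (sub_on G S)" "c \<in> (L(w := A)) u"
    then show "(u, c) \<in> nodes X" using node[of u c] sub[of u] part(1) by auto
  next
    fix u c c' assume "u \<in> verts (sub_on G S)" "c \<in> (L(w := A)) u" "c' \<in> (L(w := A)) u" "c \<noteq> c'"
    moreover from this have "u \<in> verts G" "c \<in> L u" "c' \<in> L u" using sub[of u] part(1) by auto
    ultimately show "{(u, c), (u, c')} \<in> edges X" using clique by blast
  qed (use part(2) loopless in auto)
qed

lemma combine_colourings:
  assumes "list_cover X G L"
    and \<phi>: "proper_on X L S \<phi>" and \<psi>: "proper_on X L T \<psi>" and eq: "\<phi> w = \<psi> w"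
  shows "\<exists>\<chi>. proper_on X L (verts G) \<chi>"
proof -
  interpret list_cover X G L by (fact assms(1))
  define \<chi> where "\<chi> u = (if u \<in> S then \<phi> u else \<psi> u)" for u
  have \<chi>S: "\<chi> u = \<phi> u" if "u \<in> S" for u using that by (simp add: \<chi>_def)
  have \<chi>T: "\<chi> u = \<psi> u" if "u \<in> T" for u using that eq ST(2) by (auto simp: \<chi>_def)
  have pS: "proper_on X L S \<chi>" using \<phi> \<chi>S by (simp add: proper_on_def)
  have pT: "proper_on X L T \<chi>" using \<psi> \<chi>T by (simp add: proper_on_def)
  have lst: "\<chi> u \<in> L u" if "u \<in> verts G" for u
    using that pS pT ST(1) by (auto simp: proper_on_def)
  have cross: "{(u, \<chi> u), (v, \<chi> v)} \<notin> edges X" if uv: "u \<in> S - {w}" "v \<in> T - {w}" for u v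
  proof -
    have V: "u \<in> verts G" "v \<in> verts G" "u \<noteq> v" using uv ST by auto
    have "card (nbrs X L u (\<chi> u) v) \<le> 0" using bound[OF V lst[OF V(1)]] no_edge[OF uv] by simp
    then have "\<chi> v \<notin> nbrs X L u (\<chi> u) v" using N_finite[OF V(2)] by simp
    then show ?thesis using lst[OF V(2)] by (simp add: nbrs_def)
  qed
  have "proper_on X L (verts G) \<chi>" unfolding proper_on_def
  proof (intro conjI ballI impI)
    fix u v assume uv: "u \<in> verts G" "v \<in> verts G" "u \<noteq> v"
    consider "u \<in> S" "v \<in> S" | "u \<in> T" "v \<in> T" | "u \<in> S - {w}" "v \<in> T - {w}" | "v \<in> S - {w}" "u \<in> T - {w}"
      using uv ST w_in by blast
    then show "{(u, \<chi> u), (v, \<chi> v)} \<notin> edges X"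
    proof cases
      case 4
      show ?thesis using cross[OF 4] by (simp add: insert_commute)
    qed (use pS pT uv cross in \<open>simp_all add: proper_on_def\<close>)
  qed (rule lst)
  then show ?thesis by blast
qed

lemma mem_blocks_part:
  assumes "u \<in> S - {w}"
  shows "{B. is_block G B \<and> u \<in> verts B} = {B. is_block (sub_on G S) B \<and> u \<in> verts B}"
proof -
  interpret swap: vertex_split G T S w by (rule vertex_split_swap[OF vertex_split_axioms])
  have "u \<notin> T" using assms ST(2) by blast
  then have "\<not> is_block (sub_on G T) B" if "u \<in> verts B" for B
    using swap.block_of_part(2)[of B] that by blast
  then show ?thesis unfolding is_block_iff by blast
qed

end

section \<open>The structure theorem\<close>

text \<open>The right-hand side of the theorem regrouped block by block, the form in which it can be
  glued and restricted at a cut vertex.\<close>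

definition gallai_structure ::
  "('v \<times> nat) sgraph \<Rightarrow> 'v mgraph \<Rightarrow> ('v \<Rightarrow> nat set) \<Rightarrow> ('v mgraph \<Rightarrow> 'v \<Rightarrow> nat set) \<Rightarrow> bool" where
  "gallai_structure X G L LB \<longleftrightarrow>
     (\<forall>u\<in>verts G.
        L u = (\<Union>B\<in>{B. is_block G B \<and> u \<in> verts B}. LB B u) \<and>
        disjoint_family_on (\<lambda>B. LB B u) {B. is_block G B \<and> u \<in> verts B}) \<and>
     (\<forall>B. is_block G B \<longrightarrow> obstructed_block X B (LB B))"

lemma gallai_structureD:
  assumes "gallai_structure X G L LB"
  shows "u \<in> verts G \<Longrightarrow> L u = (\<Union>B\<in>{B. is_block G B \<and> u \<in> verts B}. LB B u)"
    "u \<in> verts G \<Longrightarrow> disjoint_family_on (\<lambda>B. LB B u) {B. is_block G B \<and> u \<in> verts B}"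
    "is_block G B \<Longrightarrow> obstructed_block X B (LB B)"
  using assms unfolding gallai_structure_def by blast+

lemma disjoint_family_on_cong:
  assumes "\<And>B. B \<in> I \<Longrightarrow> f B = g B"
  shows "disjoint_family_on f I \<longleftrightarrow> disjoint_family_on g I"
  using assms unfolding disjoint_family_on_def by simp

context vertex_split
begin

lemma glue_structure:
  assumes S: "gallai_structure X (sub_on G S) (L(w := A1)) LB1"
    and T: "gallai_structure X (sub_on G T) (L(w := A2)) LB2"
    and A: "L w = A1 \<union> A2" "A1 \<inter> A2 = {}"
  shows "gallai_structure X G L (\<lambda>B. if is_block (sub_on G S) B then LB1 B else LB2 B)"
proof -
  interpret swap: vertex_split G T S w by (rule vertex_split_swap[OF vertex_split_axioms])
  \<comment> \<open>The case distinction is consistent because no block belongs to both sides, by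
    \<open>blocks_disjoint\<close>.\<close>
  let ?LB = "\<lambda>B. if is_block (sub_on G S) B then LB1 B else LB2 B"
  let ?S = "\<lambda>u. {B. is_block (sub_on G S) B \<and> u \<in> verts B}"
  let ?T = "\<lambda>u. {B. is_block (sub_on G T) B \<and> u \<in> verts B}"
  have LS: "?LB B u = LB1 B u" if "B \<in> ?S u" for B u using that by simp
  have LT: "?LB B u = LB2 B u" if "B \<in> ?T u" for B u using that blocks_disjoint by auto
  have partS: "(L(w := A1)) u = (\<Union>B\<in>?S u. ?LB B u) \<and> disjoint_family_on (\<lambda>B. ?LB B u) (?S u)"
    if "u \<in> S" for u
  proof
    have "(\<Union>B\<in>?S u. ?LB B u) = (\<Union>B\<in>?S u. LB1 B u)" using LS by (rule SUP_cong[OF refl])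
    then show "(L(w := A1)) u = (\<Union>B\<in>?S u. ?LB B u)" using gallai_structureD(1)[OF S, of u] that by simp
    show "disjoint_family_on (\<lambda>B. ?LB B u) (?S u)"
      using gallai_structureD(2)[OF S, of u] that disjoint_family_on_cong[OF LS, of "?S u"] by simp
  qed
  have partT: "(L(w := A2)) u = (\<Union>B\<in>?T u. ?LB B u) \<and> disjoint_family_on (\<lambda>B. ?LB B u) (?T u)"
    if "u \<in> T" for u
  proof
    have "(\<Union>B\<in>?T u. ?LB B u) = (\<Union>B\<in>?T u. LB2 B u)" using LT by (rule SUP_cong[OF refl])
    then show "(L(w := A2)) u = (\<Union>B\<in>?T u. ?LB B u)" using gallai_structureD(1)[OF T, of u] that by simp
    show "disjoint_family_on (\<lambda>B. ?LB B u) (?T u)"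
      using gallai_structureD(2)[OF T, of u] that disjoint_family_on_cong[OF LT, of "?T u"] by simp
  qed
  show ?thesis unfolding gallai_structure_def
  proof (intro conjI allI impI ballI)
    fix B assume "is_block G B"
    then show "obstructed_block X B (?LB B)"
      using is_block_iff gallai_structureD(3)[OF S, of B] gallai_structureD(3)[OF T, of B] by auto
  next
    fix u assume u: "u \<in> verts G"
    have "L u = (\<Union>B\<in>{B. is_block G B \<and> u \<in> verts B}. ?LB B u) \<and>
      disjoint_family_on (\<lambda>B. ?LB B u) {B. is_block G B \<and> u \<in> verts B}"
    proof -
      consider "u \<in> S - {w}" | "u \<in> T - {w}" | "u = w" using u ST(1) by blast
      then show ?thesis
      proof cases
        case 1
        then show ?thesis unfolding mem_blocks_part[OF 1] using partS[of u] by simp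
      next
        case 2
        then show ?thesis unfolding swap.mem_blocks_part[OF 2] using partT[of u] by simp
      next
        case 3
        have blk: "{B. is_block G B \<and> u \<in> verts B} = ?S u \<union> ?T u" unfolding is_block_iff by blast
        have A1: "A1 = (\<Union>B\<in>?S u. ?LB B u)" and A2: "A2 = (\<Union>B\<in>?T u. ?LB B u)"
          and d1: "disjoint_family_on (\<lambda>B. ?LB B u) (?S u)"
          and d2: "disjoint_family_on (\<lambda>B. ?LB B u) (?T u)"
          using partS[OF w_in(1)] partT[OF w_in(2)] unfolding 3 by simp_all
        have "L u = (\<Union>B\<in>?S u \<union> ?T u. ?LB B u)"
          using A(1) 3 unfolding UN_Un A1[symmetric] A2[symmetric] by simp
        moreover have "disjoint_family_on (\<lambda>B. ?LB B u) (?S u \<union> ?T u)"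
          unfolding disjoint_family_on_def
        proof (intro ballI impI)
          fix B B' assume b: "B \<in> ?S u \<union> ?T u" "B' \<in> ?S u \<union> ?T u" "B \<noteq> B'"
          have in1: "?LB D u \<subseteq> A1" if "D \<in> ?S u" for D unfolding A1 using that by (rule UN_upper)
          have in2: "?LB D u \<subseteq> A2" if "D \<in> ?T u" for D unfolding A2 using that by (rule UN_upper)
          consider "B \<in> ?S u" "B' \<in> ?S u" | "B \<in> ?T u" "B' \<in> ?T u" | "B \<in> ?S u" "B' \<in> ?T u"
            | "B \<in> ?T u" "B' \<in> ?S u" using b by blast
          then show "?LB B u \<inter> ?LB B' u = {}"
          proof cases
            case 1
            show ?thesis by (rule disjoint_family_onD[OF d1 1 b(3)])
          next
            case 2
            show ?thesis by (rule disjoint_family_onD[OF d2 2 b(3)])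
          next
            case 3
            show ?thesis using in1[OF 3(1)] in2[OF 3(2)] A(2) by blast
          next
            case 4
            show ?thesis using in2[OF 4(1)] in1[OF 4(2)] A(2) by blast
          qed
        qed
        ultimately show ?thesis unfolding blk by blast
      qed
    qed
    then show "L u = (\<Union>B\<in>{B. is_block G B \<and> u \<in> verts B}. ?LB B u)"
      "disjoint_family_on (\<lambda>B. ?LB B u) {B. is_block G B \<and> u \<in> verts B}" by blast+
  qed
qed

lemma restrict_structure:
  assumes st: "gallai_structure X G L LB"
  shows "gallai_structure X (sub_on G S)
    (L(w := \<Union>B\<in>{B. is_block (sub_on G S) B \<and> w \<in> verts B}. LB B w)) LB"
  unfolding gallai_structure_def
proof (intro conjI allI impI ballI)
  fix B assume "is_block (sub_on G S) B"
  then show "obstructed_block X B (LB B)" using is_block_iff gallai_structureD(3)[OF st] by blast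
next
  fix u assume "u \<in> verts (sub_on G S)"
  then have u: "u \<in> S" "u \<in> verts G" using part(1) by auto
  show "disjoint_family_on (\<lambda>B. LB B u) {B. is_block (sub_on G S) B \<and> u \<in> verts B}"
    by (rule disjoint_family_on_mono[OF _ gallai_structureD(2)[OF st u(2)]]) (use is_block_iff in blast)
  show "(L(w := \<Union>B\<in>{B. is_block (sub_on G S) B \<and> w \<in> verts B}. LB B w)) u
      = (\<Union>B\<in>{B. is_block (sub_on G S) B \<and> u \<in> verts B}. LB B u)"
  proof (cases "u = w")
    case False
    then have "u \<in> S - {w}" using u by blast
    from mem_blocks_part[OF this] gallai_structureD(1)[OF st u(2)] False show ?thesis by simp
  qed simp
qed

end

section \<open>The two inductions over cut vertices\<close>

lemma gallai_structure_if_not_colourable: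
  assumes "list_cover X G L" "mconnected G"
    "\<And>u. u \<in> verts G \<Longrightarrow> mdegree G u \<le> card (L u)"
    "\<nexists>\<phi>. proper_on X L (verts G) \<phi>"
  shows "\<exists>LB. gallai_structure X G L LB"
  using assms
proof (induction "card (verts G)" arbitrary: G L rule: less_induct)
  case less
  interpret list_cover X G L by (fact less.prems(1))
  show ?case
  proof (cases "\<exists>w. cut_vertex G w")
    case False
    then interpret block_cover X G L
      using conn_delete_vertex[OF mgr less.prems(2)] mconnected_iff_conn[OF mgr] less.prems
      by unfold_locales blast+
    have "verts G \<noteq> {}" using less.prems(2) by (simp add: mconnected_def)
    then have ob: "obstructed_block X G L" by (rule obstructed)
    have blk: "is_block G B \<longleftrightarrow> B = G" for B
      using is_block_without_cut_vertex[OF mgr less.prems(2)] False by blast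
    have "gallai_structure X G L (\<lambda>B. L)"
      unfolding gallai_structure_def blk using ob by (auto simp: disjoint_family_on_def)
    then show ?thesis by blast
  next
    case True
    then obtain S T w where "vertex_split G S T w" using cut_vertex_imp_split[OF mgr less.prems(2)] by blast
    then interpret vertex_split G S T w .
    interpret swap: vertex_split G T S w by (rule vertex_split_swap[OF vertex_split_axioms])
    define A where "A U = {c \<in> L w. \<nexists>\<phi>. proper_on X L U \<phi> \<and> \<phi> w = c}" for U
    have AL: "A U \<subseteq> L w" for U by (auto simp: A_def)
    \<comment> \<open>A colour in neither set extends to both sides, and two colourings that agree
      at \<open>w\<close> combine to one of \<open>G\<close>.\<close>
    have "L w \<subseteq> A S \<union> A T"
    proof (rule ccontr)
      assume "\<not> ?thesis"
      then obtain c where "c \<in> L w" "c \<notin> A S" "c \<notin> A T" by blast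
      then obtain \<phi> \<psi> where "proper_on X L S \<phi>" "proper_on X L T \<psi>" "\<phi> w = c" "\<psi> w = c"
        unfolding A_def by blast
      then show False using combine_colourings[OF less.prems(1)] less.prems(4) by metis
    qed
    then have un: "L w = A S \<union> A T" using AL by blast
    have part_bad: "\<nexists>\<phi>. proper_on X (L(w := A U)) U \<phi>" if "w \<in> U" for U
    proof
      assume "\<exists>\<phi>. proper_on X (L(w := A U)) U \<phi>"
      then obtain \<phi> where \<phi>: "proper_on X (L(w := A U)) U \<phi>" by blast
      have "\<phi> u \<in> L u" if "u \<in> U" for u
      proof -
        have "\<phi> u \<in> (L(w := A U)) u" using \<phi> that unfolding proper_on_def by blast
        then show ?thesis using AL[of U] by (auto split: if_splits)
      qed
      then have "proper_on X L U \<phi>" using \<phi> by (simp add: proper_on_def)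
      moreover have "\<phi> w \<in> A U" using \<phi> that by (auto simp: proper_on_def)
      ultimately show False unfolding A_def by blast
    qed
    \<comment> \<open>Greedy colouring towards \<open>w\<close> needs the degree condition only away
      from \<open>w\<close>, so it applies before the size of \<open>A U\<close> is known. A set
      larger than the degree would leave a free colour for \<open>w\<close>.\<close>
    have small: "card (A U) \<le> mdegree (sub_on G U) w"
      if "vertex_split G U U' w" for U U'
    proof -
      interpret U: vertex_split G U U' w by (fact that)
      interpret LU: list_cover X "sub_on G U" "L(w := A U)"
        by (rule U.list_cover_part[OF less.prems(1) AL])
      have "conn (mult (sub_on G U)) U"
        using mconnected_iff_conn[OF U.part(2)] U.mconnected_part by simp
      moreover have "mdegree (sub_on G U) u \<le> card ((L(w := A U)) u)" if "u \<in> U - {w}" for u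
        using U.mdegree_part[OF that] less.prems(3)[of u] that U.part(1) by auto
      ultimately obtain \<psi> where "proper_on X (L(w := A U)) (U - {w}) \<psi>"
        using LU.extend[of U w undefined] U.w_in(1) by (auto simp: proper_on_def)
      then show ?thesis using LU.list_small[of w \<psi>] U.w_in(1) part_bad[of U] by simp
    qed
    have sS: "card (A S) \<le> mdegree (sub_on G S) w" by (rule small[OF vertex_split_axioms])
    have sT: "card (A T) \<le> mdegree (sub_on G T) w" by (rule small[OF swap.vertex_split_axioms])
    have fin: "finite (A S)" "finite (A T)" using AL fin_list[OF w_in(3)] finite_subset by blast+
    have "mdegree (sub_on G S) w + mdegree (sub_on G T) w \<le> card (A S \<union> A T)"
      using less.prems(3)[OF w_in(3)] mdegree_cut un by simp
    moreover have "card (A S \<union> A T) + card (A S \<inter> A T) = card (A S) + card (A T)"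
      using card_Un_Int[OF fin] by simp
    ultimately have eq: "card (A S) = mdegree (sub_on G S) w" "card (A T) = mdegree (sub_on G T) w"
      and "card (A S \<inter> A T) = 0" using sS sT by linarith+
    then have dj: "A S \<inter> A T = {}" using fin by simp
    have rec: "\<exists>LB. gallai_structure X (sub_on G U) (L(w := A U)) LB"
      if "vertex_split G U U' w" and cU: "card (A U) = mdegree (sub_on G U) w" for U U'
    proof -
      interpret U: vertex_split G U U' w by (fact that)
      show ?thesis
      proof (rule less.hyps)
        show "card (verts (sub_on G U)) < card (verts G)" using U.card_part by simp
        show "list_cover X (sub_on G U) (L(w := A U))" by (rule U.list_cover_part[OF less.prems(1) AL])
        show "mconnected (sub_on G U)" by (rule U.mconnected_part)
        show "\<nexists>\<phi>. proper_on X (L(w := A U)) (verts (sub_on G U)) \<phi>" using part_bad U.w_in(1) by simp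
        show "mdegree (sub_on G U) u \<le> card ((L(w := A U)) u)" if "u \<in> verts (sub_on G U)" for u
        proof (cases "u = w")
          case False
          then show ?thesis using U.mdegree_part[of u] less.prems(3)[of u] that U.part(1) by auto
        qed (use cU in simp)
      qed
    qed
    obtain LB1 where LB1: "gallai_structure X (sub_on G S) (L(w := A S)) LB1"
      using rec[OF vertex_split_axioms eq(1)] by blast
    obtain LB2 where LB2: "gallai_structure X (sub_on G T) (L(w := A T)) LB2"
      using rec[OF swap.vertex_split_axioms eq(2)] by blast
    show ?thesis using glue_structure[OF LB1 LB2 un dj] by blast
  qed
qed

text \<open>The colour of \<open>w\<close> lies in the part of its list belonging to one of the
  sides. On that side the colouring remains proper for the shrunk list, against the induction
  hypothesis.\<close>

lemma not_colourable_if_gallai_structure: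
  assumes "list_cover X G L" "mconnected G" "gallai_structure X G L LB"
  shows "\<not> proper_on X L (verts G) \<phi>"
  using assms
proof (induction "card (verts G)" arbitrary: G L rule: less_induct)
  case less
  interpret list_cover X G L by (fact less.prems(1))
  show ?case
  proof (cases "\<exists>w. cut_vertex G w")
    case False
    then have blk: "is_block G B \<longleftrightarrow> B = G" for B
      using is_block_without_cut_vertex[OF mgr less.prems(2)] by blast
    have L: "L u = LB G u" if "u \<in> verts G" for u
    proof -
      have "{B. is_block G B \<and> u \<in> verts B} = {G}" using blk that by auto
      then show ?thesis using gallai_structureD(1)[OF less.prems(3) that] by simp
    qed
    have "obstructed_block X G (LB G)" using gallai_structureD(3)[OF less.prems(3)] blk by blast
    then have "\<not> proper_on X (LB G) (verts G) \<phi>"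
      by (rule obstructed_block_not_colourable) (use node L in blast)
    then show ?thesis using L by (simp add: proper_on_def)
  next
    case True
    then obtain S T w where "vertex_split G S T w" using cut_vertex_imp_split[OF mgr less.prems(2)] by blast
    then interpret vertex_split G S T w .
    interpret swap: vertex_split G T S w by (rule vertex_split_swap[OF vertex_split_axioms])
    define A where "A U = (\<Union>B\<in>{B. is_block (sub_on G U) B \<and> w \<in> verts B}. LB B w)" for U
    have un: "L w = A S \<union> A T"
      using gallai_structureD(1)[OF less.prems(3) w_in(3)] unfolding A_def is_block_iff by blast
    have part: "\<phi> w \<notin> A U" if U: "vertex_split G U U' w" and p: "proper_on X L (verts G) \<phi>" for U U'
    proof
      interpret U: vertex_split G U U' w by (fact U)
      assume wA: "\<phi> w \<in> A U"
      have AL: "A U \<subseteq> L w"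
        using gallai_structureD(1)[OF less.prems(3) w_in(3)] U.is_block_iff unfolding A_def by blast
      have "\<not> proper_on X (L(w := A U)) (verts (sub_on G U)) \<phi>"
      proof (rule less.hyps)
        show "card (verts (sub_on G U)) < card (verts G)" using U.card_part by simp
        show "list_cover X (sub_on G U) (L(w := A U))" by (rule U.list_cover_part[OF less.prems(1) AL])
        show "mconnected (sub_on G U)" by (rule U.mconnected_part)
        show "gallai_structure X (sub_on G U) (L(w := A U)) LB"
          unfolding A_def by (rule U.restrict_structure[OF less.prems(3)])
      qed
      moreover have "proper_on X (L(w := A U)) U \<phi>"
        using p wA U.part(1) unfolding proper_on_def by auto
      ultimately show False by simp
    qed
    show ?thesis
    proof
      assume p: "proper_on X L (verts G) \<phi>"
      then have "\<phi> w \<in> L w" using w_in(3) by (simp add: proper_on_def)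
      then show False
        using un part[OF vertex_split_axioms p] part[OF swap.vertex_split_axioms p] by blast
    qed
  qed
qed

section \<open>Matching assignments\<close>

lemma matching_edge:
  assumes M: "matching_assignment G L M" and xy: "x \<in> verts G" "y \<in> verts G" "x \<noteq> y" and e: "e \<in> M x y"
  shows "\<exists>a b. e = {a, b} \<and> a \<in> fiber x (L x) \<and> b \<in> fiber y (L y)"
proof -
  obtain N where N: "\<forall>i < mult G x y. matching_between (fiber x (L x)) (fiber y (L y)) (N i)"
    "M x y = (\<Union>i < mult G x y. N i)"
    using M xy unfolding matching_assignment_def by meson
  then show ?thesis using e unfolding matching_between_def by blast
qed

text \<open>The ends of a matching edge determine, up to order, the pair of vertices that indexes
  it, and \<open>M\<close> is symmetric; so no other \<open>M x y\<close> contributes edges between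
  these two fibers.\<close>

lemma edge_cover_iff:
  assumes M: "matching_assignment G L M" and uv: "u \<in> verts G" "v \<in> verts G" "u \<noteq> v"
  shows "{(u, c), (v, d)} \<in> edges (cover G L M) \<longleftrightarrow> {(u, c), (v, d)} \<in> M u v"
proof
  assume "{(u, c), (v, d)} \<in> edges (cover G L M)"
  then consider x a b where "{(u, c), (v, d)} = {(x, a), (x, b)}"
    | x y where "{(u, c), (v, d)} \<in> M x y" "x \<in> verts G" "y \<in> verts G" "x \<noteq> y"
    unfolding cover_def by auto
  then show "{(u, c), (v, d)} \<in> M u v"
  proof cases
    case 1
    then show ?thesis using uv(3) by (auto simp: doubleton_eq_iff)
  next
    case 2
    have "M x y = M y x" using M 2(2-4) unfolding matching_assignment_def by blast
    moreover have "\<exists>a b. {(u, c), (v, d)} = {a, b} \<and> a \<in> fiber x (L x) \<and> b \<in> fiber y (L y)"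
      by (rule matching_edge[OF M 2(2-4,1)])
    then have "(x = u \<and> y = v) \<or> (x = v \<and> y = u)"
      using 2(4) by (auto simp: fiber_def doubleton_eq_iff)
    ultimately show ?thesis using 2(1) by auto
  qed
next
  assume "{(u, c), (v, d)} \<in> M u v"
  moreover have "M u v \<in> {M u v | u v. u \<in> verts G \<and> v \<in> verts G \<and> u \<noteq> v}" using uv by blast
  ultimately have "{(u, c), (v, d)} \<in> \<Union>{M u v | u v. u \<in> verts G \<and> v \<in> verts G \<and> u \<noteq> v}"
    by (rule UnionI[rotated])
  then show "{(u, c), (v, d)} \<in> edges (cover G L M)" by (simp add: cover_def)
qed

text \<open>Two edges of a matching that share \<open>x\<close> coincide. Each of the
  \<open>mult G u v\<close> matchings thus gives a colour at most one neighbour, which yields the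
  bound of \<open>list_cover\<close>.\<close>

lemma card_matching_neighbours:
  fixes g :: "'c \<Rightarrow> 'a"
  assumes "matching_between A B N" and "inj g"
  shows "finite {d. {x, g d} \<in> N \<and> g d \<noteq> x}" "card {d. {x, g d} \<in> N \<and> g d \<noteq> x} \<le> 1"
proof -
  have "d = d'" if "{x, g d} \<in> N" "{x, g d'} \<in> N" "g d \<noteq> x" "g d' \<noteq> x" for d d'
  proof -
    have "{x, g d} = {x, g d'}"
      using assms(1) that(1,2) unfolding matching_between_def pairwise_def disjnt_def by blast
    then have "g d = g d'" using that(3,4) by (auto simp: doubleton_eq_iff)
    then show ?thesis using \<open>inj g\<close> by (simp add: inj_eq)
  qed
  then have "\<exists>a. {d. {x, g d} \<in> N \<and> g d \<noteq> x} \<subseteq> {a}" by blast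
  then obtain a where a: "{d. {x, g d} \<in> N \<and> g d \<noteq> x} \<subseteq> {a}" by blast
  show "finite {d. {x, g d} \<in> N \<and> g d \<noteq> x}" using a by (rule finite_subset) simp
  show "card {d. {x, g d} \<in> N \<and> g d \<noteq> x} \<le> 1" using card_mono[OF _ a] by simp
qed

lemma list_cover_cover:
  assumes G: "multigraph G" and L: "list_assignment G L" and M: "matching_assignment G L M"
  shows "list_cover (cover G L M) G L"
proof
  show "multigraph G" by (fact G)
  show "finite (L u)" if "u \<in> verts G" for u
    using L that unfolding list_assignment_def by (meson finite_atLeastAtMost finite_subset)
  show "(u, c) \<in> nodes (cover G L M)" if "u \<in> verts G" "c \<in> L u" for u c
    using that by (auto simp: cover_def fiber_def)
  show "{(u, c), (u, c')} \<in> edges (cover G L M)"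
    if "u \<in> verts G" "c \<in> L u" "c' \<in> L u" "c \<noteq> c'" for u c c'
    using that unfolding cover_def by auto
  show "{p} \<notin> edges (cover G L M)" for p
  proof
    assume "{p} \<in> edges (cover G L M)"
    then consider x a b where "{p} = {(x, a), (x, b)}" "a \<noteq> b"
      | x y where "{p} \<in> M x y" "x \<in> verts G" "y \<in> verts G" "x \<noteq> y"
      unfolding cover_def by auto
    then show False
    proof cases
      case 1
      have "(x, a) \<in> {p}" "(x, b) \<in> {p}" unfolding 1(1) by simp_all
      then have "(x, a) = (x, b)" by (simp only: singleton_iff)
      then show ?thesis using 1(2) by simp
    next
      case 2
      obtain a b where ab: "{p} = {a, b}" "a \<in> fiber x (L x)" "b \<in> fiber y (L y)"
        using matching_edge[OF M 2(2-4,1)] by blast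
      have "a \<in> {p}" "b \<in> {p}" unfolding ab(1) by simp_all
      then have "a = b" by (simp only: singleton_iff)
      then show ?thesis using ab(2,3) 2(4) by (auto simp: fiber_def)
    qed
  qed
  show "card (nbrs (cover G L M) L u c v) \<le> mult G u v"
    if uv: "u \<in> verts G" "v \<in> verts G" "u \<noteq> v" and c: "c \<in> L u" for u v c
  proof -
    obtain N where N: "\<And>i. i < mult G u v \<Longrightarrow> matching_between (fiber u (L u)) (fiber v (L v)) (N i)"
      "M u v = (\<Union>i < mult G u v. N i)"
      using M uv unfolding matching_assignment_def by meson
    define D where "D i = {d. {(u, c), (v, d)} \<in> N i \<and> (v, d) \<noteq> (u, c)}" for i
    have inj: "inj (\<lambda>d. (v, d))" by (simp add: inj_def)
    have D: "finite (D i)" "card (D i) \<le> 1" if "i < mult G u v" for i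
      unfolding D_def by (rule card_matching_neighbours[OF N(1)[OF that] inj])+
    have "nbrs (cover G L M) L u c v \<subseteq> (\<Union>i < mult G u v. D i)"
    proof
      fix d assume "d \<in> nbrs (cover G L M) L u c v"
      then have "{(u, c), (v, d)} \<in> M u v" by (simp add: nbrs_def edge_cover_iff[OF M uv])
      then obtain i where "i < mult G u v" "{(u, c), (v, d)} \<in> N i" unfolding N(2) by blast
      then show "d \<in> (\<Union>i < mult G u v. D i)" using uv(3) by (auto simp: D_def)
    qed
    then have "card (nbrs (cover G L M) L u c v) \<le> card (\<Union>i < mult G u v. D i)"
      using D(1) by (intro card_mono) auto
    also have "\<dots> \<le> (\<Sum>i < mult G u v. card (D i))" by (rule card_UN_le) simp
    also have "\<dots> \<le> (\<Sum>i < mult G u v. 1)" using D(2) by (intro sum_mono) simp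
    finally show ?thesis by simp
  qed
qed

text \<open>An independent set meets every clique at most once, so with as many elements as there
  are vertices it meets each list exactly once and is the graph of a colouring.\<close>

lemma matching_coloring_iff:
  assumes "list_cover (cover G L M) G L"
  shows "(\<exists>I. matching_coloring G L M I) \<longleftrightarrow> (\<exists>\<phi>. proper_on (cover G L M) L (verts G) \<phi>)"
proof -
  interpret list_cover "cover G L M" G L by (fact assms)
  let ?X = "cover G L M"
  show ?thesis
  proof
    assume "\<exists>I. matching_coloring G L M I"
    then obtain I where I: "I \<subseteq> nodes ?X" "\<And>x y. x \<in> I \<Longrightarrow> y \<in> I \<Longrightarrow> {x, y} \<notin> edges ?X"
      "card I = card (verts G)"
      unfolding matching_coloring_def independent_set_def by blast
    have mem: "u \<in> verts G \<and> c \<in> L u" if "(u, c) \<in> I" for u c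
      using I(1) that by (auto simp: cover_def fiber_def)
    have inj: "inj_on fst I"
    proof (rule inj_onI)
      fix p q assume pq: "p \<in> I" "q \<in> I" "fst p = fst q"
      obtain u c d where "p = (u, c)" "q = (u, d)" using pq(3) by (metis prod.collapse)
      then show "p = q" using clique[of u c d] mem[of u c] mem[of u d] I(2)[OF pq(1,2)] pq by auto
    qed
    have "fst ` I = verts G"
      using mem card_image[OF inj] I(3) by (intro card_subset_eq fin_V) auto
    then have "\<exists>c. (u, c) \<in> I" if "u \<in> verts G" for u using that by force
    then obtain \<phi> where \<phi>: "\<And>u. u \<in> verts G \<Longrightarrow> (u, \<phi> u) \<in> I" by metis
    have "proper_on ?X L (verts G) \<phi>"
      unfolding proper_on_def using \<phi> mem I(2) by blast
    then show "\<exists>\<phi>. proper_on ?X L (verts G) \<phi>" by blast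
  next
    assume "\<exists>\<phi>. proper_on ?X L (verts G) \<phi>"
    then obtain \<phi> where \<phi>: "proper_on ?X L (verts G) \<phi>" by blast
    define I where "I = (\<lambda>u. (u, \<phi> u)) ` verts G"
    have "I \<subseteq> nodes ?X" using node \<phi> by (auto simp: I_def proper_on_def)
    moreover have "{x, y} \<notin> edges ?X" if xy: "x \<in> I" "y \<in> I" for x y
    proof -
      obtain u v where "u \<in> verts G" "v \<in> verts G" "x = (u, \<phi> u)" "y = (v, \<phi> v)"
        using xy unfolding I_def by blast
      then show ?thesis using \<phi> loopless[of x] by (cases "u = v") (auto simp: proper_on_def)
    qed
    moreover have "card I = card (verts G)" unfolding I_def by (intro card_image) (simp add: inj_on_def)
    ultimately show "\<exists>I. matching_coloring G L M I"
      unfolding matching_coloring_def independent_set_def by blast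
  qed
qed

text \<open>The cardinality conditions are quantified by vertex and then block on one side, by block
  and then vertex on the other; they agree because the vertices of a block are vertices of
  \<open>G\<close>.\<close>

lemma gallai_structure_iff:
  fixes G :: "'v mgraph"
  shows "(\<exists>LB. gallai_structure X G L LB) \<longleftrightarrow>
    (\<forall>B. is_block G B \<longrightarrow>
       (\<exists>n t. iso_complete_power B n t) \<or> (\<exists>n t. iso_cycle_power B n t)) \<and>
    (\<exists>LB :: 'v mgraph \<Rightarrow> 'v \<Rightarrow> nat set.
       (\<forall>u\<in>verts G.
          L u = (\<Union>B\<in>{B. is_block G B \<and> u \<in> verts B}. LB B u) \<and>
          disjoint_family_on (\<lambda>B. LB B u) {B. is_block G B \<and> u \<in> verts B} \<and>
          (\<forall>B. is_block G B \<and> u \<in> verts B \<longrightarrow>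
             (\<forall>n t. iso_complete_power B n t \<longrightarrow> card (LB B u) = t * (n - 1)) \<and>
             (\<forall>n t. iso_cycle_power B n t \<longrightarrow> card (LB B u) = 2 * t))) \<and>
       (\<forall>B n t. is_block G B \<and> iso_complete_power B n t \<longrightarrow>
          induces_layered X (verts B) (LB B) (H_graph n t) n {1..n - 1} t) \<and>
       (\<forall>B n t. is_block G B \<and> iso_cycle_power B n t \<and> odd n \<longrightarrow>
          induces_layered X (verts B) (LB B) (fat_ladder n t) n {1, 2} t) \<and>
       (\<forall>B n t. is_block G B \<and> iso_cycle_power B n t \<and> even n \<longrightarrow>
          induces_layered X (verts B) (LB B) (fat_Moebius_ladder n t) n {1, 2} t))"
    (is "_ \<longleftrightarrow> ?iso \<and> (\<exists>LB. ?P LB)")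
proof
  assume "\<exists>LB. gallai_structure X G L LB"
  then obtain LB where st: "gallai_structure X G L LB" by blast
  note ob = gallai_structureD(3)[OF st, unfolded obstructed_block_def]
  have ?iso using ob by blast
  moreover have "?P LB"
  proof (intro conjI)
    show "\<forall>u\<in>verts G.
          L u = (\<Union>B\<in>{B. is_block G B \<and> u \<in> verts B}. LB B u) \<and>
          disjoint_family_on (\<lambda>B. LB B u) {B. is_block G B \<and> u \<in> verts B} \<and>
          (\<forall>B. is_block G B \<and> u \<in> verts B \<longrightarrow>
             (\<forall>n t. iso_complete_power B n t \<longrightarrow> card (LB B u) = t * (n - 1)) \<and>
             (\<forall>n t. iso_cycle_power B n t \<longrightarrow> card (LB B u) = 2 * t))"
    proof (intro ballI conjI)
      fix u assume u: "u \<in> verts G"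
      show "L u = (\<Union>B\<in>{B. is_block G B \<and> u \<in> verts B}. LB B u)"
        by (rule gallai_structureD(1)[OF st u])
      show "disjoint_family_on (\<lambda>B. LB B u) {B. is_block G B \<and> u \<in> verts B}"
        by (rule gallai_structureD(2)[OF st u])
    qed (use ob in blast)
  qed (use ob in blast)+
  ultimately show "?iso \<and> (\<exists>LB. ?P LB)" by blast
next
  assume a: "?iso \<and> (\<exists>LB. ?P LB)"
  then obtain LB where P: "?P LB" by blast
  have sub: "u \<in> verts G" if "is_block G B" "u \<in> verts B" for u B
    using that by (auto simp: is_block_def submultigraph_def)
  have "gallai_structure X G L LB" unfolding gallai_structure_def
  proof (intro conjI ballI allI impI)
    fix B assume B: "is_block G B"
    show "obstructed_block X B (LB B)" unfolding obstructed_block_def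
    proof (intro conjI)
      show "(\<exists>n t. iso_complete_power B n t) \<or> (\<exists>n t. iso_cycle_power B n t)" using a B by blast
      show "\<forall>u\<in>verts B.
        (\<forall>n t. iso_complete_power B n t \<longrightarrow> card (LB B u) = t * (n - 1)) \<and>
        (\<forall>n t. iso_cycle_power B n t \<longrightarrow> card (LB B u) = 2 * t)"
        using P B sub[OF B] by blast
    qed (use P B in blast)+
  qed (use P in blast)+
  then show "\<exists>LB. gallai_structure X G L LB" by blast
qed

theorem theorem4:
  fixes G :: "'v mgraph"
    and L :: "'v \<Rightarrow> nat set"
    and M :: "'v \<Rightarrow> 'v \<Rightarrow> ('v \<times> nat) set set"
  assumes "multigraph G"
    and "mconnected G"
    and "degree_list_assignment G L"
    and "matching_assignment G L M"
  shows "(\<nexists>I. matching_coloring G L M I) \<longleftrightarrow>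
    (\<forall>B. is_block G B \<longrightarrow>
       (\<exists>n t. iso_complete_power B n t) \<or> (\<exists>n t. iso_cycle_power B n t)) \<and>
    (\<exists>LB :: 'v mgraph \<Rightarrow> 'v \<Rightarrow> nat set.
       (\<forall>u\<in>verts G.
          L u = (\<Union>B\<in>{B. is_block G B \<and> u \<in> verts B}. LB B u) \<and>
          disjoint_family_on (\<lambda>B. LB B u) {B. is_block G B \<and> u \<in> verts B} \<and>
          (\<forall>B. is_block G B \<and> u \<in> verts B \<longrightarrow>
             (\<forall>n t. iso_complete_power B n t \<longrightarrow> card (LB B u) = t * (n - 1)) \<and>
             (\<forall>n t. iso_cycle_power B n t \<longrightarrow> card (LB B u) = 2 * t))) \<and>
       (\<forall>B n t. is_block G B \<and> iso_complete_power B n t \<longrightarrow>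
          induces_layered (cover G L M) (verts B) (LB B) (H_graph n t) n {1..n - 1} t) \<and>
       (\<forall>B n t. is_block G B \<and> iso_cycle_power B n t \<and> odd n \<longrightarrow>
          induces_layered (cover G L M) (verts B) (LB B) (fat_ladder n t) n {1, 2} t) \<and>
       (\<forall>B n t. is_block G B \<and> iso_cycle_power B n t \<and> even n \<longrightarrow>
          induces_layered (cover G L M) (verts B) (LB B) (fat_Moebius_ladder n t) n {1, 2} t))"
proof -
  have deg: "\<And>u. u \<in> verts G \<Longrightarrow> mdegree G u \<le> card (L u)" and la: "list_assignment G L"
    using assms(3) by (simp_all add: degree_list_assignment_def)
  have lc: "list_cover (cover G L M) G L" by (rule list_cover_cover[OF assms(1) la assms(4)])
  have "(\<nexists>I. matching_coloring G L M I) \<longleftrightarrow> (\<exists>LB. gallai_structure (cover G L M) G L LB)"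
    unfolding matching_coloring_iff[OF lc]
    using gallai_structure_if_not_colourable[OF lc assms(2) deg]
      not_colourable_if_gallai_structure[OF lc assms(2)] by blast
  then show ?thesis unfolding gallai_structure_iff .
qed

end
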